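(* Let $I\subseteq\mathbb C[\mathbf t]=\mathbb C[t_1,\ldots,t_n]$ be a binomial ideal and let $I_{\rho,J}$ be an associated prime of $I$, where $J\subseteq\{1,\ldots,n\}$ and $\rho:L\to\mathbb C^*$ is a partial character defined on a saturated sublattice $L\subseteq\mathbb Z^J\subseteq\mathbb Z^n$. Set $\Phi=\mathbb N^J/L$, and let $\sim$ be the congruence on $\mathbb Z^J\times\mathbb N^{\overline J}$ determined by the ideal $(I+I_\rho)\,\mathbb C[\mathbf t][\mathbf t_J^{-1}]$. 1. Suppose $I_{\rho,J}$ is a minimal prime of $I$, and let $\widetilde U$ be the set of $u\in\mathbb N^n$ whose congruence class in $(\mathbb Z^J\times\mathbb N^{\overline J})/{\sim}$ has infinite image in $\mathbb Z\Phi\times\mathbb N^{\overline J}$. Then the $I_{\rho,J}$-primary component of $I$ is $$\mathcal C_{\rho,J}=\big((I+I_\rho):\mathbf t_J^\infty\big)+\mathbb C\{\widetilde U\}.$$ Now fix a monomial ideal $K\subseteq\mathbb C[t_j\mid j\in\overline J]$ containing a power of each variable $t_j$, $j\in\overline J$; let $\approx$ be the congruence on $\mathbb Z^J\times\mathbb N^{\overline J}$ determined by the ideal $(I+I_\rho+K)\,\mathbb C[\mathbf t][\mathbf t_J^{-1}]$; and let $\widetilde U_K$ be the set of $u\in\mathbb N^n$ whose congruence class in $(\mathbb Z^J\times\mathbb N^{\overline J})/{\approx}$ has infinite image in $\mathbb Z\Phi\times\mathbb N^{\overline J}$. 2. The $I_{\rho,J}$-primary component of the ideal $\langle I+I_\rho+K\rangle\subseteq\mathbb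 C[\mathbf t]$ is $\big((I+I_\rho+K):\mathbf t_J^\infty\big)+\mathbb C\{\widetilde U_K\}$. 3. If $K$ is contained in a sufficiently high power of $\mathfrak m_J$, then $$\mathcal C_{\rho,J}=\big((I+I_\rho+K):\mathbf t_J^\infty\big)+\mathbb C\{\widetilde U_K\}$$ is a valid choice of $I_{\rho,J}$-primary component for $I$. The only monomials in the primary components above are those in $\mathbb C\{\widetilde U\}$ (in item 1) or $\mathbb C\{\widetilde U_K\}$ (in items 2 and 3).
   Context: A binomial ideal is an ideal generated by polynomials of the form $\mathbf t^u-\lambda\mathbf t^v$ with $\lambda\in\mathbb C$ (possibly $0$). A partial character of $\mathbb Z^n$ is a group homomorphism $\rho:L\to\mathbb C^*$ from a sublattice $L\subseteq\mathbb Z^n$; $L$ is saturated if $L=(\mathbb QL)\cap\mathbb Z^n$. Write $u=u_+-u_-$ for the decomposition of an integer vector into its positive and negative parts ($u_\pm$ nonnegative with disjoint supports), and set $I_\rho=\langle\mathbf t^{u_+}-\rho(u)\mathbf t^{u_-}\mid u\in L\rangle\subseteq\mathbb C[\mathbf t]$. For $J\subseteq\{1,\ldots,n\}$, put $\overline J=\{1,\ldots,n\}\smallsetminus J$ and let $\mathbb Z^J,\mathbb N^J,\mathbb N^{\overline J}$ denote the corresponding coordinate subgroup and submonoids of $\mathbb Z^n$, so $\mathbb N^n=\mathbb N^J\times\mathbb N^{\overline J}$. Set $\mathfrak m_J=\langle t_j\mid j\notin J\rangle$ and $I_{\rho,J}=I_\rho+\mathfrak m_J$; for $L\subseteq\mathbb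 Z^J$ saturated this is a prime ideal, and every associated prime of a binomial ideal in $\mathbb C[\mathbf t]$ has this form (Eisenbud–Sturmfels). Set $\mathbf t_J=\prod_{j\in J}t_j$; $\mathbb C[\mathbf t][\mathbf t_J^{-1}]$ is the semigroup ring of $\mathbb Z^J\times\mathbb N^{\overline J}$, and $(I':\mathbf t_J^\infty)=\{f\mid \mathbf t_J^k f\in I'\text{ for some }k\ge 0\}$. $\mathbb N^J/L$ denotes the image of $\mathbb N^J$ in the torsion-free group $\mathbb Z^J/L$, so with $\Phi=\mathbb N^J/L$ one has $\mathbb Z\Phi=\mathbb Z^J/L$; images in $\mathbb Z\Phi\times\mathbb N^{\overline J}$ are taken under the natural map $\mathbb Z^J\times\mathbb N^{\overline J}\to(\mathbb Z^J/L)\times\mathbb N^{\overline J}$. The congruence determined by a binomial ideal $I'$ in the semigroup ring $\mathbb C[Q]$ of a monoid $Q$ is: $u\sim v$ if $\mathbf t^u-\lambda\mathbf t^v\in I'$ for some $\lambda\in\mathbb C^*$. For $S\subseteq\mathbb N^n$ with $\mathbb N^n+S\subseteq S$, $\mathbb C\{S\}$ is the monomial ideal of $\mathbb C[\mathbf t]$ with $\mathbb C$-basis $\{\mathbf t^u\mid u\in S\}$. For a prime $\mathfrak p$ minimal over an ideal $I'$, the $\mathfrak p$-primary component of $I'$ is the kernel of $\mathbb C[\mathbf t]\to(\mathbb C[\mathbf t]/I')_{\mathfrak p}$. A "valid choice of $\mathfrak p$-primary component for $I$", for $\mathfrak p$ an associated prime of $I$, is a $\mathfrak p$-primary ideal that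 occurs as the $\mathfrak p$-primary intersectand in some irredundant primary decomposition of $I$. "Contained in a sufficiently high power" means: there is an integer $e$, depending on $I$ and $I_{\rho,J}$, such that the conclusion holds whenever $K\subseteq\mathfrak m_J^e$. *)

theory Defs
  imports
    "HOL-Library.Poly_Mapping"
    "HOL-Analysis.Cartesian_Space"
    "HOL-Algebra.QuotRing"
    "HOL-Algebra.Ideal_Product"
begin

section \<open>Commutative algebra over a ring record\<close>

definition minimal_prime_over :: "('a, 'b) ring_scheme \<Rightarrow> 'a set \<Rightarrow> 'a set \<Rightarrow> bool" where
  "minimal_prime_over R I P \<longleftrightarrow>
     primeideal P R \<and> I \<subseteq> P \<and> (\<forall>P'. primeideal P' R \<and> I \<subseteq> P' \<and> P' \<subseteq> P \<longrightarrow> P' = P)"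

definition associated_prime :: "('a, 'b) ring_scheme \<Rightarrow> 'a set \<Rightarrow> 'a set \<Rightarrow> bool" where
  "associated_prime R I P \<longleftrightarrow>
     primeideal P R \<and> (\<exists>f\<in>carrier R. P = {g \<in> carrier R. g \<otimes>\<^bsub>R\<^esub> f \<in> I})"

definition radical :: "('a, 'b) ring_scheme \<Rightarrow> 'a set \<Rightarrow> 'a set" where
  "radical R I = {f \<in> carrier R. \<exists>k::nat. k > 0 \<and> f [^]\<^bsub>R\<^esub> k \<in> I}"

definition primary_ideal :: "('a, 'b) ring_scheme \<Rightarrow> 'a set \<Rightarrow> bool" where
  "primary_ideal R Q \<longleftrightarrow> ideal Q R \<and> Q \<noteq> carrier R \<and>
     (\<forall>f\<in>carrier R. \<forall>g\<in>carrier R. f \<otimes>\<^bsub>R\<^esub> g \<in> Q \<longrightarrow> f \<in> Q \<or> g \<in> radical R Q)"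

text \<open>Irredundance asks both that no intersectand can be dropped and that the
  intersectands have pairwise distinct radicals, so that \<^emph>\<open>the\<close> intersectand with a given
  radical makes sense.\<close>

definition irredundant_primary_decomposition ::
    "('a, 'b) ring_scheme \<Rightarrow> 'a set \<Rightarrow> 'a set set \<Rightarrow> bool" where
  "irredundant_primary_decomposition R I \<Q> \<longleftrightarrow>
     finite \<Q> \<and> (\<forall>Q\<in>\<Q>. primary_ideal R Q) \<and> carrier R \<inter> \<Inter>\<Q> = I \<and>
     (\<forall>Q\<in>\<Q>. carrier R \<inter> \<Inter>(\<Q> - {Q}) \<noteq> I) \<and> inj_on (radical R) \<Q>"

definition valid_primary_component ::
    "('a, 'b) ring_scheme \<Rightarrow> 'a set \<Rightarrow> 'a set \<Rightarrow> 'a set \<Rightarrow> bool" where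
  "valid_primary_component R I P C \<longleftrightarrow>
     (\<exists>\<Q>. irredundant_primary_decomposition R I \<Q> \<and> C \<in> \<Q> \<and> radical R C = P)"

text \<open>\<open>fraction R M a s\<close> is the element \<open>a/s\<close> of the localization \<open>M\<^sup>-\<^sup>1R\<close>, as an
  equivalence class of pairs.\<close>

definition fraction_rel :: "('a, 'b) ring_scheme \<Rightarrow> 'a set \<Rightarrow> (('a \<times> 'a) \<times> ('a \<times> 'a)) set" where
  "fraction_rel R M =
     {((a, s), (b, t)). a \<in> carrier R \<and> b \<in> carrier R \<and> s \<in> M \<and> t \<in> M \<and>
        (\<exists>u\<in>M. u \<otimes>\<^bsub>R\<^esub> (t \<otimes>\<^bsub>R\<^esub> a \<ominus>\<^bsub>R\<^esub> s \<otimes>\<^bsub>R\<^esub> b) = \<zero>\<^bsub>R\<^esub>)}"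

definition fraction :: "('a, 'b) ring_scheme \<Rightarrow> 'a set \<Rightarrow> 'a \<Rightarrow> 'a \<Rightarrow> ('a \<times> 'a) set" where
  "fraction R M a s = fraction_rel R M `` {(a, s)}"

text \<open>The kernel of \<open>R \<rightarrow> (R/I)\<^sub>P\<close>: the localization inverts the image in \<open>R/I\<close> of the
  complement of \<open>P\<close>.\<close>

definition primary_component :: "('a, 'b) ring_scheme \<Rightarrow> 'a set \<Rightarrow> 'a set \<Rightarrow> 'a set" where
  "primary_component R I P =
     (let M = (\<lambda>s. I +>\<^bsub>R\<^esub> s) ` (carrier R - P) in
      {f \<in> carrier R.
         fraction (R Quot I) M (I +>\<^bsub>R\<^esub> f) \<one>\<^bsub>R Quot I\<^esub> =
         fraction (R Quot I) M \<zero>\<^bsub>R Quot I\<^esub> \<one>\<^bsub>R Quot I\<^esub>})"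


section \<open>Semigroup rings inside the Laurent polynomial ring\<close>

text \<open>Everything lives in the Laurent polynomial ring \<open>\<complex>[\<int>\<^sup>n]\<close>, with exponent vectors in
  \<^typ>\<open>int ^ 'n\<close>; the semigroup ring \<open>\<complex>[Q]\<close> of a submonoid \<open>Q\<close> consists of the Laurent
  polynomials supported on \<open>Q\<close>. Thus the inclusions between \<open>\<complex>[t]\<close>, its localization at
  \<open>t\<^sub>J\<close> and \<open>\<complex>[t\<^sub>j | j \<notin> J]\<close> are inclusions of sets.\<close>

type_synonym 'n laurent = "(int ^ 'n) \<Rightarrow>\<^sub>0 complex"

definition semigroup_ring :: "(int ^ 'n) set \<Rightarrow> ('n::finite) laurent ring" where
  "semigroup_ring Q =
     \<lparr>carrier = {f. Poly_Mapping.keys f \<subseteq> Q}, mult = (*), one = 1, zero = 0, add = (+)\<rparr>"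

definition monomial :: "int ^ 'n \<Rightarrow> ('n::finite) laurent" where
  "monomial u = Poly_Mapping.single u 1"

definition scalar :: "complex \<Rightarrow> ('n::finite) laurent" where
  "scalar c = Poly_Mapping.single 0 c"

definition monomial_span :: "(int ^ 'n) set \<Rightarrow> ('n::finite) laurent set" where
  "monomial_span S = {f. Poly_Mapping.keys f \<subseteq> S}"

definition nonneg_vecs :: "(int ^ 'n::finite) set" where
  "nonneg_vecs = {u. \<forall>i. u $ i \<ge> 0}"

definition coord_subgroup :: "'n set \<Rightarrow> (int ^ 'n::finite) set" where
  "coord_subgroup J = {u. \<forall>i. i \<notin> J \<longrightarrow> u $ i = 0}"

definition coord_submonoid :: "'n set \<Rightarrow> (int ^ 'n::finite) set" where
  "coord_submonoid J = coord_subgroup J \<inter> nonneg_vecs"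

text \<open>\<open>\<int>\<^sup>J \<times> \<nat>\<^bsup>-J\<^esup>\<close> as a submonoid of \<open>\<int>\<^sup>n\<close>\<close>

definition local_monoid :: "'n set \<Rightarrow> (int ^ 'n::finite) set" where
  "local_monoid J = {u. \<forall>i. i \<notin> J \<longrightarrow> u $ i \<ge> 0}"

definition poly_ring :: "('n::finite) laurent ring" where
  "poly_ring = semigroup_ring nonneg_vecs"

definition local_ring :: "'n set \<Rightarrow> ('n::finite) laurent ring" where
  "local_ring J = semigroup_ring (local_monoid J)"

definition variable :: "'n \<Rightarrow> ('n::finite) laurent" where
  "variable j = monomial (axis j 1)"


section \<open>Binomial ideals and partial characters\<close>

definition binomial_ideal :: "('n::finite) laurent set \<Rightarrow> bool" where
  "binomial_ideal I \<longleftrightarrow>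
     (\<exists>G \<subseteq> {monomial u - scalar c * monomial v | u v c. u \<in> nonneg_vecs \<and> v \<in> nonneg_vecs}.
        I = Idl\<^bsub>poly_ring\<^esub> G)"

definition int_vec_group :: "(int ^ 'n::finite) monoid" where
  "int_vec_group = \<lparr>carrier = UNIV, mult = (+), one = 0\<rparr>"

definition complex_units :: "complex monoid" where
  "complex_units = \<lparr>carrier = UNIV - {0}, mult = (*), one = 1\<rparr>"

text \<open>Values of \<open>\<rho>\<close> outside of \<open>L\<close> are irrelevant.\<close>

definition partial_character :: "(int ^ 'n::finite) set \<Rightarrow> (int ^ 'n \<Rightarrow> complex) \<Rightarrow> bool" where
  "partial_character L \<rho> \<longleftrightarrow>
     subgroup L int_vec_group \<and> \<rho> \<in> hom (int_vec_group\<lparr>carrier := L\<rparr>) complex_units"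

definition rat_vec :: "int ^ 'n \<Rightarrow> rat ^ 'n::finite" where
  "rat_vec u = (\<chi> i. of_int (u $ i))"

definition saturated :: "(int ^ 'n::finite) set \<Rightarrow> bool" where
  "saturated L \<longleftrightarrow> L = {u. rat_vec u \<in> vec.span (rat_vec ` L)}"

definition pos_part :: "int ^ 'n \<Rightarrow> int ^ 'n::finite" where
  "pos_part u = (\<chi> i. max (u $ i) 0)"

definition neg_part :: "int ^ 'n \<Rightarrow> int ^ 'n::finite" where
  "neg_part u = (\<chi> i. max (- (u $ i)) 0)"

definition char_ideal :: "(int ^ 'n::finite) set \<Rightarrow> (int ^ 'n \<Rightarrow> complex) \<Rightarrow> 'n laurent set" where
  "char_ideal L \<rho> =
     Idl\<^bsub>poly_ring\<^esub> {monomial (pos_part u) - scalar (\<rho> u) * monomial (neg_part u) | u. u \<in> L}"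

definition var_ideal :: "'n set \<Rightarrow> ('n::finite) laurent set" where
  "var_ideal J = Idl\<^bsub>poly_ring\<^esub> {variable j | j. j \<notin> J}"

definition char_prime ::
    "(int ^ 'n::finite) set \<Rightarrow> (int ^ 'n \<Rightarrow> complex) \<Rightarrow> 'n set \<Rightarrow> 'n laurent set" where
  "char_prime L \<rho> J = char_ideal L \<rho> <+>\<^bsub>poly_ring\<^esub> var_ideal J"

definition colon_tJ :: "('n::finite) laurent set \<Rightarrow> 'n set \<Rightarrow> 'n laurent set" where
  "colon_tJ I J = {f \<in> carrier poly_ring. \<exists>k::nat. (\<Prod>j\<in>J. variable j) ^ k * f \<in> I}"


section \<open>Congruences and their infinite classes\<close>

definition ideal_congruence ::
    "(int ^ 'n::finite) set \<Rightarrow> 'n laurent set \<Rightarrow> ((int ^ 'n) \<times> (int ^ 'n)) set" where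
  "ideal_congruence Q I =
     {(u, v). u \<in> Q \<and> v \<in> Q \<and> (\<exists>c. c \<noteq> 0 \<and> monomial u - scalar c * monomial v \<in> I)}"

definition coord_part :: "'n set \<Rightarrow> int ^ 'n \<Rightarrow> int ^ 'n::finite" where
  "coord_part J u = (\<chi> i. if i \<in> J then u $ i else 0)"

text \<open>The natural map \<open>\<int>\<^sup>J \<times> \<nat>\<^bsup>-J\<^esup> \<rightarrow> \<int>\<Phi> \<times> \<nat>\<^bsup>-J\<^esup>\<close>, where \<open>\<int>\<Phi> = \<int>\<^sup>J/L\<close> for \<open>\<Phi> = \<nat>\<^sup>J/L\<close>.\<close>

definition quotient_map ::
    "'n set \<Rightarrow> (int ^ 'n::finite) set \<Rightarrow> int ^ 'n \<Rightarrow> (int ^ 'n) set \<times> (int ^ 'n)" where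
  "quotient_map J L u = (L #>\<^bsub>int_vec_group\<^esub> coord_part J u, coord_part (- J) u)"

text \<open>The congruence is that of the extension of \<open>I \<subseteq> \<complex>[t]\<close> to \<open>\<complex>[t][t\<^sub>J\<^sup>-\<^sup>1]\<close>; the classes live
  in \<open>\<int>\<^sup>J \<times> \<nat>\<^bsup>-J\<^esup>\<close>, but only their members \<open>u \<in> \<nat>\<^sup>n\<close> are collected.\<close>

definition infinite_classes ::
    "'n set \<Rightarrow> (int ^ 'n::finite) set \<Rightarrow> 'n laurent set \<Rightarrow> (int ^ 'n) set" where
  "infinite_classes J L I =
     {u \<in> nonneg_vecs. infinite (quotient_map J L `
        (ideal_congruence (local_monoid J) (Idl\<^bsub>local_ring J\<^esub> I) `` {u}))}"

definition component_candidate ::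
    "'n set \<Rightarrow> (int ^ 'n::finite) set \<Rightarrow> 'n laurent set \<Rightarrow> 'n laurent set" where
  "component_candidate J L I =
     colon_tJ I J <+>\<^bsub>poly_ring\<^esub> monomial_span (infinite_classes J L I)"

text \<open>Monomial ideals \<open>K\<close> of the polynomial ring \<open>\<complex>[t\<^sub>j | j \<notin> J]\<close> that contain a power of
  each of its variables; \<open>K\<close> is an ideal of this subring, not of \<open>\<complex>[t]\<close>.\<close>

definition monomial_ideal_with_powers :: "'n set \<Rightarrow> ('n::finite) laurent set \<Rightarrow> bool" where
  "monomial_ideal_with_powers J K \<longleftrightarrow>
     (\<exists>A \<subseteq> coord_submonoid (- J). K = Idl\<^bsub>semigroup_ring (coord_submonoid (- J))\<^esub> (monomial ` A)) \<and>
     (\<forall>j. j \<notin> J \<longrightarrow> (\<exists>k::nat. variable j ^ k \<in> K))"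

end

theory Submission
  imports Defs
begin

text \<open>
  \<^bold>\<open>The shape of the component.\<close>  Let \<open>M = \<int>\<^sup>J \<times> \<nat>\<^bsup>-J\<^esup>\<close>, so that \<open>\<complex>[M]\<close> is the polynomial ring
  with \<open>t\<^sub>J\<close> inverted, let \<open>P = I\<^bsub>\<rho>,J\<^esub>\<close>, and let \<open>B\<close> be the extension to \<open>\<complex>[M]\<close> of a binomial ideal
  between \<open>I\<^sub>\<rho>\<close> and \<open>P\<close> over which \<open>P\<close> is minimal.  Membership in a binomial ideal can be tested on
  each congruence class separately (\<open>binomial_ideal_part\<close>), so \<open>\<complex>[M]/B\<close> is the direct sum of
  at most one line for each class.  On a class that is finite modulo \<open>L\<close> an exponent \<open>d\<close> that
  maps the class to itself must lie in \<open>L\<close>, since \<open>L\<close> is saturated (\<open>finite_class_stabilizer\<close>).  Hence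
  no terms of \<open>s \<notin> P\<close> can interfere on such a class, and \<open>s\<close> is a nonzerodivisor modulo \<open>B\<close>
  and the monomials of the infinite classes (\<open>D_nonzerodivisor\<close>).  Conversely the monomials of an infinite
  class vanish in the localization at \<open>P\<close>: either the class contains multiples of a high power of some
  \<open>t\<^sub>j\<close>, \<open>j \<notin> J\<close>, or it contains two exponents that differ by some \<open>g \<in> \<int>\<^sup>J\<close> outside of \<open>L\<close>, and
  \<open>1 - c t\<^sup>g\<close> is not in the prime (\<open>U_monomial_mem_C\<close>).  This proves the formula for the component.

  \<^bold>\<open>Characteristic zero.\<close>  It remains to see why \<open>I\<^sub>\<rho>\<close> may be added to \<open>I\<close>.  A unit monomial \<open>x\<close> permutes
  the classes up to scalars, so on each orbit it either acts freely or satisfies an equation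
  \<open>x\<^sup>d = c\<close>, which has no multiple roots.  Therefore \<open>(x - 1)\<^sup>2 s \<in> B\<close> implies \<open>(x - 1) s \<in> B\<close>
  (\<open>unit_minus_one_square_cancel\<close>).  The generators of \<open>I\<^sub>\<rho>\<close> have the form \<open>x - 1\<close> up to units; at a
  minimal prime they are nilpotent modulo the component, and hence they belong to it.

  \<^bold>\<open>Embedded primes.\<close>  Let \<open>P\<close> be an arbitrary associated prime and \<open>Y\<close> the intersection of the other
  components.  Elements of \<open>P\<close> have powers that multiply \<open>Y\<close> into \<open>I\<close>, so all \<open>x - 1\<close> multiply
  \<open>Y\<close> into \<open>I\<close> in the localization, and the same cancellation gives \<open>Y \<inter> (I + I\<^sub>\<rho>) \<subseteq> I\<close>
  (\<open>killed_by_lattice_ideal\<close>).  A primary decomposition of the contraction of \<open>I + I\<^sub>\<rho>\<close> then shows that \<open>K\<close> only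
  has to be contained in the components with radical \<open>P\<close> (\<open>embedded_component\<close>).  Primary decompositions
  exist because the polynomial ring is noetherian, which follows from Dickson's lemma.
\<close>

section \<open>Primary decomposition in commutative rings\<close>

context cring
begin

lemma radicalI: "f \<in> carrier R \<Longrightarrow> k > 0 \<Longrightarrow> f [^] (k::nat) \<in> Q \<Longrightarrow> f \<in> radical R Q"
  unfolding radical_def by blast

lemma subset_radical:
  assumes "ideal Q R" shows "Q \<subseteq> radical R Q"
proof
  fix f assume f: "f \<in> Q"
  then have "f \<in> carrier R" using assms by (simp add: ideal.Icarr)
  with f show "f \<in> radical R Q" by (intro radicalI[of f 1]) auto
qed

lemma primary_cancel:
  assumes Q: "primary_ideal R Q" and f: "f \<in> carrier R" and g: "g \<in> carrier R"
    and fg: "f \<otimes> g \<in> Q" and ng: "g \<notin> radical R Q"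
  shows "f \<in> Q"
  using assms unfolding primary_ideal_def by blast

lemma prime_power:
  assumes P: "primeideal P R" and f: "f \<in> carrier R" and k: "f [^] (k::nat) \<in> P"
  shows "f \<in> P"
  using k
proof (induction k)
  case 0
  interpret P: primeideal P R by (rule P)
  from 0 have "P = carrier R" by (simp add: P.one_imp_carrier)
  then show ?case using f by simp
next
  case (Suc k)
  interpret P: primeideal P R by (rule P)
  from Suc show ?case using P.I_prime[of "f [^] k" f] f by auto
qed

lemma radical_subset_prime:
  assumes P: "primeideal P R" and Q: "Q \<subseteq> P" shows "radical R Q \<subseteq> P"
  using prime_power[OF P] Q unfolding radical_def by blast

lemma radical_primary_prime:
  assumes Q: "primary_ideal R Q"
  shows "primeideal (radical R Q) R"
proof -
  have Qi: "ideal Q R" and Qn: "Q \<noteq> carrier R" using Q by (auto simp: primary_ideal_def)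
  interpret Q: ideal Q R by (rule Qi)
  have one: "\<one> \<notin> radical R Q"
    using Qn Q.one_imp_carrier by (auto simp: radical_def)
  have mult: "a \<otimes> b \<in> radical R Q" if "a \<in> radical R Q" "b \<in> carrier R" for a b
  proof -
    from that obtain k :: nat where k: "a \<in> carrier R" "k > 0" "a [^] k \<in> Q"
      by (auto simp: radical_def)
    then have "(a \<otimes> b) [^] k \<in> Q"
      using that by (simp add: nat_pow_distrib Q.I_r_closed)
    then show ?thesis using k that by (intro radicalI[of _ k]) auto
  qed
  \<comment> \<open>an element outside the radical is a nonzerodivisor modulo \<open>Q\<close>, and so are its powers\<close>
  have prime: "a \<in> radical R Q \<or> b \<in> radical R Q"
    if ab: "a \<in> carrier R" "b \<in> carrier R" "a \<otimes> b \<in> radical R Q" for a b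
  proof (rule ccontr)
    assume *: "\<not> (a \<in> radical R Q \<or> b \<in> radical R Q)"
    obtain k :: nat where k: "k > 0" "(a \<otimes> b) [^] k \<in> Q" using ab by (auto simp: radical_def)
    have cancel: "x \<in> Q" if "x \<in> carrier R" "c \<in> carrier R" "c \<notin> radical R Q" "x \<otimes> c [^] (m::nat) \<in> Q"
      for x c m
      using that(4)
    proof (induction m)
      case (Suc m)
      then have "(x \<otimes> c [^] m) \<otimes> c \<in> Q" using that by (simp add: m_assoc)
      then have "x \<otimes> c [^] m \<in> Q"
        by (rule primary_cancel[OF Q _ that(2) _ that(3), rotated]) (intro m_closed nat_pow_closed that(1,2))
      then show ?case by (rule Suc.IH)
    next
      case 0
      then show ?case using that(1) by simp
    qed
    have "a [^] k \<otimes> b [^] k \<in> Q" using k ab by (simp add: nat_pow_distrib)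
    then have "a [^] k \<in> Q" using cancel[of "a [^] k" b k] ab * by simp
    then have "a \<in> radical R Q" using ab k by (intro radicalI[of a k])
    then show False using * by blast
  qed
  have add: "a \<oplus> b \<in> radical R Q" if "a \<in> radical R Q" "b \<in> radical R Q" for a b
  proof -
    from that obtain k m :: nat where k: "a \<in> carrier R" "a [^] k \<in> Q"
      and m: "b \<in> carrier R" "b [^] m \<in> Q" by (auto simp: radical_def)
    \<comment> \<open>an induction in place of the binomial theorem: each factor \<open>a + b\<close> that is multiplied out
      raises one of the two exponents\<close>
    have "(a \<oplus> b) [^] n \<otimes> (a [^] i \<otimes> b [^] j) \<in> Q" if "n + i + j \<ge> k + m" for n i j :: nat
      using that
    proof (induction n arbitrary: i j)
      case 0
      then have "i \<ge> k \<or> j \<ge> m" by linarith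
      then show ?case
      proof
        assume "i \<ge> k"
        then have "a [^] i = a [^] k \<otimes> a [^] (i - k)" using k by (simp add: nat_pow_mult)
        then have "a [^] i \<in> Q" using k by (simp add: Q.I_r_closed)
        then show ?thesis using k m by (simp add: Q.I_r_closed)
      next
        assume "j \<ge> m"
        then have "b [^] j = b [^] m \<otimes> b [^] (j - m)" using m by (simp add: nat_pow_mult)
        then have "b [^] j \<in> Q" using m by (simp add: Q.I_r_closed)
        then show ?thesis using k m by (simp add: Q.I_l_closed)
      qed
    next
      case (Suc n)
      have "(a \<oplus> b) [^] Suc n \<otimes> (a [^] i \<otimes> b [^] j) =
          (a \<oplus> b) [^] n \<otimes> (a [^] Suc i \<otimes> b [^] j) \<oplus> (a \<oplus> b) [^] n \<otimes> (a [^] i \<otimes> b [^] Suc j)"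
        using k m by (simp add: l_distr r_distr m_ac)
      then show ?case using Suc.IH[of "Suc i" j] Suc.IH[of i "Suc j"] Suc.prems
        by (simp add: Q.a_closed)
    qed
    from this[of "k + m" 0 0] have "(a \<oplus> b) [^] (Suc (k + m)) \<in> Q"
      using k m Q.I_r_closed by simp
    then show ?thesis using k m by (intro radicalI[of _ "Suc (k + m)"]) auto
  qed
  show ?thesis
  proof (rule primeidealI)
    show "ideal (radical R Q) R"
    proof (rule idealI)
      show "ring R" by (rule ring_axioms)
      show "subgroup (radical R Q) (add_monoid R)"
      proof (rule subgroup.intro)
        show "radical R Q \<subseteq> carrier (add_monoid R)" by (auto simp: radical_def)
        show "\<one>\<^bsub>add_monoid R\<^esub> \<in> radical R Q" using subset_radical[OF Qi] Q.zero_closed by auto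
        show "inv\<^bsub>add_monoid R\<^esub> x \<in> radical R Q" if "x \<in> radical R Q" for x
        proof -
          have x: "x \<in> carrier R" using that by (simp add: radical_def)
          have "x \<otimes> (\<ominus> \<one>) = \<ominus> x" using x by (simp add: r_minus)
          then show ?thesis using mult[OF that, of "\<ominus> \<one>"] by (simp add: a_inv_def)
        qed
      qed (simp add: add)
      show "x \<otimes> a \<in> radical R Q" "a \<otimes> x \<in> radical R Q" if "a \<in> radical R Q" "x \<in> carrier R" for a x
        using mult[OF that] that by (auto simp: radical_def m_comm)
    qed
    show "cring R" by (rule cring_axioms)
    show "carrier R \<noteq> radical R Q" using one by blast
  qed (rule prime)
qed

text \<open>The product of one witness from each ideal is a common witness.\<close>

lemma prime_contains_Inter:
  assumes P: "primeideal P R" and fin: "finite \<A>"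
    and \<A>: "\<And>A. A \<in> \<A> \<Longrightarrow> ideal A R"
    and not: "\<And>A. A \<in> \<A> \<Longrightarrow> \<not> A \<subseteq> P"
  shows "\<exists>s\<in>carrier R - P. s \<in> \<Inter>\<A>"
  using fin \<A> not
proof (induction \<A> rule: finite_induct)
  case empty
  interpret P: primeideal P R by (rule P)
  from P.I_notcarr P.a_subset show ?case by auto
next
  case (insert A \<A>)
  interpret P: primeideal P R by (rule P)
  obtain s where s: "s \<in> carrier R" "s \<notin> P" "s \<in> \<Inter>\<A>" using insert by auto
  obtain a where a: "a \<in> A" "a \<notin> P" using insert.prems(2) by blast
  have ac: "a \<in> carrier R" using a insert.prems(1) by (auto intro: ideal.Icarr)
  have "s \<otimes> a \<notin> P" using P.I_prime[of s a] s a ac by blast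
  moreover have "s \<otimes> a \<in> B" if "B \<in> insert A \<A>" for B
  proof -
    interpret B: ideal B R using insert.prems(1) that by blast
    show ?thesis
    proof (cases "B = A")
      case True then show ?thesis using a s B.I_l_closed by blast
    next
      case False then show ?thesis using that s ac B.I_r_closed by blast
    qed
  qed
  ultimately show ?case using s ac by (intro bexI[of _ "s \<otimes> a"]) auto
qed

text \<open>The core of the first uniqueness theorem for primary decompositions: as \<open>(I : f)\<close> is the intersection of the ideals \<open>(Q : f)\<close>, each of which is the whole ring or
  primary with the same radical as \<open>Q\<close>, a prime radical of \<open>(I : f)\<close> must be one of these radicals.\<close>

lemma radical_colon_in_radicals:
  assumes fin: "finite \<Q>" and prim: "\<And>Q. Q \<in> \<Q> \<Longrightarrow> primary_ideal R Q"
    and I: "carrier R \<inter> \<Inter>\<Q> = I" and P: "primeideal P R" and f: "f \<in> carrier R"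
    and rad: "\<And>a. a \<in> carrier R \<Longrightarrow> a \<in> P \<longleftrightarrow> (\<exists>k::nat. a [^] k \<otimes> f \<in> I)"
  shows "P \<in> radical R ` {Q \<in> \<Q>. f \<notin> Q}"
proof (rule ccontr)
  assume not: "P \<notin> radical R ` {Q \<in> \<Q>. f \<notin> Q}"
  interpret P: primeideal P R by (rule P)
  have id: "ideal Q R" if "Q \<in> \<Q>" for Q using prim[OF that] by (simp add: primary_ideal_def)
  have "\<not> radical R Q \<subseteq> P" if Q: "Q \<in> \<Q>" "f \<notin> Q" for Q
  proof
    assume sub: "radical R Q \<subseteq> P"
    have "P \<subseteq> radical R Q"
    proof
      fix a assume a: "a \<in> P"
      then have ac: "a \<in> carrier R" by (rule P.Icarr)
      then obtain k :: nat where "a [^] k \<otimes> f \<in> Q" using rad[of a] a I Q by auto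
      then have "f \<otimes> a [^] k \<in> Q" using ac f by (simp add: m_comm)
      then have "a [^] k \<in> radical R Q" using primary_cancel[OF prim[OF Q(1)] f, of "a [^] k"] Q ac by auto
      then show "a \<in> radical R Q" using prime_power[OF radical_primary_prime[OF prim[OF Q(1)]] ac] by blast
    qed
    then show False using not sub Q by auto
  qed
  then have "\<not> Q \<subseteq> P" if "Q \<in> \<Q>" "f \<notin> Q" for Q
    using that prime_power[OF P] unfolding radical_def by blast
  then obtain s where s: "s \<in> carrier R" "s \<notin> P" "s \<in> \<Inter>{Q \<in> \<Q>. f \<notin> Q}"
    using prime_contains_Inter[OF P, of "{Q \<in> \<Q>. f \<notin> Q}"] fin id by auto
  have "s \<otimes> f \<in> Q" if "Q \<in> \<Q>" for Q
  proof -
    interpret Q: ideal Q R using id[OF that] .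
    show ?thesis using s f that Q.I_l_closed Q.I_r_closed by (cases "f \<in> Q") auto
  qed
  then have "s [^] (1::nat) \<otimes> f \<in> I" using I s f by auto
  then show False using rad s by blast
qed

lemma primary_inter:
  assumes A: "primary_ideal R A" and B: "primary_ideal R B" and eq: "radical R A = radical R B"
  shows "primary_ideal R (A \<inter> B)" and "radical R (A \<inter> B) = radical R A"
proof -
  have id: "ideal A R" "ideal B R" using A B by (auto simp: primary_ideal_def)
  show rad: "radical R (A \<inter> B) = radical R A"
  proof
    show "radical R (A \<inter> B) \<subseteq> radical R A" by (auto simp: radical_def)
    show "radical R A \<subseteq> radical R (A \<inter> B)"
    proof
      fix a assume a: "a \<in> radical R A"
      then obtain k m :: nat where k: "a \<in> carrier R" "k > 0" "a [^] k \<in> A" and m: "a [^] m \<in> B"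
        using eq unfolding radical_def by blast
      have "a [^] (k + m) \<in> A \<inter> B"
        using k m id by (simp add: nat_pow_mult [symmetric] ideal.I_l_closed ideal.I_r_closed)
      then show "a \<in> radical R (A \<inter> B)" using k by (intro radicalI[of _ "k + m"]) auto
    qed
  qed
  show "primary_ideal R (A \<inter> B)"
    unfolding primary_ideal_def rad
  proof (intro conjI ballI impI)
    show "ideal (A \<inter> B) R" using i_intersect[OF id] .
    show "A \<inter> B \<noteq> carrier R" using A id(1) by (auto simp: primary_ideal_def dest: ideal.Icarr)
    fix f g assume fg: "f \<in> carrier R" "g \<in> carrier R" "f \<otimes> g \<in> A \<inter> B"
    then show "f \<in> A \<inter> B \<or> g \<in> radical R A"
      using primary_cancel[OF A, of f g] primary_cancel[OF B, of f g] eq by auto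
  qed
qed

end

text \<open>The ascending chain condition, in the form of the induction principle that it gives: a
  statement about ideals may be assumed for all strictly larger ones.\<close>

definition noetherian :: "('a, 'b) ring_scheme \<Rightarrow> bool" where
  "noetherian R \<longleftrightarrow> wf {(B, A). ideal A R \<and> ideal B R \<and> A \<subset> B}"

context cring
begin

definition colon_elem :: "'a set \<Rightarrow> 'a \<Rightarrow> 'a set" where
  "colon_elem I g = {h \<in> carrier R. g \<otimes> h \<in> I}"

lemma colon_elem_ideal:
  assumes "ideal I R" "g \<in> carrier R" shows "ideal (colon_elem I g) R"
proof -
  interpret I: ideal I R by fact
  show ?thesis
  proof (rule idealI)
    show "ring R" by (rule ring_axioms)
    show "subgroup (colon_elem I g) (add_monoid R)"
    proof (rule subgroup.intro)
      show "inv\<^bsub>add_monoid R\<^esub> x \<in> colon_elem I g" if "x \<in> colon_elem I g" for x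
        using that assms(2) by (auto simp: colon_elem_def r_minus simp flip: a_inv_def)
    qed (use assms in \<open>auto simp: colon_elem_def r_distr\<close>)
    show "x \<otimes> a \<in> colon_elem I g" "a \<otimes> x \<in> colon_elem I g" if "a \<in> colon_elem I g" "x \<in> carrier R" for a x
      using that assms(2) I.I_l_closed[of "g \<otimes> a" x] by (auto simp: colon_elem_def m_ac)
  qed
qed

text \<open>The Lasker--Noether theorem.  If \<open>f g \<in> I\<close> shows that \<open>I\<close> is not primary, choose \<open>n\<close> with
  \<open>(I : g\<^sup>n)\<close> as large as possible.  Then \<open>I\<close> is the intersection of the strictly larger ideals
  \<open>(I : g\<^sup>n)\<close> and \<open>I + (g\<^sup>n)\<close>, to which the induction applies.\<close>

lemma noetherian_primary_decomposition:
  assumes N: "noetherian R" and I: "ideal I R"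
  shows "\<exists>\<Q>. finite \<Q> \<and> (\<forall>Q\<in>\<Q>. primary_ideal R Q) \<and> carrier R \<inter> \<Inter>\<Q> = I"
  using N[unfolded noetherian_def] I
proof (induction I rule: wf_induct_rule)
  case (less I)
  interpret I: ideal I R by (rule less.prems)
  show ?case
  proof (cases "I = carrier R \<or> primary_ideal R I")
    case True
    then show ?thesis
    proof
      assume "I = carrier R"
      then show ?thesis by (intro exI[of _ "{}"]) auto
    next
      assume "primary_ideal R I"
      then show ?thesis using I.a_subset by (intro exI[of _ "{I}"]) auto
    qed
  next
    case False
    then obtain f g where fg: "f \<in> carrier R" "g \<in> carrier R" "f \<otimes> g \<in> I" "f \<notin> I" "g \<notin> radical R I"
      using less.prems unfolding primary_ideal_def by blast
    let ?C = "\<lambda>n::nat. colon_elem I (g [^] n)"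
    have Cid: "ideal (?C n) R" for n using colon_elem_ideal[OF less.prems] fg by simp
    have Cmono: "?C m \<subseteq> ?C n" if "m \<le> n" for m n
    proof
      fix h assume h: "h \<in> ?C m"
      have "g [^] n = g [^] (n - m) \<otimes> g [^] m" using that fg by (simp add: nat_pow_mult)
      then show "h \<in> ?C n" using h fg by (auto simp: colon_elem_def m_assoc I.I_l_closed)
    qed
    obtain n where n: "n \<ge> 1" "\<And>m. m \<ge> 1 \<Longrightarrow> \<not> ?C n \<subset> ?C m"
    proof -
      have "?C 1 \<in> ?C ` {1..}" by (rule imageI) simp
      from wfE_min[OF N[unfolded noetherian_def] this] obtain z
        where z: "z \<in> ?C ` {1..}" "\<And>y. (y, z) \<in> {(B, A). ideal A R \<and> ideal B R \<and> A \<subset> B} \<Longrightarrow> y \<notin> ?C ` {1..}"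
        by blast
      from z(1) obtain n where "n \<ge> 1" "z = ?C n" by auto
      then show ?thesis using that z(2) Cid by auto
    qed
    \<comment> \<open>the chain \<open>(I : g\<^sup>m)\<close> is stationary from \<open>n\<close> on, in particular at the exponent \<open>2 n\<close>
      that occurs when an element of \<open>I + (g\<^sup>n)\<close> is multiplied by \<open>g\<^sup>n\<close>\<close>
    have stab: "?C (n + n) = ?C n" using n(2)[of "n+n"] Cmono[of n "n+n"] n(1) by auto
    let ?D = "I <+>\<^bsub>R\<^esub> PIdl (g [^] n)"
    have Did: "ideal ?D R" using add_ideals[OF less.prems cgenideal_ideal] fg by simp
    have ID: "I \<subseteq> ?D"
    proof
      fix x assume "x \<in> I"
      then show "x \<in> ?D" using I.Icarr cgenideal_ideal[of "g [^] n"] fg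
        unfolding set_add_def' using additive_subgroup.zero_closed[OF ideal.axioms(1)]
        by (intro UN_I[of x] UN_I[of \<zero>]) auto
    qed
    have gD: "g [^] n \<in> ?D"
      using fg cgenideal_self[of "g [^] n"] I.zero_closed unfolding set_add_def'
      by (intro UN_I[of \<zero>] UN_I[of "g [^] n"]) auto
    have gI: "g [^] n \<notin> I" using radicalI[of g n I] fg n(1) by auto
    have "I \<subset> ?D" using ID gD gI by blast
    then obtain \<Q>1 where 1: "finite \<Q>1" "\<forall>Q\<in>\<Q>1. primary_ideal R Q" "carrier R \<inter> \<Inter>\<Q>1 = ?D"
      using less.IH[of ?D] less.prems Did by auto
    have IC: "I \<subseteq> ?C n" using fg by (auto simp: colon_elem_def I.I_l_closed)
    have "g [^] n = g [^] (n - 1) \<otimes> g" using n nat_pow_Suc[of g "n-1"] by simp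
    then have "f \<in> ?C n" using fg by (simp add: colon_elem_def m_assoc I.I_l_closed m_comm[of g f])
    then have "I \<subset> ?C n" using IC fg by blast
    then obtain \<Q>2 where 2: "finite \<Q>2" "\<forall>Q\<in>\<Q>2. primary_ideal R Q" "carrier R \<inter> \<Inter>\<Q>2 = ?C n"
      using less.IH[of "?C n"] less.prems Cid by auto
    have "?D \<inter> ?C n \<subseteq> I"
    proof
      fix h assume h: "h \<in> ?D \<inter> ?C n"
      then obtain i r where ir: "i \<in> I" "r \<in> carrier R" "h = i \<oplus> r \<otimes> g [^] n"
        by (auto simp: set_add_def' cgenideal_def)
      have "g [^] n \<otimes> h \<in> I" using h by (auto simp: colon_elem_def)
      moreover have "g [^] (n + n) \<otimes> r = g [^] n \<otimes> h \<ominus> g [^] n \<otimes> i"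
      proof -
        have "g [^] n \<otimes> h = g [^] n \<otimes> i \<oplus> g [^] (n + n) \<otimes> r"
          using ir fg by (simp add: r_distr m_ac nat_pow_mult [symmetric])
        moreover have "y = (x \<oplus> y) \<ominus> x" if "x \<in> carrier R" "y \<in> carrier R" for x y
          using that by (simp add: minus_eq a_comm[of x y] a_assoc r_neg)
        ultimately show ?thesis using ir fg I.Icarr by simp
      qed
      ultimately have "g [^] (n + n) \<otimes> r \<in> I"
        using ir fg by (simp add: minus_eq I.I_l_closed)
      then have "r \<in> ?C n" using stab ir by (auto simp: colon_elem_def)
      then have "r \<otimes> g [^] n \<in> I" using ir fg by (simp add: colon_elem_def m_comm)
      then show "h \<in> I" using ir by simp
    qed
    then have "?D \<inter> ?C n = I" using IC ID by blast
    moreover have "carrier R \<inter> \<Inter>(\<Q>1 \<union> \<Q>2) = (carrier R \<inter> \<Inter>\<Q>1) \<inter> (carrier R \<inter> \<Inter>\<Q>2)"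
      by (simp only: Inter_Un_distrib Int_ac Int_left_absorb Int_absorb)
    ultimately have "carrier R \<inter> \<Inter>(\<Q>1 \<union> \<Q>2) = I" using 1(3) 2(3) by simp
    then show ?thesis using 1 2 by (intro exI[of _ "\<Q>1 \<union> \<Q>2"]) auto
  qed
qed

text \<open>A family of least cardinality is irredundant: an intersectand that can be dropped, or two
  with the same radical, which can be merged, would give a smaller family.\<close>

lemma noetherian_irredundant_decomposition:
  assumes N: "noetherian R" and I: "ideal I R"
  shows "\<exists>\<Q>. irredundant_primary_decomposition R I \<Q>"
proof -
  define dec where "dec \<Q> \<longleftrightarrow> finite \<Q> \<and> (\<forall>Q\<in>\<Q>. primary_ideal R Q) \<and> carrier R \<inter> \<Inter>\<Q> = I" for \<Q>
  obtain \<Q> where Q: "dec \<Q>" and least: "\<And>\<Q>'. dec \<Q>' \<Longrightarrow> card \<Q> \<le> card \<Q>'"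
  proof -
    obtain \<Q>0 where "dec \<Q>0" using noetherian_primary_decomposition[OF assms] by (auto simp: dec_def)
    then show ?thesis using ex_has_least_nat[of dec \<Q>0 card] that by blast
  qed
  have "carrier R \<inter> \<Inter>(\<Q> - {Q}) \<noteq> I" if "Q \<in> \<Q>" for Q
  proof
    assume "carrier R \<inter> \<Inter>(\<Q> - {Q}) = I"
    then have "dec (\<Q> - {Q})" using Q by (auto simp: dec_def)
    from least[OF this] show False using Q that card_Diff1_less[of \<Q> Q] by (auto simp: dec_def)
  qed
  moreover have "inj_on (radical R) \<Q>"
  proof (rule inj_onI, rule ccontr)
    fix A B assume AB: "A \<in> \<Q>" "B \<in> \<Q>" "radical R A = radical R B" "A \<noteq> B"
    have "dec (insert (A \<inter> B) (\<Q> - {A, B}))"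
      using Q AB primary_inter(1)[of A B] unfolding dec_def by auto
    from least[OF this] have le: "card \<Q> \<le> card (insert (A \<inter> B) (\<Q> - {A, B}))" .
    have "finite \<Q>" using Q by (simp add: dec_def)
    then have "card (\<Q> - {A, B}) = card \<Q> - 2" "card \<Q> \<ge> 2"
      using AB card_Diff_subset[of "{A,B}" \<Q>] card_mono[of \<Q> "{A, B}"] by auto
    moreover have "card (insert (A \<inter> B) (\<Q> - {A, B})) \<le> Suc (card (\<Q> - {A, B}))"
      using \<open>finite \<Q>\<close> by (simp add: card_insert_if)
    ultimately show False using le by simp
  qed
  ultimately show ?thesis using Q unfolding irredundant_primary_decomposition_def dec_def by blast
qed

lemma associated_prime_in_radicals:
  assumes "finite \<Q>" "\<And>Q. Q \<in> \<Q> \<Longrightarrow> primary_ideal R Q"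
    and I: "carrier R \<inter> \<Inter>\<Q> = I" and ass: "associated_prime R I P"
  shows "P \<in> radical R ` \<Q>"
proof -
  obtain f where P: "primeideal P R" and f: "f \<in> carrier R" "P = {g \<in> carrier R. g \<otimes> f \<in> I}"
    using ass by (auto simp: associated_prime_def)
  have "a \<in> P \<longleftrightarrow> (\<exists>k::nat. a [^] k \<otimes> f \<in> I)" if a: "a \<in> carrier R" for a
  proof
    assume "a \<in> P"
    then have "a [^] (1::nat) \<otimes> f \<in> I" using f a by auto
    then show "\<exists>k::nat. a [^] k \<otimes> f \<in> I" by blast
  next
    assume "\<exists>k::nat. a [^] k \<otimes> f \<in> I"
    then obtain k :: nat where "a [^] k \<in> P" using f a by auto
    then show "a \<in> P" using prime_power[OF P a] by blast
  qed
  from radical_colon_in_radicals[OF assms(1-3) P f(1) this] show ?thesis by blast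
qed

text \<open>The other intersectands remain necessary: the radical of each of them is the radical of some
  \<open>(I : f)\<close>, and therefore occurs among the radicals of every primary decomposition of \<open>I\<close>.\<close>

lemma exchange_primary_component:
  assumes dec: "irredundant_primary_decomposition R I \<Q>" and Q: "Q \<in> \<Q>"
    and Q': "primary_ideal R Q'" "radical R Q' = radical R Q"
    and eq: "carrier R \<inter> \<Inter>(\<Q> - {Q}) \<inter> Q' = I"
  shows "valid_primary_component R I (radical R Q) Q'"
proof -
  define \<R> where "\<R> = insert Q' (\<Q> - {Q})"
  have fin: "finite \<Q>" and prim: "\<And>A. A \<in> \<Q> \<Longrightarrow> primary_ideal R A"
    and Int: "carrier R \<inter> \<Inter>\<Q> = I" and irr: "\<And>A. A \<in> \<Q> \<Longrightarrow> carrier R \<inter> \<Inter>(\<Q> - {A}) \<noteq> I"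
    and inj: "inj_on (radical R) \<Q>"
    using dec by (auto simp: irredundant_primary_decomposition_def)
  have Q'n: "Q' \<notin> \<Q> - {Q}"
    using inj Q Q'(2) by (auto simp: inj_on_def)
  have RInt: "carrier R \<inter> \<Inter>\<R> = I" using eq by (auto simp: \<R>_def)
  have injR: "inj_on (radical R) \<R>"
    unfolding \<R>_def
  proof (subst inj_on_insert, intro conjI)
    show "inj_on (radical R) (\<Q> - {Q})" using inj by (rule inj_on_subset) auto
    show "radical R Q' \<notin> radical R ` (\<Q> - {Q} - {Q'})"
      using inj Q Q'(2) by (auto simp: inj_on_def)
  qed
  have irrR: "carrier R \<inter> \<Inter>(\<R> - {A}) \<noteq> I" if A: "A \<in> \<R>" for A
  proof (cases "A = Q'")
    case True
    then have "\<R> - {A} = \<Q> - {Q}" using Q'n by (auto simp: \<R>_def)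
    then show ?thesis using irr[OF Q] by simp
  next
    case False
    then have AQ: "A \<in> \<Q>" "A \<noteq> Q" using A by (auto simp: \<R>_def)
    have Aid: "ideal A R" using prim[OF AQ(1)] by (simp add: primary_ideal_def)
    obtain f where f: "f \<in> carrier R" "f \<in> \<Inter>(\<Q> - {A})" "f \<notin> A"
      using irr[OF AQ(1)] Int by blast
    have P: "primeideal (radical R A) R" using radical_primary_prime prim AQ by blast
    have rad: "a \<in> radical R A \<longleftrightarrow> (\<exists>k::nat. a [^] k \<otimes> f \<in> I)" if a: "a \<in> carrier R" for a
    proof
      assume "a \<in> radical R A"
      then obtain k :: nat where k: "a [^] k \<in> A" by (auto simp: radical_def)
      have "a [^] k \<otimes> f \<in> B" if "B \<in> \<Q>" for B
      proof -
        interpret B: ideal B R using prim[OF that] by (simp add: primary_ideal_def)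
        show ?thesis using k f a that B.I_l_closed B.I_r_closed by (cases "B = A") auto
      qed
      then show "\<exists>k::nat. a [^] k \<otimes> f \<in> I" using Int a f by blast
    next
      assume "\<exists>k::nat. a [^] k \<otimes> f \<in> I"
      then obtain k :: nat where "a [^] k \<otimes> f \<in> A" using Int AQ by blast
      then have "f \<otimes> a [^] k \<in> A" using a f by (simp add: m_comm)
      then have "a [^] k \<in> radical R A" using primary_cancel[OF prim[OF AQ(1)], of f "a [^] k"] a f by auto
      then show "a \<in> radical R A" using prime_power[OF P a] by blast
    qed
    show ?thesis
    proof
      assume "carrier R \<inter> \<Inter>(\<R> - {A}) = I"
      then have "radical R A \<in> radical R ` (\<R> - {A})"
        using radical_colon_in_radicals[OF _ _ _ P f(1) rad, of "\<R> - {A}"] fin prim Q'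
        by (auto simp: \<R>_def)
      then show False using injR A by (auto simp: inj_on_def)
    qed
  qed
  have "irredundant_primary_decomposition R I \<R>"
    using fin prim Q' RInt injR irrR unfolding irredundant_primary_decomposition_def \<R>_def by auto
  then show ?thesis unfolding valid_primary_component_def using Q'(2) \<R>_def by blast
qed

subsection \<open>The component at a minimal prime\<close>

text \<open>The kernel of \<open>R \<rightarrow> (R/I)\<^sub>P\<close> without the passage through fractions.\<close>

definition local_kernel :: "'a set \<Rightarrow> 'a set \<Rightarrow> 'a set" where
  "local_kernel I P = {f \<in> carrier R. \<exists>s\<in>carrier R - P. s \<otimes> f \<in> I}"

lemma local_kernel_ideal:
  assumes I: "ideal I R" and P: "primeideal P R"
  shows "ideal (local_kernel I P) R"
proof -
  interpret I: ideal I R by fact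
  interpret P: primeideal P R by fact
  have l: "x \<otimes> a \<in> local_kernel I P" if a: "a \<in> local_kernel I P" and x: "x \<in> carrier R" for a x
  proof -
    obtain s where s: "s \<in> carrier R" "s \<notin> P" "s \<otimes> a \<in> I" "a \<in> carrier R"
      using a by (auto simp: local_kernel_def)
    then have "s \<otimes> (x \<otimes> a) \<in> I" using I.I_l_closed[of "s \<otimes> a" x] x by (simp add: m_ac)
    then show ?thesis using s x by (auto simp: local_kernel_def)
  qed
  show ?thesis
  proof (rule idealI)
    show "ring R" by (rule ring_axioms)
    show "subgroup (local_kernel I P) (add_monoid R)"
    proof (rule subgroup.intro)
      show "local_kernel I P \<subseteq> carrier (add_monoid R)" by (auto simp: local_kernel_def)
      have "\<one> \<notin> P" using P.one_imp_carrier P.I_notcarr by auto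
      then show "\<one>\<^bsub>add_monoid R\<^esub> \<in> local_kernel I P" by (auto simp: local_kernel_def intro!: bexI[of _ \<one>])
      show "inv\<^bsub>add_monoid R\<^esub> x \<in> local_kernel I P" if "x \<in> local_kernel I P" for x
      proof -
        have "x \<in> carrier R" using that by (auto simp: local_kernel_def)
        then have "\<ominus> \<one> \<otimes> x = \<ominus> x" by (simp add: l_minus)
        then show ?thesis using l[OF that, of "\<ominus> \<one>"] by (simp add: a_inv_def)
      qed
      fix a b assume "a \<in> local_kernel I P" "b \<in> local_kernel I P"
      then obtain s t where s: "s \<in> carrier R" "s \<notin> P" "s \<otimes> a \<in> I" "a \<in> carrier R"
        and t: "t \<in> carrier R" "t \<notin> P" "t \<otimes> b \<in> I" "b \<in> carrier R" by (auto simp: local_kernel_def)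
      have "s \<otimes> t \<otimes> (a \<oplus> b) = t \<otimes> (s \<otimes> a) \<oplus> s \<otimes> (t \<otimes> b)" using s t by (simp add: r_distr m_ac)
      then have "s \<otimes> t \<otimes> (a \<oplus> b) \<in> I" using s t by (simp add: I.I_l_closed)
      moreover have "s \<otimes> t \<notin> P" using P.I_prime[of s t] s t by blast
      ultimately show "a \<otimes>\<^bsub>add_monoid R\<^esub> b \<in> local_kernel I P"
        using s t by (auto simp: local_kernel_def)
    qed
    show "x \<otimes> a \<in> local_kernel I P" "a \<otimes> x \<in> local_kernel I P"
      if "a \<in> local_kernel I P" "x \<in> carrier R" for a x
      using l[OF that] that by (auto simp: local_kernel_def m_comm)
  qed
qed

lemma subset_local_kernel:
  assumes I: "ideal I R" and P: "primeideal P R"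
  shows "I \<subseteq> local_kernel I P"
proof
  interpret I: ideal I R by fact
  interpret P: primeideal P R by fact
  have "\<one> \<notin> P" using P.one_imp_carrier P.I_notcarr by auto
  then have "\<one> \<in> carrier R - P" by simp
  moreover have "\<one> \<otimes> f \<in> I" "f \<in> carrier R" if "f \<in> I" for f using that I.Icarr by auto
  ultimately show "f \<in> local_kernel I P" if "f \<in> I" for f
    using that unfolding local_kernel_def by blast
qed

lemma local_kernel_subset:
  assumes P: "primeideal P R" and IP: "I \<subseteq> P"
  shows "local_kernel I P \<subseteq> P"
proof
  interpret P: primeideal P R by fact
  fix f assume "f \<in> local_kernel I P"
  then obtain s where "s \<in> carrier R" "s \<notin> P" "s \<otimes> f \<in> I" "f \<in> carrier R" by (auto simp: local_kernel_def)
  then show "f \<in> P" using P.I_prime[of s f] IP by blast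
qed

lemma fraction_eq_zero_iff:
  assumes M: "M \<subseteq> carrier R" "\<one> \<in> M" "\<And>x y. x \<in> M \<Longrightarrow> y \<in> M \<Longrightarrow> x \<otimes> y \<in> M"
    and a: "a \<in> carrier R"
  shows "fraction R M a \<one> = fraction R M \<zero> \<one> \<longleftrightarrow> (\<exists>u\<in>M. u \<otimes> a = \<zero>)"
proof
  assume eq: "fraction R M a \<one> = fraction R M \<zero> \<one>"
  have "(\<zero>, \<one>) \<in> fraction R M \<zero> \<one>"
    unfolding fraction_def fraction_rel_def using M by (auto simp: minus_eq intro!: bexI[of _ \<one>])
  then have "(\<zero>, \<one>) \<in> fraction R M a \<one>" using eq by simp
  then obtain u where "u \<in> M" "u \<otimes> (\<one> \<otimes> a \<ominus> \<one> \<otimes> \<zero>) = \<zero>"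
    by (auto simp: fraction_def fraction_rel_def)
  then show "\<exists>u\<in>M. u \<otimes> a = \<zero>" using a by (auto simp: minus_eq)
next
  assume "\<exists>u\<in>M. u \<otimes> a = \<zero>"
  then obtain s where s: "s \<in> M" "s \<otimes> a = \<zero>" "s \<in> carrier R" using M by blast
  have eq: "s \<otimes> (t \<otimes> a \<ominus> b) = s \<otimes> (t \<otimes> \<zero> \<ominus> b)" if "t \<in> carrier R" "b \<in> carrier R" for t b
    using that a s m_lcomm[of s t a] by (simp add: minus_eq r_distr)
  have trans: "\<exists>u\<in>M. u \<otimes> (t \<otimes> c \<ominus> b) = \<zero>"
    if tb: "t \<in> carrier R" "b \<in> carrier R" "c \<in> carrier R" "d \<in> carrier R"
      and u: "u \<in> M" "u \<otimes> (t \<otimes> d \<ominus> b) = \<zero>"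
      and cd: "s \<otimes> (t \<otimes> c \<ominus> b) = s \<otimes> (t \<otimes> d \<ominus> b)" for t b u c d
  proof (rule bexI[of _ "u \<otimes> s"])
    have uc: "u \<in> carrier R" using u M by blast
    have "u \<otimes> s \<otimes> (t \<otimes> c \<ominus> b) = u \<otimes> (s \<otimes> (t \<otimes> c \<ominus> b))"
      using uc s(3) tb by (intro m_assoc) auto
    also have "\<dots> = s \<otimes> (u \<otimes> (t \<otimes> d \<ominus> b))"
      unfolding cd using uc s(3) tb by (intro m_lcomm) auto
    finally show "u \<otimes> s \<otimes> (t \<otimes> c \<ominus> b) = \<zero>" using u s by simp
    show "u \<otimes> s \<in> M" using M(3) u s by blast
  qed
  have iff: "(\<exists>u\<in>M. u \<otimes> (t \<otimes> a \<ominus> \<one> \<otimes> b) = \<zero>) \<longleftrightarrow> (\<exists>u\<in>M. u \<otimes> (t \<otimes> \<zero> \<ominus> \<one> \<otimes> b) = \<zero>)"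
    if "t \<in> M" "b \<in> carrier R" for t b
  proof -
    have t: "t \<in> carrier R" using that M(1) by blast
    show ?thesis
      unfolding l_one[OF that(2)]
      using trans[OF t that(2) a zero_closed _ _ eq[OF t that(2)]]
        trans[OF t that(2) zero_closed a _ _ eq[OF t that(2), symmetric]] by blast
  qed
  have "(b, t) \<in> fraction R M a \<one> \<longleftrightarrow> (b, t) \<in> fraction R M \<zero> \<one>" for b t
    unfolding fraction_def fraction_rel_def Image_singleton_iff mem_Collect_eq case_prod_conv
    using a M(2) iff[of t b] zero_closed by blast
  then show "fraction R M a \<one> = fraction R M \<zero> \<one>" by (simp add: set_eq_iff)
qed

lemma primary_component_eq_local_kernel:
  assumes I: "ideal I R" and P: "primeideal P R"
  shows "primary_component R I P = local_kernel I P"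
proof -
  interpret I: ideal I R by fact
  interpret P: primeideal P R by fact
  let ?Q = "R Quot I" and ?M = "(\<lambda>s. I +> s) ` (carrier R - P)"
  interpret Q: cring ?Q using I.quotient_is_cring[OF cring_axioms] .
  interpret h: ring_hom_ring R ?Q "\<lambda>x. I +> x" by (rule I.rcos_ring_hom_ring)
  have Qzero: "\<zero>\<^bsub>?Q\<^esub> = I" by (simp only: FactRing_def ring_record_simps)
  have hm: "(I +> x) \<otimes>\<^bsub>?Q\<^esub> (I +> y) = I +> (x \<otimes> y)" if "x \<in> carrier R" "y \<in> carrier R" for x y
    using h.hom_mult[OF that] by (rule sym)
  have one: "\<one> \<in> carrier R - P" using P.one_imp_carrier P.I_notcarr by auto
  have Mc: "?M \<subseteq> carrier ?Q" by auto
  have Mone: "\<one>\<^bsub>?Q\<^esub> \<in> ?M" using one h.hom_one by (metis imageI)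
  have Mmult: "x \<otimes>\<^bsub>?Q\<^esub> y \<in> ?M" if xM: "x \<in> ?M" and yM: "y \<in> ?M" for x y
  proof -
    obtain s t where st: "s \<in> carrier R - P" "t \<in> carrier R - P" "x = I +> s" "y = I +> t"
      using xM yM by blast
    then have "s \<otimes> t \<in> carrier R - P" using P.I_prime[of s t] by auto
    moreover have "x \<otimes>\<^bsub>?Q\<^esub> y = I +> (s \<otimes> t)"
      unfolding st(3,4) by (rule hm) (use st(1,2) in blast)+
    ultimately show ?thesis by (rule image_eqI[rotated])
  qed
  have zero: "I +> x = \<zero>\<^bsub>?Q\<^esub> \<longleftrightarrow> x \<in> I" if "x \<in> carrier R" for x
  proof -
    show ?thesis using Qzero a_rcos_zero[OF I, of x] I.rcos_const_imp_mem[OF that] by metis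
  qed
  have "fraction ?Q ?M (I +> f) \<one>\<^bsub>?Q\<^esub> = fraction ?Q ?M \<zero>\<^bsub>?Q\<^esub> \<one>\<^bsub>?Q\<^esub> \<longleftrightarrow>
      (\<exists>s\<in>carrier R - P. s \<otimes> f \<in> I)" if f: "f \<in> carrier R" for f
  proof -
    have "fraction ?Q ?M (I +> f) \<one>\<^bsub>?Q\<^esub> = fraction ?Q ?M \<zero>\<^bsub>?Q\<^esub> \<one>\<^bsub>?Q\<^esub> \<longleftrightarrow>
        (\<exists>u\<in>?M. u \<otimes>\<^bsub>?Q\<^esub> (I +> f) = \<zero>\<^bsub>?Q\<^esub>)"
      by (rule Q.fraction_eq_zero_iff[OF Mc Mone Mmult h.hom_closed[OF f]])
    also have "\<dots> \<longleftrightarrow> (\<exists>s\<in>carrier R - P. (I +> s) \<otimes>\<^bsub>?Q\<^esub> (I +> f) = \<zero>\<^bsub>?Q\<^esub>)"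
      by (rule bex_simps(7))
    also have "\<dots> \<longleftrightarrow> (\<exists>s\<in>carrier R - P. s \<otimes> f \<in> I)"
    proof (rule bex_cong[OF refl])
      fix s assume s: "s \<in> carrier R - P"
      then have "(I +> s) \<otimes>\<^bsub>?Q\<^esub> (I +> f) = I +> (s \<otimes> f)" by (intro hm f) blast
      then show "(I +> s) \<otimes>\<^bsub>?Q\<^esub> (I +> f) = \<zero>\<^bsub>?Q\<^esub> \<longleftrightarrow> s \<otimes> f \<in> I"
        using zero[of "s \<otimes> f"] s f by (metis DiffD1 m_closed)
    qed
    finally show ?thesis .
  qed
  then show ?thesis unfolding primary_component_def local_kernel_def Let_def by auto
qed

text \<open>The condition that the elements of \<open>P\<close> are nilpotent modulo the kernel is minimality of \<open>P\<close>
  over \<open>I\<close>, in the form in which it can be checked and used on elements.\<close>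

lemma local_kernel_primary:
  assumes I: "ideal I R" and P: "primeideal P R" and IP: "I \<subseteq> P"
    and nil: "\<And>p. p \<in> P \<Longrightarrow> \<exists>n::nat. p [^] n \<in> local_kernel I P"
  shows "primary_ideal R (local_kernel I P)" and "radical R (local_kernel I P) = P"
proof -
  interpret P: primeideal P R by fact
  let ?K = "local_kernel I P"
  have K: "ideal ?K R" by (rule local_kernel_ideal[OF I P])
  have KP: "?K \<subseteq> P" by (rule local_kernel_subset[OF P IP])
  show rad: "radical R ?K = P"
  proof
    show "radical R ?K \<subseteq> P" by (rule radical_subset_prime[OF P KP])
    show "P \<subseteq> radical R ?K"
    proof
      fix p assume p: "p \<in> P"
      then obtain n :: nat where n: "p [^] n \<in> ?K" using nil by blast
      then have "p [^] Suc n \<in> ?K" using p P.Icarr ideal.I_r_closed[OF K] by auto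
      then show "p \<in> radical R ?K" using p P.Icarr radicalI[of p "Suc n"] by blast
    qed
  qed
  show "primary_ideal R ?K" unfolding primary_ideal_def rad
  proof (intro conjI ballI impI)
    show "ideal ?K R" by (rule K)
    show "?K \<noteq> carrier R" using KP P.I_notcarr P.a_subset by auto
    fix f g assume fg: "f \<in> carrier R" "g \<in> carrier R" "f \<otimes> g \<in> ?K"
    show "f \<in> ?K \<or> g \<in> P"
    proof (cases "g \<in> P")
      case False
      obtain s where s: "s \<in> carrier R" "s \<notin> P" "s \<otimes> (f \<otimes> g) \<in> I" using fg by (auto simp: local_kernel_def)
      then have "(s \<otimes> g) \<otimes> f \<in> I" using fg by (simp add: m_ac)
      moreover have "s \<otimes> g \<notin> P" using P.I_prime[of s g] False s fg by blast
      ultimately show ?thesis using s fg by (auto simp: local_kernel_def)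
    qed simp
  qed
qed

text \<open>Among the primary intersectands of \<open>I\<close> those contained in \<open>P\<close> have radical \<open>P\<close> by minimality, so
  a power of \<open>p\<close> lies in them; the others contain a common element outside of \<open>P\<close>.\<close>

lemma minimal_prime_nilpotent:
  assumes N: "noetherian R" and I: "ideal I R" and min: "minimal_prime_over R I P" and p: "p \<in> P"
  shows "\<exists>n::nat. p [^] n \<in> local_kernel I P"
proof -
  have P: "primeideal P R" and IP: "I \<subseteq> P"
    and least: "\<And>P'. primeideal P' R \<Longrightarrow> I \<subseteq> P' \<Longrightarrow> P' \<subseteq> P \<Longrightarrow> P' = P"
    using min by (auto simp: minimal_prime_over_def)
  interpret P: primeideal P R by fact
  obtain \<Q> where fin: "finite \<Q>" and prim: "\<And>Q. Q \<in> \<Q> \<Longrightarrow> primary_ideal R Q"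
    and Int: "carrier R \<inter> \<Inter>\<Q> = I" using noetherian_primary_decomposition[OF N I] by blast
  have id: "ideal Q R" if "Q \<in> \<Q>" for Q using prim[OF that] by (simp add: primary_ideal_def)
  have dich: "radical R Q = P" if Q: "Q \<in> \<Q>" "Q \<subseteq> P" for Q
  proof (rule least)
    show "primeideal (radical R Q) R" using radical_primary_prime prim Q by blast
    show "I \<subseteq> radical R Q" using subset_radical[OF id] Q Int by blast
    show "radical R Q \<subseteq> P" by (rule radical_subset_prime[OF P Q(2)])
  qed
  have "\<exists>s\<in>carrier R - P. s \<in> \<Inter>{Q \<in> \<Q>. \<not> Q \<subseteq> P}"
    by (rule prime_contains_Inter[OF P]) (use fin id in simp_all)
  then obtain s where s: "s \<in> carrier R" "s \<notin> P" "s \<in> \<Inter>{Q \<in> \<Q>. \<not> Q \<subseteq> P}"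
    by blast
  have pc: "p \<in> carrier R" using p by (rule P.Icarr)
  have "\<exists>n::nat. p [^] n \<in> Q" if "Q \<in> \<Q>" "Q \<subseteq> P" for Q
    using dich[OF that] p by (auto simp: radical_def)
  then obtain n :: "'a set \<Rightarrow> nat" where n: "\<And>Q. Q \<in> \<Q> \<Longrightarrow> Q \<subseteq> P \<Longrightarrow> p [^] n Q \<in> Q" by metis
  define m where "m = Max (insert 0 (n ` \<Q>))"
  have "s \<otimes> p [^] m \<in> Q" if Q: "Q \<in> \<Q>" for Q
  proof -
    interpret Q: ideal Q R using id[OF Q] .
    show ?thesis
    proof (cases "Q \<subseteq> P")
      case True
      have "n Q \<le> m" using fin Q by (auto simp: m_def)
      then have "p [^] m = p [^] (m - n Q) \<otimes> p [^] n Q" using pc by (simp add: nat_pow_mult)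
      then show ?thesis using n[OF Q True] pc s by (simp add: Q.I_l_closed)
    next
      case False then show ?thesis using s Q pc by (auto intro!: Q.I_r_closed)
    qed
  qed
  then have "s \<otimes> p [^] m \<in> I" using Int s pc by auto
  then show ?thesis using s pc by (auto simp: local_kernel_def intro!: exI[of _ m])
qed

end

section \<open>Semigroup rings of exponent monoids\<close>

abbreviation "keys \<equiv> Poly_Mapping.keys"
abbreviation "coeff \<equiv> Poly_Mapping.lookup"

locale exponent_monoid =
  fixes Q :: "(int ^ 'n::finite) set"
  assumes zero_mem: "0 \<in> Q" and add_mem: "u \<in> Q \<Longrightarrow> v \<in> Q \<Longrightarrow> u + v \<in> Q"
begin

lemma semigroup_ring_simps [simp]:
  "carrier (semigroup_ring Q) = {f. keys f \<subseteq> Q}"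
  "mult (semigroup_ring Q) = (*)" "one (semigroup_ring Q) = 1"
  "zero (semigroup_ring Q) = 0" "add (semigroup_ring Q) = (+)"
  by (simp_all add: semigroup_ring_def)

lemma keys_mult_subset: "keys f \<subseteq> Q \<Longrightarrow> keys g \<subseteq> Q \<Longrightarrow> keys (f * g) \<subseteq> Q"
  using keys_mult[of f g] add_mem by blast

lemma keys_add_subset: "keys f \<subseteq> Q \<Longrightarrow> keys g \<subseteq> Q \<Longrightarrow> keys (f + g) \<subseteq> Q"
  using keys_add[of f g] by blast

lemma cring_semigroup_ring: "cring (semigroup_ring Q)"
proof (rule cringI)
  show "abelian_group (semigroup_ring Q)"
  proof (rule abelian_groupI)
    fix x assume "x \<in> carrier (semigroup_ring Q)"
    then have "keys (- x) \<subseteq> Q" by (auto simp: in_keys_iff)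
    then show "\<exists>y\<in>carrier (semigroup_ring Q). y \<oplus>\<^bsub>semigroup_ring Q\<^esub> x = \<zero>\<^bsub>semigroup_ring Q\<^esub>"
      by (intro bexI[of _ "- x"]) auto
  qed (use zero_mem in \<open>auto simp: algebra_simps dest!: keys_add_subset[THEN subsetD, rotated 2]\<close>)
  show "Group.comm_monoid (semigroup_ring Q)"
    by (rule comm_monoidI) (use zero_mem in \<open>auto simp: algebra_simps dest!: keys_mult_subset[THEN subsetD, rotated 2]\<close>)
qed (auto simp: algebra_simps)

sublocale SR: cring "semigroup_ring Q" by (rule cring_semigroup_ring)

lemma a_inv_semigroup_ring: "keys x \<subseteq> Q \<Longrightarrow> \<ominus>\<^bsub>semigroup_ring Q\<^esub> x = - x"
  by (rule SR.minus_equality) (auto simp: in_keys_iff)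

lemma nat_pow_semigroup_ring [simp]: "x [^]\<^bsub>semigroup_ring Q\<^esub> (n::nat) = x ^ n"
  by (induction n) (simp_all add: mult.commute)

lemma ideal_semigroup_ring_iff:
  "ideal I (semigroup_ring Q) \<longleftrightarrow> I \<subseteq> {f. keys f \<subseteq> Q} \<and> 0 \<in> I \<and> (\<forall>a\<in>I. \<forall>b\<in>I. a + b \<in> I) \<and>
     (\<forall>a\<in>I. \<forall>x. keys x \<subseteq> Q \<longrightarrow> x * a \<in> I)" (is "_ \<longleftrightarrow> ?R")
proof
  assume "ideal I (semigroup_ring Q)"
  then interpret I: ideal I "semigroup_ring Q" .
  show ?R using I.a_subset I.zero_closed I.a_closed I.I_l_closed by auto
next
  assume R: ?R
  have neg: "- x \<in> I" if "x \<in> I" for x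
  proof -
    have "keys (- 1 :: 'n laurent) \<subseteq> Q" using zero_mem by (auto simp: in_keys_iff lookup_one when_def)
    then have "- 1 * x \<in> I" using R that by blast
    then show ?thesis by simp
  qed
  show "ideal I (semigroup_ring Q)"
  proof (rule idealI)
    show "ring (semigroup_ring Q)" by (rule SR.ring_axioms)
    show "subgroup I (add_monoid (semigroup_ring Q))"
    proof (rule subgroup.intro)
      show "inv\<^bsub>add_monoid (semigroup_ring Q)\<^esub> x \<in> I" if "x \<in> I" for x
        using neg[OF that] a_inv_semigroup_ring[of x] R that by (auto simp: a_inv_def)
    qed (use R in auto)
    show "x \<otimes>\<^bsub>semigroup_ring Q\<^esub> a \<in> I" "a \<otimes>\<^bsub>semigroup_ring Q\<^esub> x \<in> I"
      if "a \<in> I" "x \<in> carrier (semigroup_ring Q)" for a x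
      using that R by (auto simp: mult.commute)
  qed
qed

lemma
  assumes "ideal I (semigroup_ring Q)"
  shows ideal_keys: "f \<in> I \<Longrightarrow> keys f \<subseteq> Q"
    and ideal_zero: "0 \<in> I"
    and ideal_add: "f \<in> I \<Longrightarrow> g \<in> I \<Longrightarrow> f + g \<in> I"
    and ideal_mult: "f \<in> I \<Longrightarrow> keys x \<subseteq> Q \<Longrightarrow> x * f \<in> I"
  using assms unfolding ideal_semigroup_ring_iff by auto

lemma ideal_uminus:
  assumes "ideal I (semigroup_ring Q)" "f \<in> I" shows "- f \<in> I"
proof -
  have "keys (- 1 :: 'n laurent) \<subseteq> Q" using zero_mem by (auto simp: in_keys_iff lookup_one when_def)
  from ideal_mult[OF assms this] show ?thesis by simp
qed

lemma ideal_diff: "ideal I (semigroup_ring Q) \<Longrightarrow> f \<in> I \<Longrightarrow> g \<in> I \<Longrightarrow> f - g \<in> I"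
  using ideal_add[of I f "- g"] ideal_uminus by simp

lemma ideal_sum:
  assumes "ideal I (semigroup_ring Q)" "\<And>x. x \<in> X \<Longrightarrow> f x \<in> I" shows "sum f X \<in> I"
  using assms by (induction X rule: infinite_finite_induct) (auto simp: ideal_zero ideal_add)

lemma ideal_scalar_mult:
  assumes "ideal I (semigroup_ring Q)" "f \<in> I" shows "Poly_Mapping.single 0 c * f \<in> I"
  using ideal_mult[OF assms, of "Poly_Mapping.single 0 c"] zero_mem by (cases "c = 0") auto

lemma ideal_scalar_cancel:
  assumes "ideal I (semigroup_ring Q)" "Poly_Mapping.single 0 c * f \<in> I" "c \<noteq> 0" shows "f \<in> I"
  using ideal_scalar_mult[OF assms(1,2), of "inverse c"] assms(3)
  by (simp add: mult_single flip: mult.assoc)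

lemma Idl_ideal: "G \<subseteq> {f. keys f \<subseteq> Q} \<Longrightarrow> ideal (Idl\<^bsub>semigroup_ring Q\<^esub> G) (semigroup_ring Q)"
  by (rule SR.genideal_ideal) simp

lemma Idl_superset: "G \<subseteq> {f. keys f \<subseteq> Q} \<Longrightarrow> G \<subseteq> Idl\<^bsub>semigroup_ring Q\<^esub> G"
  by (rule SR.genideal_self) simp

lemma Idl_least: "ideal I (semigroup_ring Q) \<Longrightarrow> G \<subseteq> I \<Longrightarrow> Idl\<^bsub>semigroup_ring Q\<^esub> G \<subseteq> I"
  by (rule SR.genideal_minimal)

lemma sum_of_terms: "f = (\<Sum>m\<in>keys f. Poly_Mapping.single m (coeff f m))"
  by (rule poly_mapping_eqI)
     (simp add: lookup_sum lookup_single when_def in_keys_iff)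

text \<open>As a ring element is a sum of terms, the generated ideal is the additive closure of the
  products of one term and one generator.\<close>

lemma Idl_induct [consumes 2, case_names zero add single]:
  assumes f: "f \<in> Idl\<^bsub>semigroup_ring Q\<^esub> G" and G: "G \<subseteq> {f. keys f \<subseteq> Q}"
    and zero: "X 0" and add: "\<And>f g. X f \<Longrightarrow> X g \<Longrightarrow> X (f + g)"
    and single: "\<And>g m c. g \<in> G \<Longrightarrow> m \<in> Q \<Longrightarrow> X (Poly_Mapping.single m c * g)"
  shows "X f"
proof -
  let ?H = "{f. keys f \<subseteq> Q \<and> (\<forall>m\<in>Q. \<forall>c. X (Poly_Mapping.single m c * f))}"
  have fin: "X (sum h A)" if "\<And>a. a \<in> A \<Longrightarrow> X (h a)" for h :: "_ \<Rightarrow> 'n laurent" and A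
    using that by (induction A rule: infinite_finite_induct) (auto simp: zero add)
  have mult: "Poly_Mapping.single m c * (x * a) =
      (\<Sum>k\<in>keys x. Poly_Mapping.single (m + k) (c * coeff x k) * a)" for m c x a
    by (subst (1) sum_of_terms[of x])
       (simp add: sum_distrib_left sum_distrib_right mult_single flip: mult.assoc)
  have "ideal ?H (semigroup_ring Q)"
    unfolding ideal_semigroup_ring_iff
  proof (intro conjI ballI allI impI)
    show "0 \<in> ?H" using zero by simp
    show "a + b \<in> ?H" if "a \<in> ?H" "b \<in> ?H" for a b
      using that keys_add_subset add by (auto simp: distrib_left)
    show "x * a \<in> ?H" if "a \<in> ?H" "keys x \<subseteq> Q" for a x
    proof -
      have "X (Poly_Mapping.single m c * (x * a))" if "m \<in> Q" for m c
        unfolding mult using \<open>a \<in> ?H\<close> \<open>keys x \<subseteq> Q\<close> that add_mem by (intro fin) auto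
      moreover have "keys (x * a) \<subseteq> Q" using that by (intro keys_mult_subset) auto
      ultimately show ?thesis by blast
    qed
  qed auto
  moreover have "G \<subseteq> ?H" using G single by auto
  ultimately have "f \<in> ?H" using Idl_least f by blast
  then have "X (Poly_Mapping.single 0 1 * f)" using zero_mem by blast
  then show ?thesis by simp
qed

lemma Idl_finite_support:
  assumes f: "f \<in> Idl\<^bsub>semigroup_ring Q\<^esub> G" and G: "G \<subseteq> {f. keys f \<subseteq> Q}"
  shows "\<exists>F \<subseteq> G. finite F \<and> f \<in> Idl\<^bsub>semigroup_ring Q\<^esub> F"
  using f G
proof (induction f rule: Idl_induct)
  case zero
  then show ?case using ideal_zero[OF Idl_ideal] by (intro exI[of _ "{}"]) auto
next
  case (add f g)
  then obtain A B where A: "A \<subseteq> G" "finite A" "f \<in> Idl\<^bsub>semigroup_ring Q\<^esub> A"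
    and B: "B \<subseteq> G" "finite B" "g \<in> Idl\<^bsub>semigroup_ring Q\<^esub> B" by blast
  have AB: "A \<union> B \<subseteq> {f. keys f \<subseteq> Q}" using A B G by blast
  have "f + g \<in> Idl\<^bsub>semigroup_ring Q\<^esub> (A \<union> B)"
    using A B Idl_least[OF Idl_ideal[OF AB], of A] Idl_least[OF Idl_ideal[OF AB], of B]
      Idl_superset[OF AB] by (intro ideal_add[OF Idl_ideal[OF AB]]) auto
  then show ?case using A B by (intro exI[of _ "A \<union> B"]) auto
next
  case (single g m c)
  then have g: "{g} \<subseteq> {f. keys f \<subseteq> Q}" using G by blast
  have "Poly_Mapping.single m c * g \<in> Idl\<^bsub>semigroup_ring Q\<^esub> {g}"
    using single Idl_superset[OF g] by (intro ideal_mult[OF Idl_ideal[OF g]]) auto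
  then show ?case using single by (intro exI[of _ "{g}"]) auto
qed

lemma ideal_sum_set:
  assumes "ideal A (semigroup_ring Q)" "ideal B (semigroup_ring Q)"
  shows "ideal (A <+>\<^bsub>semigroup_ring Q\<^esub> B) (semigroup_ring Q)"
    and "A \<subseteq> A <+>\<^bsub>semigroup_ring Q\<^esub> B" and "B \<subseteq> A <+>\<^bsub>semigroup_ring Q\<^esub> B"
    and "ideal C (semigroup_ring Q) \<Longrightarrow> A \<subseteq> C \<Longrightarrow> B \<subseteq> C \<Longrightarrow> A <+>\<^bsub>semigroup_ring Q\<^esub> B \<subseteq> C"
proof -
  show "ideal (A <+>\<^bsub>semigroup_ring Q\<^esub> B) (semigroup_ring Q)" by (rule SR.add_ideals[OF assms])
  show "A \<subseteq> A <+>\<^bsub>semigroup_ring Q\<^esub> B" "B \<subseteq> A <+>\<^bsub>semigroup_ring Q\<^esub> B"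
    using ideal_zero[OF assms(1)] ideal_zero[OF assms(2)] by (force simp: set_add_def')+
  show "A <+>\<^bsub>semigroup_ring Q\<^esub> B \<subseteq> C" if "ideal C (semigroup_ring Q)" "A \<subseteq> C" "B \<subseteq> C"
    using that ideal_add[OF that(1)] by (auto simp: set_add_def')
qed

end

lemma mem_set_add_semigroup_ring:
  "f \<in> A <+>\<^bsub>semigroup_ring Q\<^esub> B \<longleftrightarrow> (\<exists>a\<in>A. \<exists>b\<in>B. f = a + b)"
  by (auto simp: set_add_def' semigroup_ring_def)

interpretation nonneg: exponent_monoid nonneg_vecs
  by unfold_locales (auto simp: nonneg_vecs_def)

interpretation loc: exponent_monoid "local_monoid J"
  by unfold_locales (auto simp: local_monoid_def)

interpretation coord: exponent_monoid "coord_submonoid J"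
  by unfold_locales (auto simp: coord_submonoid_def coord_subgroup_def nonneg_vecs_def)

section \<open>The polynomial ring is noetherian\<close>

lemma monotone_subsequence_nat:
  fixes f :: "nat \<Rightarrow> nat"
  shows "\<exists>g :: nat \<Rightarrow> nat. strict_mono g \<and> mono (\<lambda>k. f (g k))"
proof -
  obtain g where g: "strict_mono g" "monoseq (\<lambda>k. f (g k))" using seq_monosub by blast
  show ?thesis
  proof (cases "\<forall>m n. m \<le> n \<longrightarrow> f (g m) \<le> f (g n)")
    case True
    then have "mono (\<lambda>k. f (g k))" by (simp add: mono_def)
    then show ?thesis using g(1) by blast
  next
    case False
    then have dec: "\<And>m n. m \<le> n \<Longrightarrow> f (g n) \<le> f (g m)" using g(2) by (auto simp: monoseq_def)
    \<comment> \<open>a decreasing sequence of natural numbers is constant once it takes its least value\<close>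
    obtain k where k: "\<And>m. f (g k) \<le> f (g m)"
      using ex_has_least_nat[of "\<lambda>_. True" undefined "\<lambda>m. f (g m)"] by auto
    have "f (g (i + k)) = f (g k)" for i using dec[of k "i + k"] k[of "i + k"] by simp
    moreover have "strict_mono (\<lambda>i. g (i + k))" using g(1) by (simp add: strict_mono_def)
    ultimately show ?thesis by (intro exI[of _ "\<lambda>i. g (i + k)"]) (simp add: mono_def)
  qed
qed

text \<open>Dickson's lemma: pass to a subsequence on which the first coordinate is nondecreasing, then to a
  further one for the second coordinate, and so on.\<close>

lemma dickson:
  fixes f :: "nat \<Rightarrow> int ^ 'n::finite"
  assumes nn: "\<And>k. f k \<in> nonneg_vecs"
  shows "\<exists>i j. i < j \<and> (\<forall>l. f i $ l \<le> f j $ l)"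
proof -
  have "\<exists>g :: nat \<Rightarrow> nat. strict_mono g \<and> (\<forall>l\<in>X. mono (\<lambda>k. f (g k) $ l))" if "finite X" for X :: "'n set"
    using that
  proof (induction X rule: finite_induct)
    case empty
    show ?case using strict_mono_id by blast
  next
    case (insert x X)
    then obtain g :: "nat \<Rightarrow> nat" where g: "strict_mono g" "\<And>l. l \<in> X \<Longrightarrow> mono (\<lambda>k. f (g k) $ l)" by blast
    obtain h :: "nat \<Rightarrow> nat" where h: "strict_mono h" "mono (\<lambda>k. nat (f (g (h k)) $ x))"
      using monotone_subsequence_nat[of "\<lambda>k. nat (f (g k) $ x)"] by blast
    have "mono (\<lambda>k. f (g (h k)) $ x)"
      using h(2) nn by (auto simp: mono_def nonneg_vecs_def nat_le_eq_zle)
    moreover have "mono (\<lambda>k. f (g (h k)) $ l)" if "l \<in> X" for l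
      using g(2)[OF that] h(1) by (auto simp: mono_def strict_mono_less_eq)
    moreover have "strict_mono (\<lambda>k. g (h k))" using g(1) h(1) by (simp add: strict_mono_def)
    ultimately show ?case by (intro exI[of _ "\<lambda>k. g (h k)"]) auto
  qed
  from this[of UNIV] obtain g :: "nat \<Rightarrow> nat" where "strict_mono g" "\<And>l. mono (\<lambda>k. f (g k) $ l)" by auto
  then show ?thesis by (intro exI[of _ "g 0"] exI[of _ "g 1"]) (auto simp: strict_mono_def mono_def)
qed

text \<open>The exponents are ordered lexicographically.  The index type carries no order, so an arbitrary
  enumeration of the coordinates is fixed.\<close>

definition coord_enum :: "nat \<Rightarrow> 'n::finite" where
  "coord_enum = (SOME h. bij_betw h {..<CARD('n)} UNIV)"

lemma coord_enum: "bij_betw (coord_enum :: nat \<Rightarrow> 'n::finite) {..<CARD('n)} UNIV"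
proof -
  have "\<exists>h. bij_betw h {..<CARD('n)} (UNIV :: 'n set)"
    using finite_same_card_bij[of "{..<CARD('n)}" "UNIV :: 'n set"] by simp
  then show ?thesis unfolding coord_enum_def by (rule someI_ex)
qed

definition lex_less :: "int ^ 'n \<Rightarrow> int ^ 'n::finite \<Rightarrow> bool" where
  "lex_less u v \<longleftrightarrow> (\<exists>i<CARD('n). (\<forall>k<i. u $ coord_enum k = v $ coord_enum k) \<and>
      u $ coord_enum i < v $ coord_enum i)"

lemma lex_less_trans: "lex_less u v \<Longrightarrow> lex_less v w \<Longrightarrow> lex_less u w"
  unfolding lex_less_def
proof (elim exE conjE)
  fix i j assume i: "i < CARD('a)" "\<forall>k<i. u $ coord_enum k = v $ coord_enum k" "u $ coord_enum i < v $ coord_enum i"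
    and j: "j < CARD('a)" "\<forall>k<j. v $ coord_enum k = w $ coord_enum k" "v $ coord_enum j < w $ coord_enum j"
  show "\<exists>i<CARD('a). (\<forall>k<i. u $ coord_enum k = w $ coord_enum k) \<and> u $ coord_enum i < w $ coord_enum i"
    using i j by (intro exI[of _ "min i j"]) (cases i j rule: linorder_cases; auto)
qed

lemma lex_less_add: "lex_less u v \<longleftrightarrow> lex_less (w + u) (w + v)"
  by (simp add: lex_less_def)

lemma lex_less_total: "u = v \<or> lex_less u v \<or> lex_less v u"
proof (rule ccontr)
  assume *: "\<not> (u = v \<or> lex_less u v \<or> lex_less v u)"
  then obtain l where "u $ l \<noteq> v $ l" by (auto simp: vec_eq_iff)
  moreover obtain i where "i < CARD('a)" "l = coord_enum i"
    using bij_betw_imp_surj_on[OF coord_enum] by (metis UNIV_I imageE lessThan_iff)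
  ultimately have "\<exists>i. i < CARD('a) \<and> u $ coord_enum i \<noteq> v $ coord_enum i" by blast
  from exists_least_iff[THEN iffD1, OF this] obtain i where
    i: "i < CARD('a)" "u $ coord_enum i \<noteq> v $ coord_enum i" "\<forall>k<i. \<not> (k < CARD('a) \<and> u $ coord_enum k \<noteq> v $ coord_enum k)"
    by blast
  then have "\<forall>k<i. u $ coord_enum k = v $ coord_enum k" by auto
  then have "lex_less u v \<or> lex_less v u" unfolding lex_less_def using i
    by (metis linorder_neqE)
  then show False using * by blast
qed

lemma lex_less_not_ge: "lex_less u v \<Longrightarrow> \<exists>l. u $ l < v $ l"
  by (auto simp: lex_less_def)

text \<open>In an infinite descending sequence of nonnegative vectors some later member would dominate an
  earlier one in every coordinate, by Dickson's lemma.\<close>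

lemma wf_lex_less: "wf {(u, v :: int ^ 'n::finite). u \<in> nonneg_vecs \<and> v \<in> nonneg_vecs \<and> lex_less u v}"
  unfolding wf_iff_no_infinite_down_chain
proof
  assume "\<exists>f. \<forall>i. (f (Suc i), f i) \<in> {(u, v :: int ^ 'n::finite). u \<in> nonneg_vecs \<and> v \<in> nonneg_vecs \<and> lex_less u v}"
  then obtain f :: "nat \<Rightarrow> int ^ 'n" where f: "\<And>i. f i \<in> nonneg_vecs" "\<And>i. lex_less (f (Suc i)) (f i)" by auto
  have "lex_less (f (i + Suc k)) (f i)" for i k
  proof (induction k)
    case (Suc k)
    then show ?case using f(2)[of "i + Suc k"] lex_less_trans by auto
  qed (use f(2) in auto)
  then have dec: "lex_less (f j) (f i)" if "i < j" for i j
    using less_imp_Suc_add[OF that] by auto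
  obtain i j where "i < j" "\<forall>l. f i $ l \<le> f j $ l" using dickson[of f] f by blast
  with lex_less_not_ge[OF dec[OF \<open>i < j\<close>]] show False by (meson not_le)
qed

definition leading_exponent :: "'n::finite laurent \<Rightarrow> int ^ 'n \<Rightarrow> bool" where
  "leading_exponent f u \<longleftrightarrow> u \<in> keys f \<and> (\<forall>v\<in>keys f. v = u \<or> lex_less v u)"

lemma leading_exponent_exists:
  assumes "f \<noteq> 0" shows "\<exists>u. leading_exponent f u"
proof -
  have "\<exists>u\<in>X. \<forall>v\<in>X. v = u \<or> lex_less v u" if "finite X" "X \<noteq> {}" for X :: "(int ^ 'a) set"
    using that
  proof (induction X rule: finite_ne_induct)
    case (insert x X)
    then obtain u where u: "u \<in> X" "\<forall>v\<in>X. v = u \<or> lex_less v u" by blast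
    show ?case
    proof (cases "lex_less u x")
      case True
      then have "\<forall>v\<in>insert x X. v = x \<or> lex_less v x" using u(2) lex_less_trans by (metis insert_iff)
      then show ?thesis by blast
    next
      case False
      then have "\<forall>v\<in>insert x X. v = u \<or> lex_less v u" using u lex_less_total[of x u] by auto
      then show ?thesis using u(1) by blast
    qed
  qed auto
  from this[of "keys f"] show ?thesis using assms by (auto simp: leading_exponent_def)
qed

text \<open>In a strictly ascending chain of ideals pick at each step a new element with least possible
  leading exponent.  By Dickson's lemma one of these exponents is a translate of an earlier one,
  and cancelling the leading term produces a new element with smaller leading exponent.\<close>

lemma noetherian_poly_ring: "noetherian (poly_ring :: 'n::finite laurent ring)"
  unfolding noetherian_def wf_iff_no_infinite_down_chain
proof
  assume "\<exists>A. \<forall>i. (A (Suc i), A i) \<in> {(B, A). ideal A (poly_ring :: 'n laurent ring) \<and> ideal B poly_ring \<and> A \<subset> B}"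
  then obtain A :: "nat \<Rightarrow> 'n laurent set" where
    id: "\<And>i. ideal (A i) (semigroup_ring nonneg_vecs)" and sub: "\<And>i. A i \<subset> A (Suc i)"
    unfolding poly_ring_def by blast
  have mono: "A i \<subseteq> A j" if "i \<le> j" for i j
    using that by (induction rule: dec_induct) (use sub in blast)+
  let ?X = "\<lambda>k. {u. \<exists>f. f \<in> A (Suc k) - A k \<and> leading_exponent f u}"
  have nn: "u \<in> nonneg_vecs" if "u \<in> ?X k" for u k
    using that nonneg.ideal_keys[OF id] by (auto simp: leading_exponent_def)
  have "\<exists>f u. f \<in> A (Suc k) - A k \<and> leading_exponent f u \<and> (\<forall>v\<in>?X k. \<not> lex_less v u)" for k
  proof -
    obtain f where "f \<in> A (Suc k) - A k" using sub by blast
    moreover from this have "f \<noteq> 0" using nonneg.ideal_zero[OF id] by auto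
    ultimately obtain u0 where "u0 \<in> ?X k" using leading_exponent_exists by blast
    from wfE_min[OF wf_lex_less this] obtain u where "u \<in> ?X k"
      "\<And>v. (v, u) \<in> {(u, v). u \<in> nonneg_vecs \<and> v \<in> nonneg_vecs \<and> lex_less u v} \<Longrightarrow> v \<notin> ?X k" by blast
    then show ?thesis using nn[of _ k] by blast
  qed
  then have "\<forall>k. \<exists>p. fst p \<in> A (Suc k) - A k \<and> leading_exponent (fst p) (snd p) \<and>
      (\<forall>v\<in>?X k. \<not> lex_less v (snd p))" by (simp only: split_paired_Ex fst_conv snd_conv simp_thms)
  from choice[OF this] obtain p where p: "\<forall>k. fst (p k) \<in> A (Suc k) - A k \<and>
      leading_exponent (fst (p k)) (snd (p k)) \<and> (\<forall>v\<in>?X k. \<not> lex_less v (snd (p k)))" ..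
  define f u where "f k = fst (p k)" and "u k = snd (p k)" for k
  have f: "\<And>k. f k \<in> A (Suc k) - A k" and lead: "\<And>k. leading_exponent (f k) (u k)"
    and least: "\<And>k v. v \<in> ?X k \<Longrightarrow> \<not> lex_less v (u k)"
    using p unfolding f_def u_def by blast+
  have "u k \<in> nonneg_vecs" for k using nn[of "u k" k] f lead by blast
  then obtain i j where ij: "i < j" "\<And>l. u i $ l \<le> u j $ l" using dickson[of u] by blast
  define c where "c = coeff (f j) (u j) / coeff (f i) (u i)"
  define d where "d = u j - u i"
  define g where "g = f j - Poly_Mapping.single d c * f i"
  have ci: "coeff (f i) (u i) \<noteq> 0" using lead[of i] by (simp add: leading_exponent_def in_keys_iff)
  have shift: "coeff (Poly_Mapping.single d c * f i) (d + v) = c * coeff (f i) v" for v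
  proof -
    have "Poly_Mapping.single d c * f i = (\<Sum>m\<in>keys (f i). Poly_Mapping.single (d + m) (c * coeff (f i) m))"
      by (subst nonneg.sum_of_terms[of "f i"]) (simp add: sum_distrib_left mult_single)
    then show ?thesis by (simp add: lookup_sum lookup_single when_def in_keys_iff)
  qed
  have fi: "f i \<in> A j" using f[of i] mono[of "Suc i" j] ij by auto
  have dn: "keys (Poly_Mapping.single d c) \<subseteq> nonneg_vecs"
    using ij(2) by (simp add: d_def nonneg_vecs_def)
  have pj: "Poly_Mapping.single d c * f i \<in> A j" using nonneg.ideal_mult[OF id fi dn] .
  have gj: "g \<in> A (Suc j) - A j"
  proof
    show "g \<in> A (Suc j)" unfolding g_def using f[of j] pj mono[of j "Suc j"]
      by (intro nonneg.ideal_diff[OF id]) auto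
    show "g \<notin> A j"
    proof
      assume "g \<in> A j"
      then have "g + Poly_Mapping.single d c * f i \<in> A j" using pj nonneg.ideal_add[OF id] by blast
      then show False using f[of j] by (simp add: g_def)
    qed
  qed
  then have "g \<noteq> 0" using nonneg.ideal_zero[OF id] by auto
  then obtain w where w: "leading_exponent g w" using leading_exponent_exists by blast
  have "lex_less w (u j)"
  proof -
    have wk: "coeff g w \<noteq> 0" using w by (simp add: leading_exponent_def in_keys_iff)
    have g_eq: "coeff g w = coeff (f j) w - c * coeff (f i) (w - d)" for w
      using shift[of "w - d"] by (simp add: g_def lookup_minus)
    have "coeff g (u j) = 0" unfolding g_eq using ci by (simp add: d_def c_def)
    then have "w \<noteq> u j" using wk by auto
    have "w \<in> keys (f j) \<or> w - d \<in> keys (f i)" using wk g_eq[of w] by (auto simp: in_keys_iff)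
    then show ?thesis
    proof
      assume "w \<in> keys (f j)"
      then show ?thesis using lead[of j] \<open>w \<noteq> u j\<close> by (auto simp: leading_exponent_def)
    next
      assume "w - d \<in> keys (f i)"
      then have "w - d = u i \<or> lex_less (w - d) (u i)" using lead[of i] by (auto simp: leading_exponent_def)
      then show ?thesis using \<open>w \<noteq> u j\<close> lex_less_add[of "w - d" "u i" d] by (auto simp: d_def)
    qed
  qed
  moreover have "w \<in> ?X j" using gj w by blast
  ultimately show False using least by blast
qed

section \<open>Congruences of binomial ideals\<close>

abbreviation "single \<equiv> Poly_Mapping.single"

lemma monomial_eq_single: "monomial u = single u 1"
  by (simp add: monomial_def)

lemma scalar_eq_single: "scalar c = single 0 c"
  by (simp add: scalar_def)

lemma coeff_single_mult: "coeff (single m c * f) u = c * coeff f (u - m)"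
  for f :: "'n::finite laurent"
proof -
  have "single m c * f = (\<Sum>k\<in>keys f. single (m + k) (c * coeff f k))"
    by (subst nonneg.sum_of_terms[of f]) (simp add: sum_distrib_left mult_single)
  then have "coeff (single m c * f) u = (\<Sum>k\<in>keys f. if k = u - m then c * coeff f k else 0)"
    by (simp add: lookup_sum lookup_single when_def eq_diff_eq add.commute)
  then show ?thesis by (simp only: sum.delta finite_keys) (auto simp: in_keys_iff)
qed

text \<open>Modulo a binomial ideal a polynomial is studied one congruence class at a time, that is,
  through its restrictions to sets of exponents.\<close>

definition part :: "(int ^ 'n) set \<Rightarrow> ('n::finite) laurent \<Rightarrow> 'n laurent" where
  "part T f = (\<Sum>u\<in>keys f \<inter> T. single u (coeff f u))"

lemma coeff_part: "coeff (part T f) u = (if u \<in> T then coeff f u else 0)"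
  by (auto simp: part_def lookup_sum lookup_single when_def in_keys_iff)

lemma keys_part: "keys (part T f) = keys f \<inter> T"
  by (auto simp: in_keys_iff coeff_part split: if_splits)

lemma part_zero [simp]: "part T 0 = 0"
  and part_add: "part T (f + g) = part T f + part T g"
  and part_diff: "part T (f - g) = part T f - part T g"
  and part_split: "part T f + part (- T) f = f"
  and part_part: "part T (part T' f) = part (T \<inter> T') f"
  and part_single: "part T (single m c) = (if m \<in> T then single m c else 0)"
  by (rule poly_mapping_eqI,
      simp add: coeff_part lookup_add lookup_minus lookup_single when_def)+

lemma part_id: "keys f \<subseteq> T \<Longrightarrow> part T f = f"
  by (rule poly_mapping_eqI) (auto simp: coeff_part in_keys_iff)

lemma part_disjoint: "keys f \<inter> T = {} \<Longrightarrow> part T f = 0"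
  by (simp add: part_def)

lemma part_single_mult:
  "part T (single m c * f) = single m c * part {u. m + u \<in> T} f"
  by (rule poly_mapping_eqI) (simp add: coeff_part coeff_single_mult)

lemma keys_single_mult: "c \<noteq> 0 \<Longrightarrow> keys (single m c * f) = (+) m ` keys f" for f :: "'n::finite laurent"
proof -
  assume "c \<noteq> 0"
  then have "u \<in> keys (single m c * f) \<longleftrightarrow> u - m \<in> keys f" for u by (simp add: in_keys_iff coeff_single_mult)
  then show ?thesis by (force simp: image_iff)
qed

lemma part_invariant_mult:
  fixes f x :: "'n::finite laurent"
  assumes T: "\<And>m w. m \<in> keys x \<Longrightarrow> w \<in> keys f \<Longrightarrow> m + w \<in> T \<longleftrightarrow> w \<in> T"
  shows "part T (x * f) = x * part T f"
proof -
  have "x * f = x * part T f + x * part (- T) f"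
    by (simp add: part_split flip: distrib_left)
  moreover have "part T (x * part T f) = x * part T f"
    using keys_mult[of x "part T f"] T by (intro part_id) (auto simp: keys_part)
  moreover have "part T (x * part (- T) f) = 0"
    using keys_mult[of x "part (- T) f"] T by (intro part_disjoint) (auto simp: keys_part)
  ultimately show ?thesis by (simp add: part_add)
qed

definition binomials :: "(int ^ 'n::finite) set \<Rightarrow> 'n laurent set" where
  "binomials Q = {monomial u - scalar c * monomial v | u v c. u \<in> Q \<and> v \<in> Q}"

definition binomial_ideal_in :: "(int ^ 'n::finite) set \<Rightarrow> 'n laurent set \<Rightarrow> bool" where
  "binomial_ideal_in Q B \<longleftrightarrow> (\<exists>G \<subseteq> binomials Q. B = Idl\<^bsub>semigroup_ring Q\<^esub> G)"

lemma mem_binomials_iff: "f \<in> binomials Q \<longleftrightarrow> (\<exists>u\<in>Q. \<exists>v\<in>Q. \<exists>c. f = single u 1 - single v c)"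
  by (auto simp: binomials_def monomial_eq_single scalar_eq_single mult_single)

lemma mem_ideal_congruence_iff:
  "(u, v) \<in> ideal_congruence Q B \<longleftrightarrow> u \<in> Q \<and> v \<in> Q \<and> (\<exists>c. c \<noteq> 0 \<and> single u 1 - single v c \<in> B)"
  by (simp add: ideal_congruence_def monomial_eq_single scalar_eq_single mult_single)

definition congruence_closed :: "(int ^ 'n::finite) set \<Rightarrow> 'n laurent set \<Rightarrow> (int ^ 'n) set \<Rightarrow> bool" where
  "congruence_closed Q B T \<longleftrightarrow> (\<forall>u v. (u, v) \<in> ideal_congruence Q B \<longrightarrow> (u \<in> T \<longleftrightarrow> v \<in> T))"

lemma congruence_closed_Compl: "congruence_closed Q B T \<Longrightarrow> congruence_closed Q B (- T)"
  by (simp add: congruence_closed_def)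

context exponent_monoid
begin

lemma binomials_keys: "binomials Q \<subseteq> {f. keys f \<subseteq> Q}"
proof
  fix f assume "f \<in> binomials Q"
  then obtain u v c where f: "u \<in> Q" "v \<in> Q" "f = single u 1 - single v c" by (auto simp: mem_binomials_iff)
  have "keys f \<subseteq> {u, v}" unfolding f(3) by (auto simp: in_keys_iff lookup_minus lookup_single when_def split: if_splits)
  then show "f \<in> {f. keys f \<subseteq> Q}" using f by auto
qed

lemma binomial_ideal_in_ideal: "binomial_ideal_in Q B \<Longrightarrow> ideal B (semigroup_ring Q)"
  unfolding binomial_ideal_in_def using Idl_ideal binomials_keys by blast

lemma ideal_single_mult:
  "ideal B (semigroup_ring Q) \<Longrightarrow> f \<in> B \<Longrightarrow> m \<in> Q \<Longrightarrow> single m c * f \<in> B"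
  using ideal_mult[of B f "single m c"] by (auto split: if_splits)

lemma ideal_unit_mult_iff:
  assumes B: "ideal B (semigroup_ring Q)" and m: "m \<in> Q" "- m \<in> Q" and c: "c \<noteq> 0"
  shows "single m c * f \<in> B \<longleftrightarrow> f \<in> B"
  using ideal_single_mult[OF B _ m(1), of f c] ideal_single_mult[OF B _ m(2), of "single m c * f" "inverse c"] c
  by (auto simp: mult_single simp flip: mult.assoc)

lemma monomial_mem_iff:
  assumes B: "ideal B (semigroup_ring Q)" and c: "c \<noteq> 0"
  shows "single m c \<in> B \<longleftrightarrow> single m 1 \<in> B"
  using ideal_scalar_mult[OF B, of "single m c" "inverse c"] ideal_scalar_mult[OF B, of "single m 1" c] c
  by (auto simp: mult_single)

lemma congruence_refl:
  "ideal B (semigroup_ring Q) \<Longrightarrow> u \<in> Q \<Longrightarrow> (u, u) \<in> ideal_congruence Q B"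
  by (auto simp: mem_ideal_congruence_iff ideal_zero intro!: exI[of _ 1])

lemma congruence_sym:
  assumes B: "ideal B (semigroup_ring Q)" and uv: "(u, v) \<in> ideal_congruence Q B"
  shows "(v, u) \<in> ideal_congruence Q B"
proof -
  obtain c where c: "u \<in> Q" "v \<in> Q" "c \<noteq> 0" "single u 1 - single v c \<in> B"
    using uv by (auto simp: mem_ideal_congruence_iff)
  from ideal_scalar_mult[OF B c(4), of "- inverse c"]
  have "single v 1 - single u (inverse c) \<in> B" using c(3) by (simp add: right_diff_distrib mult_single single_uminus)
  then show ?thesis using c by (auto simp: mem_ideal_congruence_iff intro!: exI[of _ "inverse c"])
qed

lemma congruence_trans:
  assumes B: "ideal B (semigroup_ring Q)"
    and uv: "(u, v) \<in> ideal_congruence Q B" and vw: "(v, w) \<in> ideal_congruence Q B"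
  shows "(u, w) \<in> ideal_congruence Q B"
proof -
  obtain c d where c: "u \<in> Q" "v \<in> Q" "c \<noteq> 0" "single u 1 - single v c \<in> B"
    and d: "w \<in> Q" "d \<noteq> 0" "single v 1 - single w d \<in> B"
    using uv vw by (auto simp: mem_ideal_congruence_iff)
  have "(single u 1 - single v c) + single 0 c * (single v 1 - single w d) \<in> B"
    by (intro ideal_add[OF B] ideal_scalar_mult[OF B] c d)
  then have "single u 1 - single w (c * d) \<in> B" by (simp add: right_diff_distrib mult_single)
  then show ?thesis using c d by (auto simp: mem_ideal_congruence_iff intro!: exI[of _ "c * d"])
qed

lemma congruence_translate:
  assumes B: "ideal B (semigroup_ring Q)" and uv: "(u, v) \<in> ideal_congruence Q B" and m: "m \<in> Q"
  shows "(m + u, m + v) \<in> ideal_congruence Q B"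
proof -
  obtain c where c: "u \<in> Q" "v \<in> Q" "c \<noteq> 0" "single u 1 - single v c \<in> B"
    using uv by (auto simp: mem_ideal_congruence_iff)
  from ideal_single_mult[OF B c(4) m, of 1]
  have "single (m + u) 1 - single (m + v) c \<in> B" by (simp add: right_diff_distrib mult_single)
  then show ?thesis using c m add_mem by (auto simp: mem_ideal_congruence_iff)
qed

lemma congruence_closed_class:
  assumes "ideal B (semigroup_ring Q)" shows "congruence_closed Q B (ideal_congruence Q B `` {u})"
  using congruence_trans[OF assms] congruence_sym[OF assms] unfolding congruence_closed_def by blast

text \<open>This is what distinguishes binomial ideals: membership can be tested class by class.  The two
  exponents of a term multiple of a generator \<open>t\<^sup>u - c t\<^sup>v\<close> are congruent unless \<open>c = 0\<close>, so that
  a union of classes contains both or neither; and for \<open>c = 0\<close> there is only one exponent.\<close>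

lemma binomial_ideal_part:
  assumes B: "binomial_ideal_in Q B" and T: "congruence_closed Q B T" and f: "f \<in> B"
  shows "part T f \<in> B"
proof -
  obtain G where G: "G \<subseteq> binomials Q" "B = Idl\<^bsub>semigroup_ring Q\<^esub> G" using B by (auto simp: binomial_ideal_in_def)
  have GQ: "G \<subseteq> {f. keys f \<subseteq> Q}" using G(1) binomials_keys by blast
  have Bi: "ideal B (semigroup_ring Q)" by (rule binomial_ideal_in_ideal[OF B])
  have "f \<in> Idl\<^bsub>semigroup_ring Q\<^esub> G" using f G by simp
  then show ?thesis using GQ
  proof (induction f rule: Idl_induct)
    case zero
    then show ?case using ideal_zero[OF Bi] by simp
  next
    case (add f g)
    then show ?case using ideal_add[OF Bi] by (simp add: part_add)
  next
    case (single g m c)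
    then obtain u v d where g: "u \<in> Q" "v \<in> Q" "g = single u 1 - single v d"
      using G(1) unfolding subset_iff mem_binomials_iff by blast
    have gB: "g \<in> B" using single(1) Idl_superset[OF GQ] G by blast
    then have mB: "single m c * g \<in> B" using ideal_single_mult[OF Bi] single(2) by blast
    have eq: "single m c * g = single (m + u) c - single (m + v) (c * d)"
      by (simp add: g right_diff_distrib mult_single)
    show ?case
    proof (cases "d = 0")
      case True
      then show ?thesis using mB ideal_zero[OF Bi] by (simp add: eq part_single)
    next
      case False
      then have "(u, v) \<in> ideal_congruence Q B" using g gB by (auto simp: mem_ideal_congruence_iff)
      then have "(m + u, m + v) \<in> ideal_congruence Q B" using congruence_translate[OF Bi _ single(2)] by blast
      then have "m + u \<in> T \<longleftrightarrow> m + v \<in> T" using T by (auto simp: congruence_closed_def)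
      then show ?thesis using mB ideal_zero[OF Bi] by (simp add: eq part_single part_diff)
    qed
  qed
qed

section \<open>Square-freeness modulo a binomial ideal\<close>

lemma keys_unit_minus_one: "u \<in> Q \<Longrightarrow> keys (single u c - 1) \<subseteq> Q"
  using zero_mem by (auto simp: in_keys_iff lookup_minus lookup_one lookup_single when_def split: if_splits)

lemma keys_power_subset: "keys x \<subseteq> Q \<Longrightarrow> keys (x ^ k) \<subseteq> Q"
  by (induction k) (simp_all add: zero_mem keys_mult_subset)

lemma keys_sum_subset: "(\<And>i. i \<in> X \<Longrightarrow> keys (h i) \<subseteq> Q) \<Longrightarrow> keys (sum h X) \<subseteq> Q"
  using keys_sum[of h X] by blast

text \<open>Over a field of characteristic zero \<open>X\<^sup>d - e\<close> has no multiple roots, so \<open>(x - 1)\<^sup>2\<close> and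
  \<open>x\<^sup>d - e\<close> generate an ideal that contains \<open>x - 1\<close>.\<close>

lemma square_free_cyclic:
  assumes B: "ideal B (semigroup_ring Q)" and x: "keys x \<subseteq> Q" and d: "d \<ge> 1"
    and sq: "(x - 1)^2 * a \<in> B" and cyc: "(x ^ d - single 0 e) * a \<in> B"
  shows "(x - 1) * a \<in> B"
proof -
  define g where "g = (\<Sum>i<d. x ^ i)"
  \<comment> \<open>\<open>g\<close> is \<open>(x\<^sup>d - 1)/(x - 1)\<close>, and \<open>g2\<close> is \<open>(g - d)/(x - 1)\<close>\<close>
  define g2 where "g2 = (\<Sum>i<d. \<Sum>k<i. x ^ k)"
  have kx: "keys (x ^ i) \<subseteq> Q" for i by (rule keys_power_subset[OF x])
  have kg: "keys g \<subseteq> Q" "keys g2 \<subseteq> Q"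
    unfolding g_def g2_def using kx by (auto intro!: keys_sum_subset)
  have kx1: "keys (x - 1) \<subseteq> Q"
    using keys_diff[of x 1] x zero_mem by auto
  have xd: "x ^ d - 1 = (x - 1) * g" unfolding g_def by (rule power_diff_1_eq)
  have gd: "g - of_nat d = (x - 1) * g2"
  proof -
    have "(x - 1) * g2 = (\<Sum>i<d. x ^ i - 1)"
      unfolding g2_def sum_distrib_left by (simp add: power_diff_1_eq sum_distrib_left)
    then show ?thesis by (simp add: g_def sum_subtractf)
  qed
  show ?thesis
  proof (cases "e = 1")
    case False
    have "(x - 1) * ((x ^ d - single 0 e) * a) - g * ((x - 1)^2 * a) =
        ((x ^ d - single 0 e) - (x - 1) * g) * ((x - 1) * a)" by (simp add: algebra_simps power2_eq_square)
    also have "(x ^ d - single 0 e) - (x - 1) * g = single 0 (1 - e)"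
      unfolding xd[symmetric] by (simp add: single_diff)
    finally have "single 0 (1 - e) * ((x - 1) * a) \<in> B"
      using ideal_diff[OF B ideal_mult[OF B cyc kx1] ideal_mult[OF B sq kg(1)]] by simp
    then show ?thesis by (rule ideal_scalar_cancel[OF B]) (use False in simp)
  next
    case True
    have "(x ^ d - single 0 e) * a - g2 * ((x - 1)^2 * a) = (x ^ d - 1) * a - (x - 1) * g2 * ((x - 1) * a)"
      using True by (simp add: algebra_simps power2_eq_square)
    also have "\<dots> = single 0 (of_nat d) * ((x - 1) * a)"
      unfolding xd gd[symmetric] by (simp add: algebra_simps)
    finally have "single 0 (of_nat d) * ((x - 1) * a) \<in> B"
      using ideal_diff[OF B cyc ideal_mult[OF B sq kg(2)]] by simp
    then show ?thesis by (rule ideal_scalar_cancel[OF B]) (use d in simp)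
  qed
qed

lemma single_power: "single u c ^ k = single (int k *s u) (c ^ k)" for c :: complex
  by (induction k) (simp_all add: mult_single vector_sadd_rdistrib add.commute)

lemma multiple_mem: "u \<in> Q \<Longrightarrow> int k *s u \<in> Q"
  by (induction k) (simp_all add: zero_mem vector_sadd_rdistrib add_mem)

text \<open>If no power of \<open>x\<close> maps the class of an exponent of \<open>y\<close> to itself, then for some \<open>N\<close> the
  classes met by \<open>x\<^sup>N y\<close> are disjoint from those met by \<open>y\<close>.  As \<open>(x\<^sup>N - 1) y\<close> lies in
  the binomial ideal, so does its restriction \<open>-y\<close> to the latter classes.\<close>

lemma torsion_free_cancel:
  assumes B: "binomial_ideal_in Q B" and u: "u \<in> Q" "- u \<in> Q" and c: "c \<noteq> 0"
    and y: "keys y \<subseteq> Q"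
    and free: "\<And>v d e. v \<in> keys y \<Longrightarrow> d \<ge> 1 \<Longrightarrow> (single u c ^ d - single 0 e) * single v 1 \<notin> B"
    and yB: "(single u c - 1) * y \<in> B"
  shows "y \<in> B"
proof -
  let ?x = "single u c"
  have Bi: "ideal B (semigroup_ring Q)" by (rule binomial_ideal_in_ideal[OF B])
  define bad where "bad v v' = {N::nat. (int N *s u + v, v') \<in> ideal_congruence Q B}" for v v'
  have one: "N = N'" if v: "v \<in> keys y" and N: "N \<in> bad v v'" and N': "N' \<in> bad v v'" and le: "N \<le> N'" for v v' N N'
  proof (rule ccontr)
    assume "N \<noteq> N'"
    then obtain d where d: "d \<ge> 1" "N' = N + d" using le by (metis le_iff_add less_one linorder_not_less add_0_right)
    have "(int N *s u + v, int N' *s u + v) \<in> ideal_congruence Q B"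
      using N N' congruence_trans[OF Bi] congruence_sym[OF Bi] unfolding bad_def by blast
    moreover have "- (int N *s u) \<in> Q"
    proof -
      have "- (int N *s u) = int N *s (- u)" by (simp add: vec_eq_iff)
      then show ?thesis using multiple_mem[OF u(2), of N] by metis
    qed
    ultimately have "(- (int N *s u) + (int N *s u + v), - (int N *s u) + (int N' *s u + v)) \<in> ideal_congruence Q B"
      using congruence_translate[OF Bi] by blast
    then have "(v, int d *s u + v) \<in> ideal_congruence Q B"
      by (simp add: d vector_sadd_rdistrib algebra_simps)
    then obtain b where b: "b \<noteq> 0" "single v 1 - single (int d *s u + v) b \<in> B"
      by (auto simp: mem_ideal_congruence_iff)
    from ideal_scalar_mult[OF Bi b(2), of "- (c ^ d / b)"]
    have "(?x ^ d - single 0 (c ^ d / b)) * single v 1 \<in> B"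
      using b(1) by (simp add: single_power left_diff_distrib right_diff_distrib mult_single single_uminus)
    then show False using free[OF v d(1)] by blast
  qed
  have "finite (bad v v')" if "v \<in> keys y" for v v'
  proof (cases "bad v v' = {}")
    case False
    then obtain N where N: "N \<in> bad v v'" by blast
    have "M = N" if "M \<in> bad v v'" for M
      using one[OF \<open>v \<in> keys y\<close> N that] one[OF \<open>v \<in> keys y\<close> that N] by linarith
    then have "bad v v' \<subseteq> {N}" by blast
    then show ?thesis by (rule finite_subset) simp
  qed simp
  then have "finite (\<Union>v\<in>keys y. \<Union>v'\<in>keys y. bad v v')" by simp
  then obtain N where N: "N \<notin> (\<Union>v\<in>keys y. \<Union>v'\<in>keys y. bad v v')"
    using ex_new_if_finite[OF infinite_UNIV_nat] by blast
  define T where "T = {w. \<exists>v\<in>keys y. (w, v) \<in> ideal_congruence Q B}"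
  have T: "congruence_closed Q B T"
    unfolding congruence_closed_def T_def using congruence_trans[OF Bi] congruence_sym[OF Bi] by blast
  have xN: "?x ^ N - 1 = (\<Sum>i<N. ?x ^ i) * (?x - 1)" by (simp add: power_diff_1_eq mult.commute)
  have "keys (\<Sum>i<N. ?x ^ i) \<subseteq> Q"
    using u(1) by (intro keys_sum_subset keys_power_subset) auto
  from ideal_mult[OF Bi yB this] have "(?x ^ N - 1) * y \<in> B" by (simp add: xN mult.assoc)
  then have "part T ((?x ^ N - 1) * y) \<in> B" by (rule binomial_ideal_part[OF B T])
  moreover have "part T (?x ^ N * y) = 0"
  proof (rule part_disjoint)
    show "keys (?x ^ N * y) \<inter> T = {}"
      using N c by (auto simp: single_power keys_single_mult T_def bad_def)
  qed
  moreover have "part T y = y"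
    using y congruence_refl[OF Bi] by (intro part_id) (auto simp: T_def)
  ultimately have "- y \<in> B" by (simp add: left_diff_distrib part_diff)
  then show ?thesis using ideal_uminus[OF Bi, of "- y"] by simp
qed

text \<open>Modulo a binomial ideal the monomials are, up to scalars, the congruence classes, and a unit
  monomial \<open>x\<close> permutes these.  On a finite cycle of classes \<open>x\<close> satisfies an equation
  \<open>x\<^sup>d = e\<close>, which is square-free because the characteristic is zero; on an infinite orbit
  nothing is annihilated by \<open>x - 1\<close>.  Hence \<open>x - 1\<close> acts on the quotient without nilpotent part.\<close>

lemma unit_minus_one_square_cancel:
  assumes B: "binomial_ideal_in Q B" and u: "u \<in> Q" "- u \<in> Q" and c: "c \<noteq> 0"
    and s: "keys s \<subseteq> Q" and sq: "(single u c - 1)^2 * s \<in> B"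
  shows "(single u c - 1) * s \<in> B"
  using s sq
proof (induction "card (keys s)" arbitrary: s rule: less_induct)
  case less
  let ?x = "single u c"
  have Bi: "ideal B (semigroup_ring Q)" by (rule binomial_ideal_in_ideal[OF B])
  have kx1: "keys (?x - 1) \<subseteq> Q" by (rule keys_unit_minus_one[OF u(1)])
  have tors_translate: "(?x ^ d - single 0 e) * single (u + w) 1 \<in> B \<longleftrightarrow> (?x ^ d - single 0 e) * single w 1 \<in> B" for d e w
  proof -
    have "(?x ^ d - single 0 e) * single (u + w) 1 = single u 1 * ((?x ^ d - single 0 e) * single w 1)"
      by (simp add: mult.left_commute[of "single u 1"] mult_single)
    then show ?thesis using ideal_unit_mult_iff[OF Bi u, of 1] by simp
  qed
  show ?case
  proof (cases "\<exists>v\<in>keys s. \<exists>d\<ge>1. \<exists>e. (?x ^ d - single 0 e) * single v 1 \<in> B")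
    case True
    then obtain v d e where v: "v \<in> keys s" "d \<ge> 1" "(?x ^ d - single 0 e) * single v 1 \<in> B" by blast
    \<comment> \<open>split off all exponents on which \<open>x\<close> satisfies this same equation\<close>
    define T where "T = {w. (?x ^ d - single 0 e) * single w 1 \<in> B}"
    have T: "congruence_closed Q B T"
    proof -
      have "w' \<in> T" if ww: "(w, w') \<in> ideal_congruence Q B" "w \<in> T" for w w'
      proof -
        obtain b where b: "b \<noteq> 0" "single w' 1 - single w b \<in> B"
          using congruence_sym[OF Bi ww(1)] by (auto simp: mem_ideal_congruence_iff)
        have "keys (?x ^ d - single 0 e) \<subseteq> Q"
          using keys_diff[of "?x ^ d" "single 0 e"] keys_power_subset[of ?x d] u(1) zero_mem
          by (force split: if_splits)
        from ideal_mult[OF Bi b(2) this]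
        have "(?x ^ d - single 0 e) * (single w' 1 - single w b) + single 0 b * ((?x ^ d - single 0 e) * single w 1) \<in> B"
          using ww(2) by (intro ideal_add[OF Bi] ideal_scalar_mult[OF Bi]) (auto simp: T_def)
        moreover have "single w b = single 0 b * single w 1" by (simp add: mult_single)
        ultimately show ?thesis by (simp add: T_def algebra_simps)
      qed
      then show ?thesis using congruence_sym[OF Bi] unfolding congruence_closed_def by blast
    qed
    have inv: "u + w \<in> T \<longleftrightarrow> w \<in> T" for w using tors_translate by (simp add: T_def)
    have restr: "part S ((?x - 1)^2 * s) = (?x - 1)^2 * part S s"
      if "\<And>w. u + w \<in> S \<longleftrightarrow> w \<in> S" for S
    proof -
      have "keys (?x - 1) \<subseteq> {u, 0}"
        by (auto simp: in_keys_iff lookup_minus lookup_one lookup_single when_def split: if_splits)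
      then have "part S ((?x - 1) * f) = (?x - 1) * part S f" for f
        using that by (intro part_invariant_mult) auto
      then show ?thesis by (simp add: power2_eq_square mult.assoc)
    qed
    have "(?x - 1) * part T s \<in> B"
    proof (rule square_free_cyclic[OF Bi _ v(2)])
      show "keys ?x \<subseteq> Q" using u(1) by auto
      show "(?x - 1)^2 * part T s \<in> B"
        using binomial_ideal_part[OF B T less.prems(2)] restr[of T] inv by simp
      have "(?x ^ d - single 0 e) * part T s =
          (\<Sum>w\<in>keys s \<inter> T. single 0 (coeff s w) * ((?x ^ d - single 0 e) * single w 1))"
        unfolding part_def sum_distrib_left
        by (intro sum.cong) (simp_all add: mult_single mult.left_commute[of "single 0 b" for b])
      also have "\<dots> \<in> B" by (intro ideal_sum[OF Bi] ideal_scalar_mult[OF Bi]) (simp add: T_def)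
      finally show "(?x ^ d - single 0 e) * part T s \<in> B" .
    qed
    moreover have "(?x - 1) * part (- T) s \<in> B"
    proof (rule less.hyps)
      show "card (keys (part (- T) s)) < card (keys s)"
        unfolding keys_part using v by (intro psubset_card_mono) (auto simp: T_def)
      show "keys (part (- T) s) \<subseteq> Q" using less.prems by (auto simp: keys_part)
      show "(?x - 1)^2 * part (- T) s \<in> B"
        using binomial_ideal_part[OF B congruence_closed_Compl[OF T] less.prems(2)] restr[of "- T"] inv by simp
    qed
    ultimately have "(?x - 1) * part T s + (?x - 1) * part (- T) s \<in> B" by (rule ideal_add[OF Bi])
    then show ?thesis by (simp add: part_split flip: distrib_left)
  next
    case False
    show ?thesis
    proof (rule torsion_free_cancel[OF B u c keys_mult_subset[OF kx1 less.prems(1)]])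
      show "(?x - 1) * ((?x - 1) * s) \<in> B" using less.prems(2) by (simp add: power2_eq_square mult.assoc)
      fix v e and d :: nat assume v: "v \<in> keys ((?x - 1) * s)" and d: "d \<ge> 1"
      have "v \<in> keys (?x * s) \<or> v \<in> keys s" using v keys_diff[of "?x * s" s] by (auto simp: left_diff_distrib)
      then have "v \<in> keys s \<or> (\<exists>w\<in>keys s. v = u + w)" using c by (auto simp: keys_single_mult)
      then show "(?x ^ d - single 0 e) * single v 1 \<notin> B" using False d tors_translate by auto
    qed
  qed
qed

lemma unit_minus_one_power_cancel:
  assumes B: "binomial_ideal_in Q B" and u: "u \<in> Q" "- u \<in> Q" and c: "c \<noteq> 0"
    and s: "keys s \<subseteq> Q" and pow: "(single u c - 1) ^ k * s \<in> B"
  shows "(single u c - 1) * s \<in> B"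
  using pow
proof (induction k)
  case 0
  then show ?case using ideal_mult[OF binomial_ideal_in_ideal[OF B] _ keys_unit_minus_one[OF u(1)]] by simp
next
  case (Suc k)
  show ?case
  proof (cases k)
    case 0
    then show ?thesis using Suc.prems by simp
  next
    case (Suc m)
    then have "(single u c - 1)^2 * ((single u c - 1) ^ m * s) \<in> B"
      using Suc.prems by (simp add: power2_eq_square mult.assoc)
    moreover have "keys ((single u c - 1) ^ m * s) \<subseteq> Q"
      using keys_unit_minus_one[OF u(1)] s by (intro keys_mult_subset keys_power_subset)
    ultimately have "(single u c - 1) * ((single u c - 1) ^ m * s) \<in> B"
      using unit_minus_one_square_cancel[OF B u c] by blast
    then show ?thesis using Suc.IH \<open>k = Suc m\<close> by (simp add: mult.assoc)
  qed
qed

end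

section \<open>Passing to the localization at \<open>t\<^sub>J\<close>\<close>

text \<open>The exponent of \<open>t\<^sub>J\<^sup>k\<close>.\<close>

definition shift :: "'n set \<Rightarrow> nat \<Rightarrow> int ^ 'n::finite" where
  "shift J k = (\<chi> i. if i \<in> J then int k else 0)"

lemma shift_zero [simp]: "shift J 0 = 0"
  and shift_add: "shift J k + shift J l = shift J (k + l)"
  and shift_coord: "shift J k \<in> coord_subgroup J"
  and shift_nonneg: "shift J k \<in> nonneg_vecs"
  by (auto simp: shift_def coord_subgroup_def nonneg_vecs_def vec_eq_iff)

lemma coord_local: "u \<in> coord_subgroup J \<Longrightarrow> u \<in> local_monoid J"
  and coord_uminus: "u \<in> coord_subgroup J \<Longrightarrow> - u \<in> coord_subgroup J"
  and coord_add: "u \<in> coord_subgroup J \<Longrightarrow> v \<in> coord_subgroup J \<Longrightarrow> u + v \<in> coord_subgroup J"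
  and coord_zero: "0 \<in> coord_subgroup J"
  and nonneg_local: "u \<in> nonneg_vecs \<Longrightarrow> u \<in> local_monoid J"
  by (auto simp: coord_subgroup_def local_monoid_def nonneg_vecs_def)

lemma nonneg_subset_local: "nonneg_vecs \<subseteq> local_monoid J"
  using nonneg_local by blast

lemma variable_power: "variable j ^ k = single (axis j (int k)) 1"
proof (induction k)
  case (Suc k)
  have "axis j (int (Suc k)) = axis j 1 + axis j (int k)" by (simp add: axis_def vec_eq_iff)
  then show ?case using Suc by (simp add: variable_def monomial_eq_single mult_single)
next
  case 0
  have "axis j (int 0) = 0" by (simp add: axis_def vec_eq_iff)
  then show ?case by (simp only: power_0 single_one)
qed

lemma prod_variable_power: "(\<Prod>j\<in>J. variable j) ^ k = single (shift J k) 1"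
  for J :: "'n::finite set"
proof -
  have 1: "(\<Prod>j\<in>X. variable j) = single (shift X 1) 1" if "finite X" for X :: "'n set"
    using that
  proof (induction X rule: finite_induct)
    case (insert x X)
    have "shift (insert x X) 1 = axis x 1 + shift X 1" using insert by (auto simp: shift_def axis_def vec_eq_iff)
    then show ?case using insert by (simp add: variable_def monomial_eq_single mult_single)
  next
    case empty
    have "shift {} 1 = (0 :: int ^ 'n)" by (simp add: shift_def vec_eq_iff)
    then show ?case by simp
  qed
  show ?thesis
  proof (induction k)
    case (Suc k)
    then show ?case using 1[of J] shift_add[of J 1 k] by (simp add: mult_single)
  qed simp
qed

lemma clear_denominators:
  fixes f :: "'n::finite laurent"
  assumes "keys f \<subseteq> local_monoid J"
  shows "\<exists>k. keys (single (shift J k) 1 * f) \<subseteq> nonneg_vecs"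
proof -
  define k where "k = nat (\<Sum>u\<in>keys f. \<Sum>i\<in>UNIV. \<bar>u $ i\<bar>)"
  have "int k + u $ i \<ge> 0" if u: "u \<in> keys f" for u i
  proof -
    have "\<bar>u $ i\<bar> \<le> (\<Sum>i\<in>UNIV. \<bar>u $ i\<bar>)" by (rule member_le_sum) auto
    also have "\<dots> \<le> (\<Sum>u\<in>keys f. \<Sum>i\<in>UNIV. \<bar>u $ i\<bar>)"
      using u by (intro member_le_sum) (auto intro: sum_nonneg)
    finally have "\<bar>u $ i\<bar> \<le> (\<Sum>u\<in>keys f. \<Sum>i\<in>UNIV. \<bar>u $ i\<bar>)" .
    then show ?thesis unfolding k_def by linarith
  qed
  then have "keys (single (shift J k) 1 * f) \<subseteq> nonneg_vecs"
    using assms by (auto simp: keys_single_mult nonneg_vecs_def shift_def local_monoid_def)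
  then show ?thesis ..
qed

text \<open>The contraction of \<open>I \<complex>[t][t\<^sub>J\<^sup>-\<^sup>1]\<close> to \<open>\<complex>[t]\<close> is \<open>(I : t\<^sub>J\<^sup>\<infinity>)\<close>, because every element of
  the localization becomes a polynomial after multiplication by a power of \<open>t\<^sub>J\<close>.\<close>

lemma Idl_local_iff:
  fixes I :: "'n::finite laurent set"
  assumes I: "ideal I (semigroup_ring nonneg_vecs)"
  shows "f \<in> Idl\<^bsub>semigroup_ring (local_monoid J)\<^esub> I \<longleftrightarrow>
    keys f \<subseteq> local_monoid J \<and> (\<exists>k. single (shift J k) 1 * f \<in> I)"
proof -
  let ?S = "semigroup_ring (local_monoid J) :: 'n laurent ring"
  let ?E = "{f. keys f \<subseteq> local_monoid J \<and> (\<exists>k. single (shift J k) 1 * f \<in> I)}"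
  have Ik: "I \<subseteq> {f. keys f \<subseteq> local_monoid J}"
    using nonneg.ideal_keys[OF I] nonneg_subset_local by blast
  have more: "single (shift J (k + l)) 1 * f \<in> I" if "single (shift J k) 1 * f \<in> I" for k l f
    using nonneg.ideal_single_mult[OF I that shift_nonneg[of J l], of 1]
    by (simp add: mult_single shift_add add.commute flip: mult.assoc)
  have "ideal ?E ?S"
    unfolding loc.ideal_semigroup_ring_iff
  proof (intro conjI ballI allI impI)
    show "0 \<in> ?E" using nonneg.ideal_zero[OF I] by simp
  next
    fix a b assume "a \<in> ?E" "b \<in> ?E"
    then obtain k l where a: "keys a \<subseteq> local_monoid J" "single (shift J k) 1 * a \<in> I"
      and b: "keys b \<subseteq> local_monoid J" "single (shift J l) 1 * b \<in> I" by blast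
    have "single (shift J (k + l)) 1 * a + single (shift J (k + l)) 1 * b \<in> I"
      using more[OF a(2), of l] more[OF b(2), of k] by (intro nonneg.ideal_add[OF I]) (simp_all add: add.commute)
    then have "single (shift J (k + l)) 1 * (a + b) \<in> I" by (simp add: distrib_left)
    then show "a + b \<in> ?E" using loc.keys_add_subset a b by blast
  next
    fix a x :: "'n laurent" assume "a \<in> ?E" and x: "keys x \<subseteq> local_monoid J"
    then obtain k where a: "keys a \<subseteq> local_monoid J" "single (shift J k) 1 * a \<in> I" by blast
    obtain l where l: "keys (single (shift J l) 1 * x) \<subseteq> nonneg_vecs" using clear_denominators[OF x] by blast
    have "(single (shift J l) 1 * x) * (single (shift J k) 1 * a) = (single (shift J l) 1 * single (shift J k) 1) * (x * a)"
      by (simp only: mult_ac)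
    also have "\<dots> = single (shift J (l + k)) 1 * (x * a)" by (simp add: mult_single shift_add)
    finally have "single (shift J (l + k)) 1 * (x * a) \<in> I" using nonneg.ideal_mult[OF I a(2) l] by simp
    then show "x * a \<in> ?E" using loc.keys_mult_subset[OF x a(1)] by blast
  qed auto
  moreover have "I \<subseteq> ?E"
  proof
    fix f assume f: "f \<in> I"
    then have "single (shift J 0) 1 * f \<in> I" by simp
    then show "f \<in> ?E" using Ik f by blast
  qed
  ultimately have 1: "Idl\<^bsub>?S\<^esub> I \<subseteq> ?E" by (rule loc.Idl_least)
  have id: "ideal (Idl\<^bsub>?S\<^esub> I) ?S" by (rule loc.Idl_ideal[OF Ik])
  have "f \<in> Idl\<^bsub>?S\<^esub> I" if "single (shift J k) 1 * f \<in> I" for k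
    using loc.ideal_unit_mult_iff[OF id coord_local coord_local, of "shift J k" 1 f]
      shift_coord[of J k] coord_uminus[OF shift_coord, of J k] that loc.Idl_superset[OF Ik] by auto
  then show ?thesis using 1 by blast
qed

lemma colon_tJ_eq:
  fixes I :: "'n::finite laurent set"
  assumes I: "ideal I (semigroup_ring nonneg_vecs)"
  shows "colon_tJ I J = {f. keys f \<subseteq> nonneg_vecs} \<inter> Idl\<^bsub>semigroup_ring (local_monoid J)\<^esub> I"
proof -
  have sub: "keys f \<subseteq> local_monoid J" if "keys f \<subseteq> nonneg_vecs" for f :: "'n laurent"
    using that nonneg_subset_local by (rule subset_trans)
  have iff: "f \<in> colon_tJ I J \<longleftrightarrow> keys f \<subseteq> nonneg_vecs \<and> (\<exists>k. single (shift J k) 1 * f \<in> I)" for f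
    by (simp add: colon_tJ_def prod_variable_power poly_ring_def)
  show ?thesis
  proof (rule Set.set_eqI)
    fix f :: "'n laurent"
    show "f \<in> colon_tJ I J \<longleftrightarrow> f \<in> {f. keys f \<subseteq> nonneg_vecs} \<inter> Idl\<^bsub>semigroup_ring (local_monoid J)\<^esub> I"
      unfolding iff Int_iff mem_Collect_eq Idl_local_iff[OF I] using sub[of f] by metis
  qed
qed

lemma Idl_local_Idl:
  fixes G :: "'n::finite laurent set"
  assumes G: "G \<subseteq> {f. keys f \<subseteq> nonneg_vecs}"
  shows "Idl\<^bsub>semigroup_ring (local_monoid J)\<^esub> (Idl\<^bsub>semigroup_ring nonneg_vecs\<^esub> G) =
    Idl\<^bsub>semigroup_ring (local_monoid J)\<^esub> G"
proof -
  let ?S = "semigroup_ring (local_monoid J) :: 'n laurent ring" and ?R = "semigroup_ring nonneg_vecs :: 'n laurent ring"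
  have GS: "G \<subseteq> {f. keys f \<subseteq> local_monoid J}" using G nonneg_subset_local by blast
  have id: "ideal (Idl\<^bsub>?S\<^esub> G) ?S" by (rule loc.Idl_ideal[OF GS])
  have "ideal ({f. keys f \<subseteq> nonneg_vecs} \<inter> Idl\<^bsub>?S\<^esub> G) ?R"
    unfolding nonneg.ideal_semigroup_ring_iff
  proof (intro conjI ballI allI impI IntI)
    fix a x assume a: "a \<in> {f. keys f \<subseteq> nonneg_vecs} \<inter> Idl\<^bsub>?S\<^esub> G"
    show "a + x \<in> {f. keys f \<subseteq> nonneg_vecs}" if "x \<in> {f. keys f \<subseteq> nonneg_vecs} \<inter> Idl\<^bsub>?S\<^esub> G"
      using nonneg.keys_add_subset[of a x] a that by simp
    show "a + x \<in> Idl\<^bsub>?S\<^esub> G" if "x \<in> {f. keys f \<subseteq> nonneg_vecs} \<inter> Idl\<^bsub>?S\<^esub> G"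
      by (rule loc.ideal_add[OF id IntD2[OF a] IntD2[OF that]])
    assume x: "keys x \<subseteq> nonneg_vecs"
    show "x * a \<in> {f. keys f \<subseteq> nonneg_vecs}" using nonneg.keys_mult_subset[OF x, of a] a by simp
    show "x * a \<in> Idl\<^bsub>?S\<^esub> G"
      by (rule loc.ideal_mult[OF id IntD2[OF a] subset_trans[OF x nonneg_subset_local]])
  qed (use loc.ideal_zero[OF id] in auto)
  then have "Idl\<^bsub>?R\<^esub> G \<subseteq> Idl\<^bsub>?S\<^esub> G"
    using nonneg.Idl_least[of "{f. keys f \<subseteq> nonneg_vecs} \<inter> Idl\<^bsub>?S\<^esub> G" G] G loc.Idl_superset[OF GS] by blast
  then have 1: "Idl\<^bsub>?S\<^esub> (Idl\<^bsub>?R\<^esub> G) \<subseteq> Idl\<^bsub>?S\<^esub> G" by (rule loc.Idl_least[OF id])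
  have GR: "Idl\<^bsub>?R\<^esub> G \<subseteq> {f. keys f \<subseteq> local_monoid J}"
    using nonneg.ideal_keys[OF nonneg.Idl_ideal[OF G]] nonneg_subset_local by blast
  have "G \<subseteq> Idl\<^bsub>?S\<^esub> (Idl\<^bsub>?R\<^esub> G)" using nonneg.Idl_superset[OF G] loc.Idl_superset[OF GR] by blast
  then have "Idl\<^bsub>?S\<^esub> G \<subseteq> Idl\<^bsub>?S\<^esub> (Idl\<^bsub>?R\<^esub> G)" by (rule loc.Idl_least[OF loc.Idl_ideal[OF GR]])
  with 1 show ?thesis by blast
qed

lemma binomials_mono: "Q \<subseteq> Q' \<Longrightarrow> binomials Q \<subseteq> binomials Q'"
  by (force simp: mem_binomials_iff)

lemma binomial_ideal_in_local:
  assumes "binomial_ideal_in nonneg_vecs I"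
  shows "binomial_ideal_in (local_monoid J) (Idl\<^bsub>semigroup_ring (local_monoid J)\<^esub> I)"
proof -
  obtain G where G: "G \<subseteq> binomials nonneg_vecs" "I = Idl\<^bsub>semigroup_ring nonneg_vecs\<^esub> G"
    using assms by (auto simp: binomial_ideal_in_def)
  then have "Idl\<^bsub>semigroup_ring (local_monoid J)\<^esub> I = Idl\<^bsub>semigroup_ring (local_monoid J)\<^esub> G"
    using Idl_local_Idl nonneg.binomials_keys by blast
  then show ?thesis
    using G(1) binomials_mono[OF nonneg_subset_local] unfolding binomial_ideal_in_def by blast
qed

section \<open>The prime ideal of a partial character\<close>

lemma group_int_vec_group: "group (int_vec_group :: (int ^ 'n::finite) monoid)"
proof (rule groupI)
  fix x assume "x \<in> carrier (int_vec_group :: (int ^ 'n) monoid)"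
  show "\<exists>y\<in>carrier (int_vec_group :: (int ^ 'n) monoid). y \<otimes>\<^bsub>int_vec_group\<^esub> x = \<one>\<^bsub>int_vec_group\<^esub>"
    by (intro bexI[of _ "- x"]) (auto simp: int_vec_group_def)
qed (auto simp: int_vec_group_def)

locale lattice_character =
  fixes J :: "'n::finite set" and L :: "(int ^ 'n) set" and \<rho> :: "int ^ 'n \<Rightarrow> complex"
  assumes char: "partial_character L \<rho>" and sat: "saturated L" and LJ: "L \<subseteq> coord_subgroup J"
begin

lemma L_zero: "0 \<in> L" and L_add: "u \<in> L \<Longrightarrow> v \<in> L \<Longrightarrow> u + v \<in> L"
  and L_uminus: "u \<in> L \<Longrightarrow> - u \<in> L"
proof -
  interpret G: group "int_vec_group :: (int ^ 'n) monoid" by (rule group_int_vec_group)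
  have L: "subgroup L int_vec_group" using char by (simp add: partial_character_def)
  show "0 \<in> L" using subgroup.one_closed[OF L] by (simp add: int_vec_group_def)
  show "u + v \<in> L" if "u \<in> L" "v \<in> L" using subgroup.m_closed[OF L that] by (simp add: int_vec_group_def)
  have "inv\<^bsub>int_vec_group\<^esub> u = - u" by (rule G.inv_equality) (auto simp: int_vec_group_def)
  then show "- u \<in> L" if "u \<in> L" using subgroup.m_inv_closed[OF L that] by simp
qed

lemma L_diff: "u \<in> L \<Longrightarrow> v \<in> L \<Longrightarrow> u - v \<in> L"
  using L_add[of u "- v"] L_uminus by simp

lemma L_shift: "u - v \<in> L \<Longrightarrow> u - w \<in> L \<longleftrightarrow> v - w \<in> L"
  using L_add[of "u - v" "v - w"] L_diff[of "u - w" "u - v"] by auto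

lemma rho_add: "u \<in> L \<Longrightarrow> v \<in> L \<Longrightarrow> \<rho> (u + v) = \<rho> u * \<rho> v"
  using char by (auto simp: partial_character_def hom_def int_vec_group_def complex_units_def)

lemma rho_nonzero: "u \<in> L \<Longrightarrow> \<rho> u \<noteq> 0"
  using char by (auto simp: partial_character_def hom_def int_vec_group_def complex_units_def)

lemma rho_zero [simp]: "\<rho> 0 = 1"
  using rho_add[OF L_zero L_zero] rho_nonzero[OF L_zero] by simp

lemma L_saturated:
  assumes "int k *s d \<in> L" "k > 0" shows "d \<in> L"
proof -
  have "rat_vec (int k *s d) = rat_of_nat k *s rat_vec d" by (simp add: rat_vec_def vec_eq_iff)
  then have "rat_vec d = inverse (rat_of_nat k) *s rat_vec (int k *s d)" using assms(2) by (simp add: vec_eq_iff)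
  moreover have "rat_vec (int k *s d) \<in> vec.span (rat_vec ` L)" using assms(1) by (intro vec.span_base) auto
  ultimately have "rat_vec d \<in> vec.span (rat_vec ` L)" by (metis vec.span_scale)
  then show ?thesis using sat unfolding saturated_def by blast
qed

text \<open>The value of \<open>f\<close> on the coset \<open>a + L\<close>, where \<open>t\<^sup>m\<close> counts as \<open>\<rho>(m - a)\<close> times \<open>t\<^sup>a\<close>.  The
  prime \<open>I\<^bsub>\<rho>,J\<^esub>\<close> is the common kernel of these functionals for \<open>a \<in> \<int>\<^sup>J\<close>, which makes
  membership in it testable without an extension of \<open>\<rho>\<close> to \<open>\<int>\<^sup>J\<close>.\<close>

definition coset_value :: "int ^ 'n \<Rightarrow> 'n laurent \<Rightarrow> complex" where
  "coset_value a f = (\<Sum>m\<in>{m \<in> keys f. m - a \<in> L}. \<rho> (m - a) * coeff f m)"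

lemma coset_value_superset:
  assumes "finite X" "keys f \<subseteq> X"
  shows "coset_value a f = (\<Sum>m\<in>{m \<in> X. m - a \<in> L}. \<rho> (m - a) * coeff f m)"
  unfolding coset_value_def using assms by (intro sum.mono_neutral_left) (auto simp: in_keys_iff)

lemma coset_value_add: "coset_value a (f + g) = coset_value a f + coset_value a g"
proof -
  let ?X = "keys f \<union> keys g"
  have "keys (f + g) \<subseteq> ?X" using keys_add[of f g] by blast
  then show ?thesis
    using coset_value_superset[of ?X "f + g" a] coset_value_superset[of ?X f a] coset_value_superset[of ?X g a]
    by (simp add: lookup_add distrib_left sum.distrib)
qed

lemma coset_value_zero [simp]: "coset_value a 0 = 0"
  by (simp add: coset_value_def)

lemma coset_value_single: "coset_value a (single m c) = (if m - a \<in> L then \<rho> (m - a) * c else 0)"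
proof -
  have "{k \<in> {m}. k - a \<in> L} = (if m - a \<in> L then {m} else {})" by auto
  then show ?thesis using coset_value_superset[of "{m}" "single m c" a] by auto
qed

lemma coset_value_uminus: "coset_value a (- f) = - coset_value a f"
  using coset_value_add[of a f "- f"] by (simp add: eq_neg_iff_add_eq_0 add.commute)

lemma coset_value_diff: "coset_value a (f - g) = coset_value a f - coset_value a g"
  using coset_value_add[of a f "- g"] by (simp add: coset_value_uminus)

lemma coset_value_sum: "coset_value a (sum h X) = (\<Sum>x\<in>X. coset_value a (h x))"
  by (induction X rule: infinite_finite_induct) (simp_all add: coset_value_add)

lemma coset_value_single_mult: "coset_value a (single m c * f) = c * coset_value (a - m) f"
proof -
  have "single m c * f = (\<Sum>k\<in>keys f. single (m + k) (c * coeff f k))"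
    by (subst nonneg.sum_of_terms[of f]) (simp add: sum_distrib_left mult_single)
  then have "coset_value a (single m c * f) =
      (\<Sum>k\<in>keys f. if k - (a - m) \<in> L then \<rho> (k - (a - m)) * (c * coeff f k) else 0)"
  proof -
    have eq: "m + k - a = k - (a - m)" for k by simp
    show ?thesis unfolding \<open>single m c * f = _\<close> coset_value_sum coset_value_single eq ..
  qed
  also have "\<dots> = (\<Sum>k\<in>{k \<in> keys f. k - (a - m) \<in> L}. \<rho> (k - (a - m)) * (c * coeff f k))"
    by (simp add: sum.inter_filter)
  finally show ?thesis by (simp add: coset_value_def sum_distrib_left mult_ac)
qed

lemma coset_value_part:
  assumes "\<And>m. m - a \<in> L \<Longrightarrow> m \<in> T" shows "coset_value a (part T f) = coset_value a f"
  unfolding coset_value_def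
  by (rule sum.cong) (use assms in \<open>auto simp: keys_part coeff_part\<close>)

lemma single_sum: "single m (sum h X) = (\<Sum>x\<in>X. single m (h x))" for h :: "_ \<Rightarrow> complex"
  by (induction X rule: infinite_finite_induct) (simp_all add: single_add)

text \<open>Modulo an ideal that identifies \<open>t\<^sup>m\<close> with \<open>\<rho>(m - a) t\<^sup>a\<close> on each coset, the part of \<open>f\<close>
  on a coset is its value times one monomial.\<close>

lemma coset_reduction:
  assumes Q: "exponent_monoid Q" and A: "ideal A (semigroup_ring Q)"
    and rel: "\<And>m a. m \<in> Q \<Longrightarrow> a \<in> Q \<Longrightarrow> m - a \<in> L \<Longrightarrow> single m 1 - single a (\<rho> (m - a)) \<in> A"
    and f: "keys f \<subseteq> Q" and a: "a \<in> Q"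
  shows "part {m. m - a \<in> L} f - single a (coset_value a f) \<in> A"
proof -
  interpret exponent_monoid Q by (rule Q)
  have eq: "{m \<in> keys f. m - a \<in> L} = keys f \<inter> {m. m - a \<in> L}" by auto
  have "part {m. m - a \<in> L} f - single a (coset_value a f) =
      (\<Sum>m\<in>keys f \<inter> {m. m - a \<in> L}. single 0 (coeff f m) * (single m 1 - single a (\<rho> (m - a))))"
    unfolding part_def coset_value_def eq single_sum
    by (simp add: right_diff_distrib mult_single mult.commute sum_subtractf)
  also have "\<dots> \<in> A"
    using f a by (intro ideal_sum[OF A] ideal_scalar_mult[OF A] rel) auto
  finally show ?thesis .
qed

text \<open>The cosets met by \<open>f\<close> are removed one after the other.\<close>

lemma coset_values_zero_imp_mem:
  assumes Q: "exponent_monoid Q" and A: "ideal A (semigroup_ring Q)"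
    and rel: "\<And>m a. m \<in> Q \<Longrightarrow> a \<in> Q \<Longrightarrow> m - a \<in> L \<Longrightarrow> single m 1 - single a (\<rho> (m - a)) \<in> A"
    and f: "keys f \<subseteq> Q" and zero: "\<And>a. a \<in> keys f \<Longrightarrow> coset_value a f = 0"
  shows "f \<in> A"
  using f zero
proof (induction "card (keys f)" arbitrary: f rule: less_induct)
  case less
  interpret exponent_monoid Q by (rule Q)
  show ?case
  proof (cases "f = 0")
    case True then show ?thesis using ideal_zero[OF A] by simp
  next
    case False
    then have "keys f \<noteq> {}" by simp
    then obtain a where a: "a \<in> keys f" by blast
    let ?T = "{m. m - a \<in> L}"
    have "part ?T f \<in> A"
      using coset_reduction[OF Q A rel less.prems(1), of a] less.prems a by auto
    moreover have "part (- ?T) f \<in> A"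
    proof (rule less.hyps)
      show "card (keys (part (- ?T) f)) < card (keys f)"
      proof -
        have "a \<notin> keys f \<inter> - ?T" using L_zero by simp
        then have "keys f \<inter> - ?T \<subset> keys f" using a by blast
        then show ?thesis unfolding keys_part by (intro psubset_card_mono) auto
      qed
      show "keys (part (- ?T) f) \<subseteq> Q" using less.prems(1) by (auto simp: keys_part)
      fix b assume b: "b \<in> keys (part (- ?T) f)"
      then have "m \<in> - ?T" if "m - b \<in> L" for m using L_shift[OF that] by (auto simp: keys_part)
      then have "coset_value b (part (- ?T) f) = coset_value b f" by (rule coset_value_part)
      then show "coset_value b (part (- ?T) f) = 0" using b less.prems(2) by (simp add: keys_part)
    qed
    ultimately have "part ?T f + part (- ?T) f \<in> A" by (rule ideal_add[OF A])
    then show ?thesis by (simp add: part_split)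
  qed
qed

abbreviation "char_gens \<equiv> {monomial (pos_part u) - scalar (\<rho> u) * monomial (neg_part u) | u. u \<in> L}"

lemma pos_neg_part: "pos_part u - neg_part u = u" "pos_part u \<in> nonneg_vecs" "neg_part u \<in> nonneg_vecs"
  by (auto simp: pos_part_def neg_part_def nonneg_vecs_def vec_eq_iff)

lemma char_gen_eq: "monomial (pos_part u) - scalar (\<rho> u) * monomial (neg_part u) =
    single (pos_part u) 1 - single (neg_part u) (\<rho> u)"
  by (simp add: monomial_eq_single scalar_eq_single mult_single)

lemma char_gens_binomials: "char_gens \<subseteq> binomials nonneg_vecs"
  using pos_neg_part(2,3) unfolding char_gen_eq subset_iff mem_binomials_iff by blast

lemma char_ideal_ideal: "ideal (char_ideal L \<rho>) (semigroup_ring nonneg_vecs)"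
  unfolding char_ideal_def poly_ring_def
  using char_gens_binomials nonneg.binomials_keys by (intro nonneg.Idl_ideal) blast

lemma char_gen_mem: "u \<in> L \<Longrightarrow> single (pos_part u) 1 - single (neg_part u) (\<rho> u) \<in> char_ideal L \<rho>"
  unfolding char_ideal_def poly_ring_def char_gen_eq
  using char_gens_binomials[unfolded char_gen_eq] nonneg.binomials_keys
  by (intro nonneg.Idl_superset[THEN subsetD]) blast+

lemma char_relation_translate:
  assumes "m - a \<in> L"
  shows "single m 1 - single a (\<rho> (m - a)) =
    single (a - neg_part (m - a)) 1 * (single (pos_part (m - a)) 1 - single (neg_part (m - a)) (\<rho> (m - a)))"
proof -
  have "a - neg_part (m - a) + pos_part (m - a) = m" using pos_neg_part(1)[of "m - a"] by (simp add: algebra_simps)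
  then show ?thesis by (simp add: right_diff_distrib mult_single)
qed

text \<open>Subtracting \<open>u_-\<close> from \<open>a\<close> leaves the componentwise minimum of \<open>m\<close> and \<open>a\<close> when
  \<open>u = m - a\<close>, so the relation is a monomial multiple of a generator.\<close>

lemma char_relation_poly:
  assumes "m \<in> nonneg_vecs" "a \<in> nonneg_vecs" "m - a \<in> L"
  shows "single m 1 - single a (\<rho> (m - a)) \<in> char_ideal L \<rho>"
proof -
  have "a - neg_part (m - a) \<in> nonneg_vecs"
    using assms(1,2) by (auto simp: nonneg_vecs_def neg_part_def)
  then show ?thesis unfolding char_relation_translate[OF assms(3)]
    by (intro nonneg.ideal_single_mult[OF char_ideal_ideal] char_gen_mem assms)
qed

lemma char_relation_local:
  assumes B: "ideal B (semigroup_ring (local_monoid J))" "char_ideal L \<rho> \<subseteq> B"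
    and ma: "a \<in> local_monoid J" "m - a \<in> L"
  shows "single m 1 - single a (\<rho> (m - a)) \<in> B"
proof -
  have "m - a \<in> coord_subgroup J" using ma LJ by blast
  then have "a - neg_part (m - a) \<in> local_monoid J"
    using ma(1) by (auto simp: local_monoid_def neg_part_def coord_subgroup_def)
  then show ?thesis unfolding char_relation_translate[OF ma(2)]
    using B(2) char_gen_mem[OF ma(2)] by (intro loc.ideal_single_mult[OF B(1)]) auto
qed

lemma var_gens_keys: "{variable j | j. j \<notin> J} \<subseteq> {f. keys f \<subseteq> nonneg_vecs}"
  by (auto simp: variable_def monomial_eq_single nonneg_vecs_def axis_def)

lemma var_ideal_ideal: "ideal (var_ideal J) (semigroup_ring nonneg_vecs)"
  unfolding var_ideal_def poly_ring_def by (rule nonneg.Idl_ideal[OF var_gens_keys])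

lemma variable_mem: "j \<notin> J \<Longrightarrow> variable j \<in> var_ideal J"
  unfolding var_ideal_def poly_ring_def by (intro nonneg.Idl_superset[OF var_gens_keys, THEN subsetD]) blast

lemma char_prime_ideal: "ideal (char_prime L \<rho> J) (semigroup_ring nonneg_vecs)"
  and char_ideal_subset: "char_ideal L \<rho> \<subseteq> char_prime L \<rho> J"
  and var_ideal_subset: "var_ideal J \<subseteq> char_prime L \<rho> J"
  unfolding char_prime_def poly_ring_def
  using nonneg.ideal_sum_set[OF char_ideal_ideal var_ideal_ideal] by auto

text \<open>On a generator of \<open>I\<^sub>\<rho>\<close> every functional vanishes by the homomorphism property of \<open>\<rho>\<close>; on
  multiples of the \<open>t\<^sub>j\<close>, \<open>j \<notin> J\<close>, those with \<open>a \<in> \<int>\<^sup>J\<close> do because \<open>L \<subseteq> \<int>\<^sup>J\<close>.\<close>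

lemma coset_value_char_prime:
  assumes f: "f \<in> char_prime L \<rho> J" and a: "a \<in> coord_subgroup J"
  shows "coset_value a f = 0"
proof -
  obtain g h where gh: "g \<in> char_ideal L \<rho>" "h \<in> var_ideal J" "f = g + h"
    using f by (auto simp: char_prime_def poly_ring_def mem_set_add_semigroup_ring)
  have k: "char_gens \<subseteq> {f. keys f \<subseteq> nonneg_vecs}" using char_gens_binomials nonneg.binomials_keys by blast
  have "coset_value a g = 0"
    using gh(1)[unfolded char_ideal_def poly_ring_def] k
  proof (induction g rule: nonneg.Idl_induct)
    case (single g m c)
    then obtain u where u: "u \<in> L" "g = single (pos_part u) 1 - single (neg_part u) (\<rho> u)"
      by (auto simp: char_gen_eq)
    have "coset_value b g = 0" for b
    proof -
      have eq: "pos_part u - b = u + (neg_part u - b)" using pos_neg_part(1)[of u] by (simp add: algebra_simps)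
      have "pos_part u - b \<in> L \<longleftrightarrow> neg_part u - b \<in> L" using L_shift[of "pos_part u" "neg_part u" b] u pos_neg_part(1)[of u] by simp
      then show ?thesis using u rho_add[OF u(1), of "neg_part u - b"]
        by (auto simp: coset_value_diff coset_value_single eq)
    qed
    then show ?case by (simp add: coset_value_single_mult)
  qed (simp_all add: coset_value_add)
  moreover have "coset_value a h = 0"
    using gh(2)[unfolded var_ideal_def poly_ring_def] var_gens_keys
  proof (induction h rule: nonneg.Idl_induct)
    case (single g m c)
    then obtain j where j: "j \<notin> J" "g = single (axis j 1) 1" by (auto simp: variable_def monomial_eq_single)
    have "m $ j \<ge> 0" "a $ j = 0" using single(2) a j(1) by (simp_all add: coord_subgroup_def nonneg_vecs_def)
    then have "(axis j 1 - (a - m)) $ j > 0" by simp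
    moreover have "v $ j = 0" if "v \<in> L" for v using LJ j(1) that by (auto simp: coord_subgroup_def)
    ultimately have "axis j 1 - (a - m) \<notin> L" by force
    then show ?case by (simp add: coset_value_single_mult coset_value_single j)
  qed (simp_all add: coset_value_add)
  ultimately show ?thesis by (simp add: gh coset_value_add)
qed

lemma coset_values_zero_imp_char_ideal:
  assumes "keys f \<subseteq> nonneg_vecs" "keys f \<subseteq> coord_subgroup J"
    and "\<And>a. a \<in> coord_subgroup J \<Longrightarrow> coset_value a f = 0"
  shows "f \<in> char_ideal L \<rho>"
  by (rule coset_values_zero_imp_mem[OF nonneg.exponent_monoid_axioms char_ideal_ideal char_relation_poly])
     (use assms in auto)

lemma coset_values_zero_imp_char_prime:
  assumes f: "keys f \<subseteq> nonneg_vecs" and zero: "\<And>a. a \<in> coord_subgroup J \<Longrightarrow> coset_value a f = 0"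
  shows "f \<in> char_prime L \<rho> J"
proof -
  let ?Z = "coord_subgroup J"
  have "part ?Z f \<in> char_ideal L \<rho>"
  proof (rule coset_values_zero_imp_char_ideal)
    show "coset_value a (part ?Z f) = 0" if a: "a \<in> ?Z" for a
    proof -
      have "m \<in> ?Z" if "m - a \<in> L" for m using coord_add[of "m - a" J a] that LJ a by auto
      then show ?thesis using coset_value_part zero[OF a] by simp
    qed
  qed (use f in \<open>auto simp: keys_part\<close>)
  moreover have "part (- ?Z) f \<in> var_ideal J"
    unfolding part_def
  proof (rule nonneg.ideal_sum[OF var_ideal_ideal])
    fix u assume u: "u \<in> keys f \<inter> - ?Z"
    then obtain j where j: "j \<notin> J" "u $ j \<noteq> 0" by (auto simp: coord_subgroup_def)
    have un: "u \<in> nonneg_vecs" using u f by auto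
    then have "u - axis j 1 \<in> nonneg_vecs"
      using j by (auto simp: nonneg_vecs_def axis_def) (smt (verit))
    from nonneg.ideal_single_mult[OF var_ideal_ideal variable_mem[OF j(1)] this, of "coeff f u"]
    show "single u (coeff f u) \<in> var_ideal J" by (simp add: variable_def monomial_eq_single mult_single)
  qed
  ultimately have "part ?Z f + part (- ?Z) f \<in> char_prime L \<rho> J"
    using char_ideal_subset var_ideal_subset by (intro nonneg.ideal_add[OF char_prime_ideal]) auto
  then show ?thesis by (simp add: part_split)
qed

lemma shift_notin_char_prime: "single (shift J k) 1 \<notin> char_prime L \<rho> J"
  using coset_value_char_prime[OF _ shift_coord, of "single (shift J k) 1" k] L_zero
  by (auto simp: coset_value_single)

text \<open>As \<open>L \<subseteq> \<int>\<^sup>J\<close>, the target of \<open>quotient_map\<close> is simply the quotient by \<open>L\<close>.\<close>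

lemma quotient_map_eq_iff: "quotient_map J L u = quotient_map J L v \<longleftrightarrow> u - v \<in> L"
proof
  assume eq: "quotient_map J L u = quotient_map J L v"
  have "coord_part J u \<in> L #>\<^bsub>int_vec_group\<^esub> coord_part J u"
    using L_zero by (auto simp: r_coset_def int_vec_group_def intro!: bexI[of _ 0])
  then have "coord_part J u \<in> L #>\<^bsub>int_vec_group\<^esub> coord_part J v" using eq by (simp add: quotient_map_def)
  then obtain h where h: "h \<in> L" "coord_part J u = h + coord_part J v" by (auto simp: r_coset_def int_vec_group_def)
  have "coord_part (- J) u = coord_part (- J) v" using eq by (simp add: quotient_map_def)
  moreover have "u = coord_part J u + coord_part (- J) u" "v = coord_part J v + coord_part (- J) v"
    by (auto simp: coord_part_def vec_eq_iff)
  ultimately have "u - v = h" using h(2) by (metis add.assoc add_diff_cancel_right')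
  then show "u - v \<in> L" using h by simp
next
  assume uv: "u - v \<in> L"
  then have z: "\<And>i. i \<notin> J \<Longrightarrow> u $ i = v $ i" using LJ by (force simp: coord_subgroup_def)
  then have h: "coord_part J u = (u - v) + coord_part J v" and "coord_part (- J) u = coord_part (- J) v"
    by (auto simp: coord_part_def vec_eq_iff)
  moreover have "L #>\<^bsub>int_vec_group\<^esub> ((u - v) + x) = L #>\<^bsub>int_vec_group\<^esub> x" for x
  proof -
    have "\<exists>h'\<in>L. h + ((u - v) + x) = h' + x" if "h \<in> L" for h
      using L_add[OF that uv] by (intro bexI[of _ "h + (u - v)"]) (simp_all add: add.assoc)
    moreover have "\<exists>h'\<in>L. h + x = h' + ((u - v) + x)" if "h \<in> L" for h
      using L_diff[OF that uv] by (intro bexI[of _ "h - (u - v)"]) simp_all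
    ultimately show ?thesis by (auto simp: r_coset_def int_vec_group_def)
  qed
  ultimately show "quotient_map J L u = quotient_map J L v" by (simp add: quotient_map_def)
qed

end

section \<open>The local structure at a lattice prime\<close>

lemma finite_image_factor:
  assumes fin: "finite (f ` X)" and eq: "\<And>x y. x \<in> X \<Longrightarrow> y \<in> X \<Longrightarrow> f x = f y \<Longrightarrow> g x = g y"
  shows "finite (g ` X)"
proof -
  have "g ` X \<subseteq> (\<lambda>v. g (SOME x. x \<in> X \<and> f x = v)) ` f ` X"
  proof
    fix z assume "z \<in> g ` X"
    then obtain x where x: "x \<in> X" "z = g x" by blast
    have "\<exists>x'. x' \<in> X \<and> f x' = f x" using x by blast
    from someI_ex[OF this] have "g (SOME x'. x' \<in> X \<and> f x' = f x) = z"
      using eq[of "SOME x'. x' \<in> X \<and> f x' = f x" x] x by blast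
    then show "z \<in> (\<lambda>v. g (SOME x. x \<in> X \<and> f x = v)) ` f ` X" using x by blast
  qed
  then show ?thesis using fin finite_subset by blast
qed

locale lattice_prime = lattice_character J L \<rho>
  for J :: "'n::finite set" and L \<rho> +
  assumes prime: "primeideal (char_prime L \<rho> J) (semigroup_ring nonneg_vecs)"
begin

abbreviation "P \<equiv> char_prime L \<rho> J"

end

text \<open>The condition on the \<open>t\<^sub>j\<close> is what remains of the minimality of \<open>P\<close> over \<open>I\<close> once
  \<open>I\<^sub>\<rho> \<subseteq> I\<close>; it can be verified directly when a monomial ideal \<open>K\<close> has been added.\<close>

locale lattice_component = lattice_prime J L \<rho>
  for J :: "'n::finite set" and L \<rho> +
  fixes I :: "'n laurent set"
  assumes binomial: "binomial_ideal_in nonneg_vecs I"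
    and char_sub: "char_ideal L \<rho> \<subseteq> I" and sub_prime: "I \<subseteq> char_prime L \<rho> J"
    and nilpotent: "\<And>j. j \<notin> J \<Longrightarrow> \<exists>N. variable j ^ N \<in> nonneg.SR.local_kernel I (char_prime L \<rho> J)"
begin

abbreviation "M \<equiv> local_monoid J"

definition B :: "'n laurent set" where "B = Idl\<^bsub>semigroup_ring M\<^esub> I"

abbreviation "cong \<equiv> ideal_congruence M B"

definition U :: "(int ^ 'n) set" where
  "U = {u \<in> M. infinite (quotient_map J L ` (cong `` {u}))}"

text \<open>The extension of \<open>component_candidate\<close> to \<open>\<complex>[M]\<close>: only the part of \<open>f\<close> supported on
  the finite classes has to lie in \<open>B\<close>.\<close>

definition D :: "'n laurent set" where
  "D = {f. keys f \<subseteq> M \<and> part (- U) f \<in> B}"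

lemma I_ideal: "ideal I (semigroup_ring nonneg_vecs)"
  by (rule nonneg.binomial_ideal_in_ideal[OF binomial])

lemma B_binomial: "binomial_ideal_in M B"
  unfolding B_def by (rule binomial_ideal_in_local[OF binomial])

lemma B_ideal: "ideal B (semigroup_ring M)"
  by (rule loc.binomial_ideal_in_ideal[OF B_binomial])

lemma mem_B_iff: "f \<in> B \<longleftrightarrow> keys f \<subseteq> M \<and> (\<exists>k. single (shift J k) 1 * f \<in> I)"
  unfolding B_def by (rule Idl_local_iff[OF I_ideal])

lemma I_subset_B: "I \<subseteq> B"
proof
  fix f assume f: "f \<in> I"
  then have "single (shift J 0) 1 * f \<in> I" by simp
  moreover have "keys f \<subseteq> M" using nonneg.ideal_keys[OF I_ideal f] nonneg_subset_local by blast
  ultimately show "f \<in> B" unfolding mem_B_iff by blast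
qed

lemma relation_B: "m \<in> M \<Longrightarrow> a \<in> M \<Longrightarrow> m - a \<in> L \<Longrightarrow> single m 1 - single a (\<rho> (m - a)) \<in> B"
  using char_relation_local[OF B_ideal] char_sub I_subset_B by blast

lemma cong_lattice: "m \<in> M \<Longrightarrow> a \<in> M \<Longrightarrow> m - a \<in> L \<Longrightarrow> (m, a) \<in> cong"
  using relation_B[of m a] rho_nonzero by (auto simp: mem_ideal_congruence_iff)

lemma unit_B_iff: "m \<in> coord_subgroup J \<Longrightarrow> c \<noteq> 0 \<Longrightarrow> single m c * f \<in> B \<longleftrightarrow> f \<in> B"
  using loc.ideal_unit_mult_iff[OF B_ideal] coord_local coord_uminus by blast

lemma P_prime: "keys f \<subseteq> nonneg_vecs \<Longrightarrow> keys g \<subseteq> nonneg_vecs \<Longrightarrow> f * g \<in> P \<Longrightarrow> f \<in> P \<or> g \<in> P"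
  using primeideal.I_prime[OF prime, of f g] by simp

lemma notin_P: "keys s \<subseteq> nonneg_vecs \<Longrightarrow> s \<notin> P \<Longrightarrow> \<exists>a\<in>coord_subgroup J. coset_value a s \<noteq> 0"
  using coset_values_zero_imp_char_prime by blast

subsection \<open>Infinite classes\<close>

lemma U_subset: "U \<subseteq> M"
  by (auto simp: U_def)

lemma U_closed: "congruence_closed M B U"
proof -
  have "cong `` {u} = cong `` {v}" if "(u, v) \<in> cong" for u v
    using that loc.congruence_trans[OF B_ideal] loc.congruence_sym[OF B_ideal] by blast
  moreover have "u \<in> M" "v \<in> M" if "(u, v) \<in> cong" for u v using that by (auto simp: mem_ideal_congruence_iff)
  ultimately show ?thesis unfolding congruence_closed_def U_def by auto
qed

lemma U_add:
  assumes u: "u \<in> U" and m: "m \<in> M" shows "m + u \<in> U"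
proof -
  let ?C = "cong `` {u}" and ?q = "quotient_map J L"
  have "infinite (?q ` (\<lambda>w. m + w) ` ?C)"
  proof
    assume "finite (?q ` (\<lambda>w. m + w) ` ?C)"
    then have "finite ((\<lambda>w. ?q (m + w)) ` ?C)" by (simp add: image_image)
    then have "finite (?q ` ?C)" by (rule finite_image_factor) (simp add: quotient_map_eq_iff)
    then show False using u by (simp add: U_def)
  qed
  moreover have "(\<lambda>w. m + w) ` ?C \<subseteq> cong `` {m + u}" using loc.congruence_translate[OF B_ideal _ m] by blast
  ultimately have "infinite (?q ` (cong `` {m + u}))" by (meson finite_subset image_mono)
  moreover have "m + u \<in> M" using loc.add_mem[OF m, of u] u U_subset by blast
  ultimately show ?thesis by (simp add: U_def)
qed

lemma U_add_unit_iff: "a \<in> coord_subgroup J \<Longrightarrow> a + u \<in> U \<longleftrightarrow> u \<in> U"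
  using U_add[of u a] U_add[of "a + u" "- a"] coord_local[of a J] coord_local[of "- a" J] coord_uminus[of a J]
  by auto

text \<open>All monomials in \<open>B\<close> are congruent.  If there is some \<open>j \<notin> J\<close>, the multiples of \<open>t\<^sup>w\<close> by
  powers of \<open>t\<^sub>j\<close> make the class infinite; if there is none, a monomial in \<open>B\<close> would be a unit,
  while \<open>B\<close> is a proper ideal.\<close>

lemma monomial_B_imp_U:
  assumes w: "w \<in> M" and wB: "single w 1 \<in> B" shows "w \<in> U"
proof (cases "J = UNIV")
  case True
  then have wc: "w \<in> coord_subgroup J" by (simp add: coord_subgroup_def)
  obtain k where "single (shift J k) 1 * single w 1 \<in> I" using wB mem_B_iff by blast
  then have "single (shift J k + w) 1 \<in> P" using sub_prime by (auto simp: mult_single)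
  from coset_value_char_prime[OF this coord_add[OF shift_coord[of J k] wc]]
  have False using L_zero by (simp add: coset_value_single)
  then show ?thesis ..
next
  case False
  then obtain j where j: "j \<notin> J" by blast
  define h where "h k = axis j (int k) + w" for k
  have aM: "axis j (int k) \<in> M" for k by (auto simp: local_monoid_def axis_def)
  have hB: "single (h k) 1 \<in> B" for k
    using loc.ideal_single_mult[OF B_ideal wB aM[of k], of 1] by (simp add: h_def mult_single)
  have hM: "h k \<in> M" for k unfolding h_def using aM w by (rule loc.add_mem)
  have "(w, h k) \<in> cong" for k
    using w hM loc.ideal_diff[OF B_ideal wB hB] by (auto simp: mem_ideal_congruence_iff intro!: exI[of _ 1])
  then have "range (\<lambda>k. quotient_map J L (h k)) \<subseteq> quotient_map J L ` (cong `` {w})" by blast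
  moreover have "inj (\<lambda>k. quotient_map J L (h k))"
  proof (rule injI)
    fix k l assume "quotient_map J L (h k) = quotient_map J L (h l)"
    then have "h k - h l \<in> coord_subgroup J" using LJ quotient_map_eq_iff by blast
    then have "(h k - h l) $ j = 0" using j by (simp add: coord_subgroup_def)
    then show "k = l" by (simp add: h_def)
  qed
  ultimately have "infinite (quotient_map J L ` (cong `` {w}))"
    using range_inj_infinite infinite_super by blast
  then show ?thesis using w by (simp add: U_def)
qed

text \<open>If \<open>d + w\<close> is congruent to \<open>w\<close>, then so are all \<open>k d + w\<close>.  On a finite class two of them
  agree modulo \<open>L\<close>, and \<open>L\<close> is saturated.\<close>

lemma finite_class_stabilizer:
  assumes d: "d \<in> M" and w: "w \<in> M" "w \<notin> U" and dw: "(d + w, w) \<in> cong"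
  shows "d \<in> L"
proof -
  have k: "(int k *s d + w, w) \<in> cong" for k
  proof (induction k)
    case 0
    then show ?case using loc.congruence_refl[OF B_ideal w(1)] by simp
  next
    case (Suc k)
    have "(d + (int k *s d + w), d + w) \<in> cong" by (rule loc.congruence_translate[OF B_ideal Suc d])
    from loc.congruence_trans[OF B_ideal this dw]
    show ?case by (simp add: vector_sadd_rdistrib algebra_simps)
  qed
  have "range (\<lambda>k. quotient_map J L (int k *s d + w)) \<subseteq> quotient_map J L ` (cong `` {w})"
    using loc.congruence_sym[OF B_ideal k] by blast
  moreover have "finite (quotient_map J L ` (cong `` {w}))" using w by (simp add: U_def)
  ultimately have "\<not> inj (\<lambda>k. quotient_map J L (int k *s d + w))"
    using range_inj_infinite finite_subset by blast
  then obtain k l where kl: "k < l" "quotient_map J L (int l *s d + w) = quotient_map J L (int k *s d + w)"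
    unfolding inj_def by (metis linorder_neqE_nat)
  have "int (l - k) *s d = (int l *s d + w) - (int k *s d + w)"
    using kl(1) by (simp add: vec_eq_iff of_nat_diff left_diff_distrib)
  then have "int (l - k) *s d \<in> L" using kl(2) by (simp add: quotient_map_eq_iff)
  then show ?thesis by (rule L_saturated) (use kl(1) in simp)
qed

subsection \<open>The ideal of the component in the localization\<close>

lemma D_keys: "f \<in> D \<Longrightarrow> keys f \<subseteq> M"
  by (simp add: D_def)

lemma B_subset_D: "B \<subseteq> D"
  using loc.ideal_keys[OF B_ideal]
    loc.binomial_ideal_part[OF B_binomial congruence_closed_Compl[OF U_closed]]
  by (auto simp: D_def)

lemma D_ideal: "ideal D (semigroup_ring M)"
  unfolding loc.ideal_semigroup_ring_iff
proof (intro conjI ballI allI impI)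
  show "D \<subseteq> {f. keys f \<subseteq> M}" by (auto simp: D_def)
  show "0 \<in> D" using loc.ideal_zero[OF B_ideal] by (simp add: D_def)
  show "a + b \<in> D" if "a \<in> D" "b \<in> D" for a b
    using that loc.ideal_add[OF B_ideal] loc.keys_add_subset[of a J b] by (simp add: D_def part_add)
  fix a x :: "'n laurent" assume a: "a \<in> D" and x: "keys x \<subseteq> M"
  have "keys (x * part U a) \<subseteq> U"
    using keys_mult[of x "part U a"] x U_add by (auto simp: keys_part)
  then have "part (- U) (x * part U a) = 0" by (intro part_disjoint) auto
  moreover have "x * a = x * part U a + x * part (- U) a"
    by (simp add: part_split flip: distrib_left)
  ultimately have "part (- U) (x * a) = part (- U) (x * part (- U) a)"
    by (simp add: part_add)
  moreover have "x * part (- U) a \<in> B" using a loc.ideal_mult[OF B_ideal _ x] by (simp add: D_def)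
  ultimately have "part (- U) (x * a) \<in> B"
    using loc.binomial_ideal_part[OF B_binomial congruence_closed_Compl[OF U_closed]] by simp
  then show "x * a \<in> D" using loc.keys_mult_subset[OF x D_keys[OF a]] by (simp add: D_def)
qed

lemma D_part:
  assumes T: "congruence_closed M B T" and f: "f \<in> D" shows "part T f \<in> D"
proof -
  have "part (- U) (part T f) = part T (part (- U) f)"
    by (simp add: part_part Int_commute)
  then show ?thesis using loc.binomial_ideal_part[OF B_binomial T] f
    by (auto simp: D_def keys_part)
qed

lemma supported_on_U: "keys f \<subseteq> U \<Longrightarrow> f \<in> D"
proof -
  assume f: "keys f \<subseteq> U"
  then have "part (- U) f = 0" by (intro part_disjoint) blast
  then show "f \<in> D" using f U_subset loc.ideal_zero[OF B_ideal] by (auto simp: D_def)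
qed

lemma D_off_U: "f \<in> D \<Longrightarrow> keys f \<inter> U = {} \<Longrightarrow> f \<in> B"
proof -
  assume "f \<in> D" "keys f \<inter> U = {}"
  moreover from this have "part (- U) f = f" by (intro part_id) blast
  ultimately show "f \<in> B" by (simp add: D_def)
qed

text \<open>When the class of \<open>w\<close> is finite modulo \<open>L\<close>, the only terms of \<open>s\<close> that carry \<open>t\<^sup>w\<close> into the
  class of \<open>a + w\<close> are those in the coset \<open>a + L\<close>, by the computation of the stabilizer; their
  sum is the coset value of \<open>s\<close> times \<open>t\<^sup>a\<close>, and \<open>t\<^sup>a\<^sup>+\<^sup>w\<close> is not in \<open>B\<close>.\<close>

lemma monomial_nonzerodivisor:
  assumes s: "keys s \<subseteq> M" and a: "a \<in> coord_subgroup J" "coset_value a s \<noteq> 0"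
    and w: "w \<in> M" "w \<notin> U"
  shows "single w 1 * s \<notin> D"
proof
  assume sD: "single w 1 * s \<in> D"
  let ?T = "cong `` {a + w}"
  have aM: "a \<in> M" "- a \<in> M" using coord_local coord_uminus a(1) by blast+
  have awM: "a + w \<in> M" using aM w loc.add_mem by blast
  have awU: "a + w \<notin> U" using U_add_unit_iff[OF a(1)] w by blast
  have T: "congruence_closed M B ?T" by (rule loc.congruence_closed_class[OF B_ideal])
  have disj: "?T \<inter> U = {}" using U_closed awU by (auto simp: congruence_closed_def)
  have "part ?T (single w 1 * s) \<in> B"
    using D_part[OF T sD] disj by (intro D_off_U) (auto simp: keys_part)
  moreover have "part ?T (single w 1 * s) = single w 1 * part {m. m - a \<in> L} s"
  proof -
    have "w + m \<in> ?T \<longleftrightarrow> m - a \<in> L" if m: "m \<in> keys s" for m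
    proof
      have mM: "m \<in> M" using s m by blast
      assume "w + m \<in> ?T"
      then have "(w + m, a + w) \<in> cong" using loc.congruence_sym[OF B_ideal] by blast
      from loc.congruence_translate[OF B_ideal this aM(2)]
      have "((m - a) + w, w) \<in> cong" by (simp add: algebra_simps)
      moreover have "m - a \<in> M" using loc.add_mem[OF aM(2) mM] by simp
      ultimately show "m - a \<in> L" using finite_class_stabilizer w by blast
    next
      have mM: "w + m \<in> M" using s m w loc.add_mem by blast
      assume "m - a \<in> L"
      then have "(w + m, a + w) \<in> cong" using cong_lattice[OF mM awM] by (simp add: algebra_simps)
      then show "w + m \<in> ?T" using loc.congruence_sym[OF B_ideal] by blast
    qed
    then have "part {m. w + m \<in> ?T} s = part {m. m - a \<in> L} s"
      by (intro poly_mapping_eqI) (auto simp: coeff_part in_keys_iff)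
    then show ?thesis by (simp add: part_single_mult)
  qed
  moreover have "part {m. m - a \<in> L} s - single a (coset_value a s) \<in> B"
    by (rule coset_reduction[OF loc.exponent_monoid_axioms B_ideal relation_B s aM(1)])
  then have "single w 1 * (part {m. m - a \<in> L} s - single a (coset_value a s)) \<in> B"
    by (rule loc.ideal_single_mult[OF B_ideal _ w(1)])
  ultimately have "single w 1 * single a (coset_value a s) \<in> B"
    using loc.ideal_diff[OF B_ideal, of "single w 1 * part {m. m - a \<in> L} s"
        "single w 1 * (part {m. m - a \<in> L} s - single a (coset_value a s))"]
    by (simp add: right_diff_distrib)
  then have "single (a + w) (coset_value a s) \<in> B" by (simp add: mult_single add.commute)
  then have "single (a + w) 1 \<in> B" using loc.monomial_mem_iff[OF B_ideal a(2)] by simp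
  then show False using monomial_B_imp_U[OF awM] awU by blast
qed

lemma variable_power_U: "j \<notin> J \<Longrightarrow> \<exists>N. axis j (int N) \<in> U"
proof -
  assume j: "j \<notin> J"
  then obtain N s where s: "keys s \<subseteq> nonneg_vecs" "s \<notin> P" "s * variable j ^ N \<in> I"
    using nilpotent[OF j] by (auto simp: nonneg.SR.local_kernel_def)
  obtain a where a: "a \<in> coord_subgroup J" "coset_value a s \<noteq> 0" using notin_P s by blast
  have "single (axis j (int N)) 1 * s \<in> D"
    using s(3) I_subset_B B_subset_D by (auto simp: variable_power mult.commute)
  moreover have "axis j (int N) \<in> M" by (auto simp: local_monoid_def axis_def)
  moreover have "keys s \<subseteq> M" using s(1) nonneg_subset_local by blast
  ultimately have "axis j (int N) \<in> U" using monomial_nonzerodivisor a by blast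
  then show ?thesis ..
qed

text \<open>The units of \<open>\<int>\<^sup>J\<close> permute the classes.  An element supported on the orbit of a finite
  class is a Laurent polynomial in the \<open>t\<^sub>j\<close>, \<open>j \<in> J\<close>, times one monomial, and for these
  polynomials cancellation of \<open>s\<close> is the primality of \<open>P\<close>.\<close>

lemma unit_part_nonzerodivisor:
  assumes s: "keys s \<subseteq> nonneg_vecs" "keys s \<subseteq> coord_subgroup J" "s \<notin> P"
    and f: "keys f \<subseteq> M" "keys f \<inter> U = {}" and sf: "s * f \<in> D"
  shows "f \<in> B"
  using f sf
proof (induction "card (keys f)" arbitrary: f rule: less_induct)
  case less
  show ?case
  proof (cases "f = 0")
    case True
    then show ?thesis using loc.ideal_zero[OF B_ideal] by simp
  next
    case False
    then have "keys f \<noteq> {}" by simp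
    then obtain w where w: "w \<in> keys f" by blast
    have wM: "w \<in> M" "w \<notin> U" using less.prems w by auto
    define T where "T = {v. \<exists>g\<in>coord_subgroup J. (g + w, v) \<in> cong}"
    have T: "congruence_closed M B T"
      using loc.congruence_trans[OF B_ideal] loc.congruence_sym[OF B_ideal]
      unfolding congruence_closed_def T_def by blast
    have T_add: "m + v \<in> T" if m: "m \<in> coord_subgroup J" and v: "v \<in> T" for m v
    proof -
      obtain g where g: "g \<in> coord_subgroup J" "(g + w, v) \<in> cong" using v by (auto simp: T_def)
      from loc.congruence_translate[OF B_ideal g(2) coord_local[OF m]]
      have "((m + g) + w, m + v) \<in> cong" by (simp add: add.assoc)
      then show ?thesis using coord_add[OF m g(1)] unfolding T_def by blast
    qed
    have T_iff: "m + v \<in> T \<longleftrightarrow> v \<in> T" if "m \<in> coord_subgroup J" for m v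
      using T_add[OF that] T_add[OF coord_uminus[OF that], of "m + v"] by auto
    have sT: "part T (s * f) = s * part T f" "part (- T) (s * f) = s * part (- T) f"
      using T_iff s(2) by (intro part_invariant_mult; blast)+
    have kM: "keys (part T' f) \<subseteq> M" for T' using less.prems by (auto simp: keys_part)
    have "part (- T) f \<in> B"
    proof (rule less.hyps)
      have "0 + w \<in> T" unfolding T_def using loc.congruence_refl[OF B_ideal wM(1)] coord_zero by force
      then have "keys f \<inter> - T \<subset> keys f" using w by auto
      then show "card (keys (part (- T) f)) < card (keys f)"
        unfolding keys_part by (intro psubset_card_mono) auto
      show "keys (part (- T) f) \<inter> U = {}" using less.prems by (auto simp: keys_part)
      show "s * part (- T) f \<in> D"
        using D_part[OF congruence_closed_Compl[OF T] less.prems(3)] sT by simp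
    qed (rule kM)
    moreover have "part T f \<in> B"
    proof -
      have "\<exists>p. keys p \<subseteq> coord_subgroup J \<and> single v c - p * single w 1 \<in> B" if vT: "v \<in> T" for v c
      proof -
        obtain g where g: "g \<in> coord_subgroup J" "(v, g + w) \<in> cong"
          using vT loc.congruence_sym[OF B_ideal] unfolding T_def by blast
        then obtain b where b: "single v 1 - single (g + w) b \<in> B" by (auto simp: mem_ideal_congruence_iff)
        from loc.ideal_scalar_mult[OF B_ideal b, of c]
        have "single v c - single g (c * b) * single w 1 \<in> B" by (simp add: right_diff_distrib mult_single)
        moreover have "keys (single g (c * b)) \<subseteq> coord_subgroup J" using g by (simp split: if_splits)
        ultimately show ?thesis by blast
      qed
      then have "\<forall>v\<in>keys f \<inter> T. \<exists>p. keys p \<subseteq> coord_subgroup J \<and> single v (coeff f v) - p * single w 1 \<in> B" by blast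
      from bchoice[OF this] obtain p where p: "\<And>v. v \<in> keys f \<inter> T \<Longrightarrow> keys (p v) \<subseteq> coord_subgroup J"
        "\<And>v. v \<in> keys f \<inter> T \<Longrightarrow> single v (coeff f v) - p v * single w 1 \<in> B" by blast
      define q where "q = (\<Sum>v\<in>keys f \<inter> T. p v)"
      have qZ: "keys q \<subseteq> coord_subgroup J" unfolding q_def using keys_sum[of p "keys f \<inter> T"] p(1) by blast
      have "part T f - q * single w 1 = (\<Sum>v\<in>keys f \<inter> T. single v (coeff f v) - p v * single w 1)"
        by (simp add: q_def part_def sum_distrib_right sum_subtractf)
      also have "\<dots> \<in> B" by (intro loc.ideal_sum[OF B_ideal] p)
      finally have fq: "part T f - q * single w 1 \<in> B" .
      have qM: "keys q \<subseteq> M" using qZ coord_local by blast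
      have sM: "keys s \<subseteq> M" using s(1) nonneg_subset_local by blast
      obtain k where k: "keys (single (shift J k) 1 * q) \<subseteq> nonneg_vecs" using clear_denominators[OF qM] by blast
      define r where "r = single (shift J k) 1 * q"
      have rZ: "keys r \<subseteq> coord_subgroup J"
        unfolding r_def using qZ shift_coord[of J k] coord_add by (auto simp: keys_single_mult)
      have "s * part T f \<in> D" using D_part[OF T less.prems(3)] sT by simp
      moreover have "s * (part T f - q * single w 1) \<in> D"
        using loc.ideal_mult[OF B_ideal fq sM] B_subset_D by blast
      ultimately have "s * part T f - s * (part T f - q * single w 1) \<in> D"
        by (rule loc.ideal_diff[OF D_ideal])
      then have "s * (q * single w 1) \<in> D" by (simp add: right_diff_distrib)
      from loc.ideal_single_mult[OF D_ideal this coord_local[OF shift_coord[of J k]], where c = 1]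
      have "single w 1 * (s * r) \<in> D" by (simp add: r_def mult_ac)
      moreover have "keys (s * r) \<subseteq> M" unfolding r_def using sM qM coord_local[OF shift_coord]
        by (intro loc.keys_mult_subset) auto
      ultimately have zero: "coset_value a (s * r) = 0" if "a \<in> coord_subgroup J" for a
        using monomial_nonzerodivisor[OF _ that _ wM] by blast
      have kr: "keys r \<subseteq> nonneg_vecs" using k by (simp add: r_def)
      have "s * r \<in> P" using coset_values_zero_imp_char_prime zero nonneg.keys_mult_subset[OF s(1) kr] by blast
      then have "r \<in> P" using P_prime[OF s(1) kr] s(3) by blast
      then have "r \<in> char_ideal L \<rho>"
        using coset_values_zero_imp_char_ideal[OF kr rZ] coset_value_char_prime by blast
      then have "r \<in> B" using char_sub I_subset_B by blast
      then have "q \<in> B" unfolding r_def using unit_B_iff[OF shift_coord, of 1 k q] by simp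
      then have "q * single w 1 \<in> B" using loc.ideal_single_mult[OF B_ideal _ wM(1), of q 1] by (simp add: mult.commute)
      from loc.ideal_add[OF B_ideal fq this] show ?thesis by simp
    qed
    ultimately have "part T f + part (- T) f \<in> B" using loc.ideal_add[OF B_ideal] by blast
    then show ?thesis by (simp add: part_split)
  qed
qed

text \<open>Multiplying by a monomial \<open>t\<^sup>v\<close> of maximal degree with \<open>t\<^sup>v f \<notin> D\<close> one may assume that all
  \<open>t\<^sub>j\<close>, \<open>j \<notin> J\<close>, kill \<open>f\<close> modulo \<open>D\<close>; then only the part of \<open>s\<close> supported on \<open>\<int>\<^sup>J\<close> acts.\<close>

lemma D_nonzerodivisor:
  assumes s: "keys s \<subseteq> nonneg_vecs" "s \<notin> P" and f: "keys f \<subseteq> M" and sf: "s * f \<in> D"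
  shows "f \<in> D"
proof (rule ccontr)
  assume nf: "f \<notin> D"
  obtain N where N: "\<And>j. j \<notin> J \<Longrightarrow> axis j (int (N j)) \<in> U" using variable_power_U by metis
  \<comment> \<open>the degrees of such \<open>v\<close> are bounded because powers of the \<open>t\<^sub>j\<close> lie in \<open>D\<close>\<close>
  let ?V = "\<lambda>v. v \<in> coord_submonoid (- J) \<and> single v 1 * f \<notin> D"
  have V0: "?V 0" using nf coord.zero_mem by simp
  have bound: "v $ j < int (N j)" if v: "?V v" and j: "j \<notin> J" for v j
  proof (rule ccontr)
    assume "\<not> v $ j < int (N j)"
    then have "v - axis j (int (N j)) \<in> M"
      using v by (auto simp: local_monoid_def coord_submonoid_def nonneg_vecs_def axis_def)
    from U_add[OF N[OF j] this] have "v \<in> U" by simp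
    then have "single v 1 \<in> D" by (intro supported_on_U) simp
    from loc.ideal_mult[OF D_ideal this f] show False using v by (simp add: mult.commute)
  qed
  have vle: "nat (\<Sum>i\<in>UNIV. v $ i) < Suc (\<Sum>i\<in>UNIV. N i)" if v: "?V v" for v
  proof -
    have "v $ i \<le> int (N i)" for i
      using bound[OF v, of i] v by (cases "i \<in> J") (auto simp: coord_submonoid_def coord_subgroup_def)
    then have "(\<Sum>i\<in>UNIV. v $ i) \<le> (\<Sum>i\<in>UNIV. int (N i))" by (intro sum_mono)
    then show ?thesis by (simp flip: of_nat_sum)
  qed
  obtain v where v: "?V v" and vmax: "\<And>u. ?V u \<Longrightarrow> nat (\<Sum>i\<in>UNIV. u $ i) \<le> nat (\<Sum>i\<in>UNIV. v $ i)"
    using ex_has_greatest_nat[of ?V 0 "\<lambda>v. nat (\<Sum>i\<in>UNIV. v $ i)"] V0 vle by blast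
  define g where "g = single v 1 * f"
  have vn: "v \<in> nonneg_vecs" using v by (simp add: coord_submonoid_def)
  have vM: "v \<in> M" using vn nonneg_local by blast
  have gM: "keys g \<subseteq> M" unfolding g_def using vM f by (intro loc.keys_mult_subset) auto
  have gD: "g \<notin> D" using v by (simp add: g_def)
  have sg: "s * g \<in> D" using loc.ideal_single_mult[OF D_ideal sf vM, of 1] by (simp add: g_def mult.left_commute)
  have tg: "single (axis j 1) 1 * g \<in> D" if j: "j \<notin> J" for j
  proof (rule ccontr)
    assume "single (axis j 1) 1 * g \<notin> D"
    then have "single (axis j 1 + v) 1 * f \<notin> D" by (simp add: g_def mult_single flip: mult.assoc)
    moreover have "axis j 1 + v \<in> coord_submonoid (- J)"
      using v j by (auto simp: coord_submonoid_def coord_subgroup_def nonneg_vecs_def axis_def)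
    ultimately have "nat (\<Sum>i\<in>UNIV. (axis j 1 + v) $ i) \<le> nat (\<Sum>i\<in>UNIV. v $ i)" using vmax by blast
    moreover have "(\<Sum>i\<in>UNIV. (axis j 1 + v) $ i) = 1 + (\<Sum>i\<in>UNIV. v $ i)"
      by (simp add: sum.distrib axis_def)
    moreover have "(\<Sum>i\<in>UNIV. v $ i) \<ge> 0" using vn by (intro sum_nonneg) (simp add: nonneg_vecs_def)
    ultimately show False by linarith
  qed
  let ?Z = "coord_subgroup J"
  define s0 where "s0 = part ?Z s"
  have "part (- ?Z) s * g = (\<Sum>m\<in>keys s \<inter> - ?Z. single m (coeff s m) * g)"
    by (simp add: part_def sum_distrib_right)
  also have "\<dots> \<in> D"
  proof (rule loc.ideal_sum[OF D_ideal])
    fix m assume m: "m \<in> keys s \<inter> - ?Z"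
    then obtain j where j: "j \<notin> J" "m $ j \<noteq> 0" by (auto simp: coord_subgroup_def)
    have mn: "\<And>i. m $ i \<ge> 0" using m s(1) by (auto simp: nonneg_vecs_def)
    have "m $ j \<ge> 1" using mn[of j] j(2) by linarith
    then have "m - axis j 1 \<in> M" using mn by (auto simp: local_monoid_def axis_def)
    from loc.ideal_single_mult[OF D_ideal tg[OF j(1)] this, of "coeff s m"]
    show "single m (coeff s m) * g \<in> D" by (simp add: mult_single flip: mult.assoc)
  qed
  finally have "part (- ?Z) s * g \<in> D" .
  from loc.ideal_diff[OF D_ideal sg this]
  have s0g: "s0 * g \<in> D" by (metis add_diff_cancel_right' left_diff_distrib part_split s0_def)
  have s0: "keys s0 \<subseteq> nonneg_vecs" "keys s0 \<subseteq> ?Z" using s(1) by (auto simp: s0_def keys_part)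
  have s0P: "s0 \<notin> P"
  proof
    assume s0P: "s0 \<in> P"
    obtain a where a: "a \<in> ?Z" "coset_value a s \<noteq> 0" using notin_P s by blast
    have "m \<in> ?Z" if "m - a \<in> L" for m using coord_add[of "m - a" J a] that LJ a by auto
    then have "coset_value a s0 = coset_value a s" unfolding s0_def by (rule coset_value_part)
    then show False using coset_value_char_prime[OF s0P a(1)] a(2) by simp
  qed
  have gU: "part U g \<in> D" by (rule supported_on_U) (simp add: keys_part)
  have s0M: "keys s0 \<subseteq> M" using s0 nonneg_subset_local by blast
  have "s0 * part (- U) g = s0 * g - s0 * part U g"
    using part_split[of U g] by (metis add_diff_cancel_left' right_diff_distrib)
  also have "\<dots> \<in> D" by (intro loc.ideal_diff[OF D_ideal] s0g loc.ideal_mult[OF D_ideal gU s0M])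
  finally have "part (- U) g \<in> B"
    using unit_part_nonzerodivisor[OF s0 s0P, of "part (- U) g"] gM by (auto simp: keys_part)
  then show False using gD gM by (simp add: D_def)
qed

subsection \<open>Identification of the component\<close>

abbreviation "C \<equiv> nonneg.SR.local_kernel I P"

lemma C_ideal: "ideal C (semigroup_ring nonneg_vecs)"
  by (rule nonneg.SR.local_kernel_ideal[OF I_ideal prime])

lemma mem_C_iff: "f \<in> C \<longleftrightarrow> keys f \<subseteq> nonneg_vecs \<and> (\<exists>s. keys s \<subseteq> nonneg_vecs \<and> s \<notin> P \<and> s * f \<in> I)"
  by (auto simp: nonneg.SR.local_kernel_def)

lemma C_cancel:
  assumes s: "keys s \<subseteq> nonneg_vecs" "s \<notin> P" and f: "keys f \<subseteq> nonneg_vecs" and sf: "s * f \<in> C"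
  shows "f \<in> C"
proof -
  obtain s' where s': "keys s' \<subseteq> nonneg_vecs" "s' \<notin> P" "s' * (s * f) \<in> I" using sf by (auto simp: mem_C_iff)
  have "s' * s \<notin> P" using P_prime[OF s'(1) s(1)] s'(2) s(2) by blast
  moreover have "keys (s' * s) \<subseteq> nonneg_vecs" using s' s nonneg.keys_mult_subset by blast
  ultimately show ?thesis unfolding mem_C_iff using f s'(3) by (auto simp: mult.assoc)
qed

lemma B_nonneg_subset_C:
  assumes "f \<in> B" "keys f \<subseteq> nonneg_vecs" shows "f \<in> C"
proof -
  obtain k where "single (shift J k) 1 * f \<in> I" using assms(1) unfolding mem_B_iff by blast
  moreover have "keys (single (shift J k) (1::complex)) \<subseteq> nonneg_vecs" using shift_nonneg by simp
  ultimately show ?thesis unfolding mem_C_iff using assms(2) shift_notin_char_prime[of k] by blast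
qed

text \<open>Along an infinite class either the exponents outside of \<open>J\<close> are unbounded, and some member
  is a multiple of a nilpotent power \<open>t\<^sub>j\<^sup>N\<close>; or two members \<open>w\<close>, \<open>w + g\<close> differ by
  some \<open>g \<in> \<int>\<^sup>J\<close> outside of \<open>L\<close>, and \<open>t\<^sup>w\<close> is killed modulo \<open>B\<close> by
  \<open>1 - c t\<^sup>g\<close>, which is not in the prime.\<close>

lemma U_monomial_mem_C:
  assumes u: "u \<in> U" "u \<in> nonneg_vecs" shows "single u 1 \<in> C"
proof (rule ccontr)
  assume nu: "single u 1 \<notin> C"
  have shiftC: "single (shift J k + w) 1 \<notin> C" if w: "(u, w) \<in> cong" and k: "shift J k + w \<in> nonneg_vecs" for w k
  proof
    assume sC: "single (shift J k + w) 1 \<in> C"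
    obtain c where c: "w \<in> M" "single u 1 - single w c \<in> B" using w by (auto simp: mem_ideal_congruence_iff)
    from loc.ideal_single_mult[OF B_ideal c(2) coord_local[OF shift_coord[of J k]], where c = 1]
    have 1: "single (shift J k + u) 1 - single (shift J k + w) c \<in> B"
      by (simp add: right_diff_distrib mult_single)
    have ku: "shift J k + u \<in> nonneg_vecs" using u(2) shift_nonneg nonneg.add_mem by blast
    have "keys (single (shift J k + u) 1 - single (shift J k + w) c) \<subseteq> nonneg_vecs"
      using keys_diff[of "single (shift J k + u) (1::complex)" "single (shift J k + w) c"] ku k
      by (force split: if_splits)
    from B_nonneg_subset_C[OF 1 this] nonneg.ideal_scalar_mult[OF C_ideal sC, of c]
    have "(single (shift J k + u) 1 - single (shift J k + w) c) + single 0 c * single (shift J k + w) 1 \<in> C"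
      by (rule nonneg.ideal_add[OF C_ideal])
    then have "single (shift J k) 1 * single u 1 \<in> C" by (simp add: mult_single)
    then have "single u 1 \<in> C"
      by (rule C_cancel[rotated 3]) (use shift_nonneg shift_notin_char_prime u in auto)
    then show False using nu by simp
  qed
  have clear: "\<exists>k. shift J k + w \<in> nonneg_vecs" if "w \<in> M" for w
    using clear_denominators[of "single w 1" J] that by (simp add: mult_single)
  obtain N where N: "\<And>j. j \<notin> J \<Longrightarrow> variable j ^ N j \<in> C" using nilpotent by metis
  have bound: "w $ j < int (N j)" if w: "(u, w) \<in> cong" and j: "j \<notin> J" for w j
  proof (rule ccontr)
    assume "\<not> w $ j < int (N j)"
    moreover have "w \<in> M" using w by (auto simp: mem_ideal_congruence_iff)
    then obtain k where k: "shift J k + w \<in> nonneg_vecs" using clear by blast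
    moreover have "(shift J k + w) $ j = w $ j" using j by (simp add: shift_def)
    ultimately have "shift J k + w - axis j (int (N j)) \<in> nonneg_vecs"
      by (auto simp: nonneg_vecs_def axis_def)
    from nonneg.ideal_single_mult[OF C_ideal N[OF j] this, of 1]
    have "single (shift J k + w) 1 \<in> C" by (simp add: variable_power mult_single)
    then show False using shiftC[OF w k] by blast
  qed
  let ?X = "cong `` {u}"
  have "finite (coord_part (- J) ` ?X)"
  proof (rule finite_subset)
    let ?F = "\<lambda>i. {0..(if i \<in> J then 0 else int (N i))}"
    show "coord_part (- J) ` ?X \<subseteq> vec_lambda ` (Pi\<^sub>E UNIV ?F)"
    proof
      fix z assume "z \<in> coord_part (- J) ` ?X"
      then obtain w where w: "(u, w) \<in> cong" "z = coord_part (- J) w" by blast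
      have "w \<in> M" using w by (auto simp: mem_ideal_congruence_iff)
      then have "vec_nth z \<in> Pi\<^sub>E UNIV ?F"
        using bound[OF w(1)] by (auto simp: w(2) coord_part_def local_monoid_def less_imp_le)
      then show "z \<in> vec_lambda ` (Pi\<^sub>E UNIV ?F)" by (rule image_eqI[rotated]) (simp add: vec_nth_inverse)
    qed
    show "finite (vec_lambda ` (Pi\<^sub>E UNIV ?F))" by (intro finite_imageI finite_PiE) auto
  qed
  moreover have "infinite (quotient_map J L ` ?X)" using u(1) by (simp add: U_def)
  ultimately obtain w w' where w: "(u, w) \<in> cong" "(u, w') \<in> cong" "coord_part (- J) w = coord_part (- J) w'"
    "quotient_map J L w \<noteq> quotient_map J L w'"
    using finite_image_factor[of "coord_part (- J)" ?X "quotient_map J L"] by blast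
  define g where "g = w' - w"
  have gL: "g \<notin> L" using w(4) quotient_map_eq_iff[of w' w] by (auto simp: g_def)
  have "w $ i = w' $ i" if "i \<notin> J" for i using arg_cong[OF w(3), of "\<lambda>z. z $ i"] that by (simp add: coord_part_def)
  then have gZ: "g \<in> coord_subgroup J" by (simp add: g_def coord_subgroup_def)
  have wM: "w \<in> M" using w(1) by (auto simp: mem_ideal_congruence_iff)
  have "(w, w') \<in> cong" using loc.congruence_trans[OF B_ideal loc.congruence_sym[OF B_ideal w(1)] w(2)] .
  then obtain c where c: "single w 1 - single w' c \<in> B" by (auto simp: mem_ideal_congruence_iff)
  obtain k where k: "shift J k + w \<in> nonneg_vecs" using clear[OF wM] by blast
  have "keys (1 - single g c) \<subseteq> M"
    using keys_diff[of 1 "single g c"] coord_local[OF gZ] loc.zero_mem by (force split: if_splits)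
  then obtain l where l: "keys (single (shift J l) 1 * (1 - single g c)) \<subseteq> nonneg_vecs"
    using clear_denominators by blast
  define s where "s = single (shift J l) 1 * (1 - single g c)"
  have s: "keys s \<subseteq> nonneg_vecs" using l by (simp add: s_def)
  have "s = single (shift J l) 1 - single (shift J l + g) c" by (simp add: s_def right_diff_distrib mult_single)
  then have "coset_value (shift J l) s = 1" using gL L_zero by (simp add: coset_value_diff coset_value_single)
  then have sP: "s \<notin> P" using coset_value_char_prime[OF _ shift_coord] by force
  have "single (shift J (l + k)) 1 * (single w 1 - single w' c) \<in> B"
    by (rule loc.ideal_single_mult[OF B_ideal c coord_local[OF shift_coord]])
  moreover have "single (shift J (l + k)) 1 * (single w 1 - single w' c) = s * single (shift J k + w) 1"
  proof -
    have "single w' c = single g c * single w 1" by (simp add: g_def mult_single)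
    moreover have "single (shift J (l + k)) (1::complex) = single (shift J l) 1 * single (shift J k) 1"
      by (simp add: mult_single shift_add)
    moreover have "single (shift J k + w) (1::complex) = single (shift J k) 1 * single w 1" by (simp add: mult_single)
    ultimately show ?thesis by (simp add: s_def algebra_simps)
  qed
  moreover have "keys (s * single (shift J k + w) 1) \<subseteq> nonneg_vecs"
    using s k by (intro nonneg.keys_mult_subset) auto
  ultimately have "s * single (shift J k + w) 1 \<in> C" using B_nonneg_subset_C by simp
  then have "single (shift J k + w) 1 \<in> C" using C_cancel[OF s sP] k by simp
  then show False using shiftC[OF w(1) k] by blast
qed

lemma infinite_classes_eq: "infinite_classes J L I = U \<inter> nonneg_vecs"
  using nonneg_subset_local[of J]
  by (auto simp: infinite_classes_def U_def B_def local_ring_def)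

lemma component_candidate_eq: "component_candidate J L I = {f \<in> D. keys f \<subseteq> nonneg_vecs}"
proof -
  have "f \<in> component_candidate J L I \<longleftrightarrow> f \<in> D \<and> keys f \<subseteq> nonneg_vecs" for f
  proof -
    have "f \<in> component_candidate J L I \<longleftrightarrow>
        (\<exists>b c. b \<in> B \<and> keys b \<subseteq> nonneg_vecs \<and> keys c \<subseteq> U \<inter> nonneg_vecs \<and> f = b + c)"
      unfolding component_candidate_def poly_ring_def mem_set_add_semigroup_ring colon_tJ_eq[OF I_ideal]
        infinite_classes_eq monomial_span_def B_def[symmetric] by blast
    also have "\<dots> \<longleftrightarrow> f \<in> D \<and> keys f \<subseteq> nonneg_vecs"
    proof
      assume "\<exists>b c. b \<in> B \<and> keys b \<subseteq> nonneg_vecs \<and> keys c \<subseteq> U \<inter> nonneg_vecs \<and> f = b + c"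
      then obtain b c where bc: "b \<in> B" "keys b \<subseteq> nonneg_vecs" "keys c \<subseteq> U \<inter> nonneg_vecs" "f = b + c" by blast
      have "b \<in> D" "c \<in> D" using bc B_subset_D supported_on_U by auto
      then show "f \<in> D \<and> keys f \<subseteq> nonneg_vecs"
        using bc nonneg.keys_add_subset loc.ideal_add[OF D_ideal] by auto
    next
      assume f: "f \<in> D \<and> keys f \<subseteq> nonneg_vecs"
      then have "part (- U) f \<in> B" by (simp add: D_def)
      moreover have "keys (part (- U) f) \<subseteq> nonneg_vecs" "keys (part U f) \<subseteq> U \<inter> nonneg_vecs"
        using f by (auto simp: keys_part)
      moreover have "f = part (- U) f + part U f" by (simp add: part_split add.commute)
      ultimately show "\<exists>b c. b \<in> B \<and> keys b \<subseteq> nonneg_vecs \<and> keys c \<subseteq> U \<inter> nonneg_vecs \<and> f = b + c" by blast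
    qed
    finally show ?thesis .
  qed
  then show ?thesis by blast
qed

text \<open>One inclusion says that an element outside of \<open>P\<close> is a nonzerodivisor modulo \<open>D\<close>, the other that
  the monomials of \<open>U\<close> and the elements of \<open>B\<close> die in the localization at \<open>P\<close>.\<close>

lemma local_kernel_eq_component_candidate: "C = component_candidate J L I"
proof
  show "C \<subseteq> component_candidate J L I"
  proof
    fix f assume "f \<in> C"
    then obtain s where f: "keys f \<subseteq> nonneg_vecs" and s: "keys s \<subseteq> nonneg_vecs" "s \<notin> P" "s * f \<in> I"
      by (auto simp: mem_C_iff)
    have "s * f \<in> D" using s(3) I_subset_B B_subset_D by blast
    moreover have "keys f \<subseteq> M" using f nonneg_subset_local by blast
    ultimately have "f \<in> D" using D_nonzerodivisor s by blast
    then show "f \<in> component_candidate J L I" using f by (simp add: component_candidate_eq)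
  qed
  show "component_candidate J L I \<subseteq> C"
  proof
    fix f assume "f \<in> component_candidate J L I"
    then have f: "f \<in> D" "keys f \<subseteq> nonneg_vecs" by (auto simp: component_candidate_eq)
    have "part U f \<in> C"
      unfolding part_def
    proof (rule nonneg.ideal_sum[OF C_ideal])
      fix u assume "u \<in> keys f \<inter> U"
      then have "single u 1 \<in> C" using U_monomial_mem_C f by blast
      from nonneg.ideal_scalar_mult[OF C_ideal this] show "single u (coeff f u) \<in> C" by (simp add: mult_single)
    qed
    moreover have "part (- U) f \<in> C"
      using f by (intro B_nonneg_subset_C) (auto simp: D_def keys_part)
    ultimately have "part U f + part (- U) f \<in> C" by (rule nonneg.ideal_add[OF C_ideal])
    then show "f \<in> C" by (simp add: part_split)
  qed
qed

text \<open>By restriction to its class a monomial of \<open>D\<close> outside of \<open>U\<close> would lie in \<open>B\<close>, but the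
  monomials of \<open>B\<close> are themselves in infinite classes.\<close>

lemma monomials_in_component:
  "{u \<in> nonneg_vecs. monomial u \<in> component_candidate J L I} = infinite_classes J L I"
proof -
  have "single u 1 \<in> D \<longleftrightarrow> u \<in> U" if u: "u \<in> nonneg_vecs" for u
  proof
    assume D: "single u 1 \<in> D"
    show "u \<in> U"
    proof (rule ccontr)
      assume nu: "u \<notin> U"
      then have "single u 1 \<in> B" using D D_off_U by simp
      then show False using monomial_B_imp_U u nonneg_local nu by blast
    qed
  qed (simp add: supported_on_U)
  then show ?thesis by (auto simp: component_candidate_eq infinite_classes_eq monomial_eq_single)
qed

end

section \<open>Sums and extensions of binomial ideals\<close>

lemma Idl_mono_monoid:
  fixes G :: "'n::finite laurent set"
  assumes Q: "exponent_monoid Q" and Q': "exponent_monoid Q'" and sub: "Q \<subseteq> Q'"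
    and G: "G \<subseteq> {f. keys f \<subseteq> Q}"
  shows "Idl\<^bsub>semigroup_ring Q\<^esub> G \<subseteq> Idl\<^bsub>semigroup_ring Q'\<^esub> G"
proof
  interpret Q: exponent_monoid Q by (rule Q)
  interpret Q': exponent_monoid Q' by (rule Q')
  have G': "G \<subseteq> {f. keys f \<subseteq> Q'}" using G sub by blast
  note id = Q'.Idl_ideal[OF G']
  fix f assume "f \<in> Idl\<^bsub>semigroup_ring Q\<^esub> G"
  then show "f \<in> Idl\<^bsub>semigroup_ring Q'\<^esub> G" using G
  proof (induction f rule: Q.Idl_induct)
    case zero
    then show ?case by (rule Q'.ideal_zero[OF id])
  next
    case (add f g)
    then show ?case by (intro Q'.ideal_add[OF id])
  next
    case (single g m c)
    then show ?case using Q'.Idl_superset[OF G'] sub by (intro Q'.ideal_single_mult[OF id]) auto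
  qed
qed

context exponent_monoid
begin

lemma Idl_insert:
  assumes f: "f \<in> Idl\<^bsub>semigroup_ring Q\<^esub> (insert x G)" and G: "G \<subseteq> {f. keys f \<subseteq> Q}" and x: "keys x \<subseteq> Q"
  shows "\<exists>b\<in>Idl\<^bsub>semigroup_ring Q\<^esub> G. \<exists>h. keys h \<subseteq> Q \<and> f = b + h * x"
proof -
  note id = Idl_ideal[OF G]
  have "insert x G \<subseteq> {f. keys f \<subseteq> Q}" using G x by blast
  with f show ?thesis
  proof (induction f rule: Idl_induct)
    case zero
    then show ?case using ideal_zero[OF id] by (intro bexI[of _ 0] exI[of _ 0]) auto
  next
    case (add f g)
    then obtain b h b' h' where bh: "b \<in> Idl\<^bsub>semigroup_ring Q\<^esub> G" "keys h \<subseteq> Q" "f = b + h * x"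
      "b' \<in> Idl\<^bsub>semigroup_ring Q\<^esub> G" "keys h' \<subseteq> Q" "g = b' + h' * x" by blast
    have "f + g = (b + b') + (h + h') * x" using bh(3,6) by (simp add: algebra_simps)
    then show ?case using ideal_add[OF id bh(1,4)] keys_add_subset[OF bh(2,5)] by blast
  next
    case (single g m c)
    show ?case
    proof (cases "g = x")
      case True
      then show ?thesis using ideal_zero[OF id] single(2)
        by (intro bexI[of _ 0] exI[of _ "Poly_Mapping.single m c"]) auto
    next
      case False
      then have "Poly_Mapping.single m c * g \<in> Idl\<^bsub>semigroup_ring Q\<^esub> G"
        using single Idl_superset[OF G] by (intro ideal_single_mult[OF id]) auto
      then show ?thesis by (intro bexI[of _ "Poly_Mapping.single m c * g"] exI[of _ 0]) auto
    qed
  qed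
qed

lemma binomial_ideal_in_sum:
  assumes "binomial_ideal_in Q A" "binomial_ideal_in Q B"
  shows "binomial_ideal_in Q (A <+>\<^bsub>semigroup_ring Q\<^esub> B)"
proof -
  obtain G H where G: "G \<subseteq> binomials Q" "A = Idl\<^bsub>semigroup_ring Q\<^esub> G"
    and H: "H \<subseteq> binomials Q" "B = Idl\<^bsub>semigroup_ring Q\<^esub> H" using assms by (auto simp: binomial_ideal_in_def)
  have GH: "G \<subseteq> {f. keys f \<subseteq> Q}" "H \<subseteq> {f. keys f \<subseteq> Q}" "G \<union> H \<subseteq> {f. keys f \<subseteq> Q}"
    using G H binomials_keys by blast+
  have id: "ideal A (semigroup_ring Q)" "ideal B (semigroup_ring Q)"
    using assms binomial_ideal_in_ideal by blast+
  note id' = Idl_ideal[OF GH(3)]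
  have "A <+>\<^bsub>semigroup_ring Q\<^esub> B \<subseteq> Idl\<^bsub>semigroup_ring Q\<^esub> (G \<union> H)"
    using Idl_superset[OF GH(3)] unfolding G(2) H(2)
    by (intro ideal_sum_set(4)[OF Idl_ideal[OF GH(1)] Idl_ideal[OF GH(2)] id'] Idl_least[OF id']) auto
  moreover have "Idl\<^bsub>semigroup_ring Q\<^esub> (G \<union> H) \<subseteq> A <+>\<^bsub>semigroup_ring Q\<^esub> B"
    using Idl_superset[OF GH(1)] Idl_superset[OF GH(2)] ideal_sum_set(2,3)[OF id] unfolding G(2) H(2)
    by (intro Idl_least) (auto simp: id[unfolded G(2) H(2)] ideal_sum_set(1))
  ultimately show ?thesis using G(1) H(1) unfolding binomial_ideal_in_def
    by (intro exI[of _ "G \<union> H"]) auto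
qed

lemma monomials_binomial_ideal:
  assumes "A \<subseteq> Q" shows "binomial_ideal_in Q (Idl\<^bsub>semigroup_ring Q\<^esub> (monomial ` A))"
proof -
  have "monomial u \<in> binomials Q" if "u \<in> A" for u
    using assms that by (auto simp: mem_binomials_iff monomial_eq_single intro!: bexI[of _ u] exI[of _ 0])
  then show ?thesis unfolding binomial_ideal_in_def by blast
qed

end

lemma binomial_ideal_iff: "binomial_ideal I \<longleftrightarrow> binomial_ideal_in nonneg_vecs I"
  by (simp add: binomial_ideal_def binomial_ideal_in_def binomials_def poly_ring_def)

section \<open>The lattice ideal and nilpotents modulo a binomial ideal\<close>

text \<open>In the localization the generators of \<open>I\<^sub>\<rho>\<close> may be divided by \<open>t\<close> to the power \<open>u_-\<close>.  The
  result is \<open>\<rho>(u) (x - 1)\<close> for the unit \<open>x = \<rho>(u)\<^sup>-\<^sup>1 t\<^sup>u\<close>, to which square-freeness applies.\<close>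

definition lattice_binomial :: "(int ^ 'n \<Rightarrow> complex) \<Rightarrow> int ^ 'n \<Rightarrow> 'n::finite laurent" where
  "lattice_binomial \<rho> u = single u 1 - single 0 (\<rho> u)"

context lattice_character
begin

lemma L_local: "u \<in> L \<Longrightarrow> u \<in> local_monoid J"
  using LJ coord_local by blast

lemma lattice_binomial_mem_binomials: "u \<in> L \<Longrightarrow> lattice_binomial \<rho> u \<in> binomials (local_monoid J)"
  unfolding lattice_binomial_def mem_binomials_iff using L_local loc.zero_mem by blast

lemma lattice_binomial_keys: "u \<in> L \<Longrightarrow> keys (lattice_binomial \<rho> u) \<subseteq> local_monoid J"
  using lattice_binomial_mem_binomials loc.binomials_keys by blast

lemma neg_part_coord: "u \<in> L \<Longrightarrow> neg_part u \<in> coord_subgroup J"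
  using LJ by (auto simp: coord_subgroup_def neg_part_def)

lemma char_gen_factor:
  "single (pos_part u) 1 - single (neg_part u) (\<rho> u) = single (neg_part u) 1 * lattice_binomial \<rho> u"
  using pos_neg_part(1)[of u] by (simp add: lattice_binomial_def right_diff_distrib mult_single algebra_simps)

lemma lattice_binomial_power_cancel:
  assumes B: "binomial_ideal_in (local_monoid J) B" and u: "u \<in> L" and s: "keys s \<subseteq> local_monoid J"
    and pow: "lattice_binomial \<rho> u ^ k * s \<in> B"
  shows "lattice_binomial \<rho> u * s \<in> B"
proof -
  have Bi: "ideal B (semigroup_ring (local_monoid J))" by (rule loc.binomial_ideal_in_ideal[OF B])
  have rho: "\<rho> u \<noteq> 0" using rho_nonzero[OF u] .
  have eq: "lattice_binomial \<rho> u = single 0 (\<rho> u) * (single u (inverse (\<rho> u)) - 1)"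
    using rho by (simp add: lattice_binomial_def right_diff_distrib mult_single)
  have "single 0 (\<rho> u ^ k) * ((single u (inverse (\<rho> u)) - 1) ^ k * s) \<in> B"
    using pow by (simp add: eq power_mult_distrib loc.single_power mult.assoc)
  then have "(single u (inverse (\<rho> u)) - 1) ^ k * s \<in> B"
    by (rule loc.ideal_scalar_cancel[OF Bi]) (use rho in simp)
  then have "(single u (inverse (\<rho> u)) - 1) * s \<in> B"
    using rho by (intro loc.unit_minus_one_power_cancel[OF B L_local[OF u] L_local[OF L_uminus[OF u]] _ s]) auto
  then show ?thesis unfolding eq mult.assoc by (rule loc.ideal_scalar_mult[OF Bi])
qed

lemma char_gen_power_cancel:
  assumes B: "binomial_ideal_in (local_monoid J) B" and u: "u \<in> L" and s: "keys s \<subseteq> local_monoid J"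
    and pow: "(single (pos_part u) 1 - single (neg_part u) (\<rho> u)) ^ k * s \<in> B"
  shows "lattice_binomial \<rho> u * s \<in> B"
proof -
  have Bi: "ideal B (semigroup_ring (local_monoid J))" by (rule loc.binomial_ideal_in_ideal[OF B])
  have "int k *s neg_part u \<in> coord_subgroup J" using neg_part_coord[OF u] by (auto simp: coord_subgroup_def)
  moreover have "single (int k *s neg_part u) 1 * (lattice_binomial \<rho> u ^ k * s) \<in> B"
    using pow by (simp add: char_gen_factor power_mult_distrib loc.single_power mult.assoc)
  ultimately have "lattice_binomial \<rho> u ^ k * s \<in> B"
    using loc.ideal_unit_mult_iff[OF Bi, of "int k *s neg_part u" 1] coord_local coord_uminus by force
  then show ?thesis by (rule lattice_binomial_power_cancel[OF B u s])
qed

lemma char_ideal_binomial: "binomial_ideal_in nonneg_vecs (char_ideal L \<rho>)"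
  unfolding char_ideal_def poly_ring_def binomial_ideal_in_def using char_gens_binomials by blast

text \<open>If the elements of \<open>P\<close> become nilpotent in \<open>(R/I)\<^sub>P\<close>, then so do the generators of \<open>I\<^sub>\<rho>\<close>, and by
  square-freeness these become zero.\<close>

lemma char_ideal_subset_local_kernel:
  assumes I: "binomial_ideal_in nonneg_vecs I"
    and prime: "primeideal (char_prime L \<rho> J) (semigroup_ring nonneg_vecs)"
    and nil: "\<And>p. p \<in> char_prime L \<rho> J \<Longrightarrow> \<exists>n. p ^ n \<in> nonneg.SR.local_kernel I (char_prime L \<rho> J)"
  shows "char_ideal L \<rho> \<subseteq> nonneg.SR.local_kernel I (char_prime L \<rho> J)"
proof -
  let ?P = "char_prime L \<rho> J" and ?C = "nonneg.SR.local_kernel I (char_prime L \<rho> J)"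
  have Ii: "ideal I (semigroup_ring nonneg_vecs)" by (rule nonneg.binomial_ideal_in_ideal[OF I])
  have Ci: "ideal ?C (semigroup_ring nonneg_vecs)" by (rule nonneg.SR.local_kernel_ideal[OF Ii prime])
  let ?B = "Idl\<^bsub>semigroup_ring (local_monoid J)\<^esub> I"
  have B: "binomial_ideal_in (local_monoid J) ?B" by (rule binomial_ideal_in_local[OF I])
  have Bi: "ideal ?B (semigroup_ring (local_monoid J))" by (rule loc.binomial_ideal_in_ideal[OF B])
  have "monomial (pos_part u) - scalar (\<rho> u) * monomial (neg_part u) \<in> ?C" if u: "u \<in> L" for u
  proof -
    let ?b = "single (pos_part u) 1 - single (neg_part u) (\<rho> u)"
    have b: "?b \<in> char_ideal L \<rho>" by (rule char_gen_mem[OF u])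
    then obtain n where "?b ^ n \<in> ?C" using nil char_ideal_subset by blast
    then obtain s where s: "keys s \<subseteq> nonneg_vecs" "s \<notin> ?P" "s * ?b ^ n \<in> I"
      by (auto simp: nonneg.SR.local_kernel_def)
    have sM: "keys s \<subseteq> local_monoid J" using s(1) nonneg_subset_local by blast
    have kb: "keys ?b \<subseteq> nonneg_vecs" using nonneg.ideal_keys[OF char_ideal_ideal b] .
    have "single (shift J 0) 1 * (?b ^ n * s) \<in> I" using s(3) by (simp add: mult.commute)
    moreover have "keys (?b ^ n * s) \<subseteq> local_monoid J"
      using nonneg.keys_mult_subset[OF nonneg.keys_power_subset[OF kb] s(1)] nonneg_subset_local by blast
    ultimately have "?b ^ n * s \<in> ?B" unfolding Idl_local_iff[OF Ii] by blast
    then have "lattice_binomial \<rho> u * s \<in> ?B" by (rule char_gen_power_cancel[OF B u sM])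
    then have "single (neg_part u) 1 * (lattice_binomial \<rho> u * s) \<in> ?B"
      by (rule loc.ideal_single_mult[OF Bi]) (rule coord_local[OF neg_part_coord[OF u]])
    then have "?b * s \<in> ?B" by (simp add: char_gen_factor mult.assoc)
    then obtain k where k: "single (shift J k) 1 * (?b * s) \<in> I" by (auto simp: Idl_local_iff[OF Ii])
    have "single (shift J k) 1 * s \<notin> ?P"
      using primeideal.I_prime[OF prime, of "single (shift J k) 1" s] s shift_notin_char_prime[of k] shift_nonneg by auto
    moreover have "keys (single (shift J k) 1 * s) \<subseteq> nonneg_vecs"
      using s(1) shift_nonneg by (intro nonneg.keys_mult_subset) auto
    moreover have "(single (shift J k) 1 * s) * ?b \<in> I" using k by (simp add: mult_ac)
    ultimately have "?b \<in> ?C" using kb unfolding nonneg.SR.local_kernel_def by auto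
    then show ?thesis by (simp add: char_gen_eq)
  qed
  then show ?thesis unfolding char_ideal_def poly_ring_def by (intro nonneg.Idl_least[OF Ci]) blast
qed

text \<open>If all \<open>t\<^sup>u - \<rho>(u)\<close> kill \<open>f\<close> modulo \<open>I\<close>, then \<open>f\<close> is not changed by passing from \<open>I\<close> to
  \<open>I + I\<^sub>\<rho>\<close>: when one lattice binomial \<open>y\<close> is added and \<open>f = b + y h\<close>, then \<open>y\<^sup>2 h\<close> and hence
  \<open>y h\<close> already lie in the smaller ideal.\<close>

lemma killed_by_lattice_binomials:
  assumes I: "binomial_ideal_in (local_monoid J) I" and W: "finite W" "W \<subseteq> L"
    and kill: "\<And>u. u \<in> W \<Longrightarrow> lattice_binomial \<rho> u * f \<in> I"
    and f: "f \<in> Idl\<^bsub>semigroup_ring (local_monoid J)\<^esub> (I \<union> lattice_binomial \<rho> ` W)"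
  shows "f \<in> I"
  using W kill f
proof (induction W rule: finite_induct)
  case empty
  then show ?case using loc.Idl_least[OF loc.binomial_ideal_in_ideal[OF I], of I] by auto
next
  case (insert v W)
  let ?S = "semigroup_ring (local_monoid J) :: 'n laurent ring"
  have Ii: "ideal I ?S" by (rule loc.binomial_ideal_in_ideal[OF I])
  let ?G = "I \<union> lattice_binomial \<rho> ` W" and ?y = "lattice_binomial \<rho> v"
  have v: "v \<in> L" using insert.prems by blast
  have Gk: "?G \<subseteq> {f. keys f \<subseteq> local_monoid J}"
    using loc.ideal_keys[OF Ii] lattice_binomial_keys insert.prems(1) by blast
  note id = loc.Idl_ideal[OF Gk]
  have B: "binomial_ideal_in (local_monoid J) (Idl\<^bsub>?S\<^esub> ?G)"
  proof -
    obtain H where H: "H \<subseteq> binomials (local_monoid J)" "I = Idl\<^bsub>?S\<^esub> H" using I by (auto simp: binomial_ideal_in_def)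
    have b: "H \<union> lattice_binomial \<rho> ` W \<subseteq> binomials (local_monoid J)"
      using H(1) lattice_binomial_mem_binomials insert.prems(1) by blast
    then have k: "H \<union> lattice_binomial \<rho> ` W \<subseteq> {f. keys f \<subseteq> local_monoid J}" using loc.binomials_keys by blast
    have kH: "H \<subseteq> {f. keys f \<subseteq> local_monoid J}" using k by blast
    have "?G \<subseteq> Idl\<^bsub>?S\<^esub> (H \<union> lattice_binomial \<rho> ` W)"
      using loc.Idl_superset[OF k] loc.Idl_least[OF loc.Idl_ideal[OF k], of H] unfolding H(2) by blast
    then have "Idl\<^bsub>?S\<^esub> ?G \<subseteq> Idl\<^bsub>?S\<^esub> (H \<union> lattice_binomial \<rho> ` W)" by (rule loc.Idl_least[OF loc.Idl_ideal[OF k]])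
    moreover have "H \<union> lattice_binomial \<rho> ` W \<subseteq> Idl\<^bsub>?S\<^esub> ?G"
      using loc.Idl_superset[OF Gk] loc.Idl_superset[OF kH] unfolding H(2) by blast
    then have "Idl\<^bsub>?S\<^esub> (H \<union> lattice_binomial \<rho> ` W) \<subseteq> Idl\<^bsub>?S\<^esub> ?G" by (rule loc.Idl_least[OF id])
    ultimately show ?thesis using b unfolding binomial_ideal_in_def by blast
  qed
  have "f \<in> Idl\<^bsub>?S\<^esub> (insert ?y ?G)" using insert.prems(3) by simp
  from loc.Idl_insert[OF this Gk lattice_binomial_keys[OF v]] obtain b h where
    bh: "b \<in> Idl\<^bsub>?S\<^esub> ?G" "keys h \<subseteq> local_monoid J" "f = b + h * ?y" by blast
  have "?y * f \<in> Idl\<^bsub>?S\<^esub> ?G" using insert.prems(2)[of v] loc.Idl_superset[OF Gk] by blast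
  moreover have "?y * b \<in> Idl\<^bsub>?S\<^esub> ?G" by (rule loc.ideal_mult[OF id bh(1) lattice_binomial_keys[OF v]])
  ultimately have "?y * f - ?y * b \<in> Idl\<^bsub>?S\<^esub> ?G" by (rule loc.ideal_diff[OF id])
  then have "?y ^ 2 * h \<in> Idl\<^bsub>?S\<^esub> ?G" by (simp add: bh(3) power2_eq_square algebra_simps)
  then have "?y * h \<in> Idl\<^bsub>?S\<^esub> ?G" by (rule lattice_binomial_power_cancel[OF B v bh(2)])
  then have "f \<in> Idl\<^bsub>?S\<^esub> ?G" using loc.ideal_add[OF id bh(1)] bh(3) by (simp add: mult.commute)
  then show ?case using insert.IH insert.prems by blast
qed

text \<open>Only finitely many lattice binomials are involved in the membership of \<open>f\<close> in \<open>I + I\<^sub>\<rho>\<close>.\<close>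

lemma killed_by_lattice_ideal:
  assumes I: "binomial_ideal_in nonneg_vecs I"
    and kill: "\<And>u. u \<in> L \<Longrightarrow> lattice_binomial \<rho> u * f \<in> Idl\<^bsub>semigroup_ring (local_monoid J)\<^esub> I"
    and f: "f \<in> Idl\<^bsub>semigroup_ring (local_monoid J)\<^esub> (I <+>\<^bsub>semigroup_ring nonneg_vecs\<^esub> char_ideal L \<rho>)"
  shows "f \<in> Idl\<^bsub>semigroup_ring (local_monoid J)\<^esub> I"
proof -
  let ?S = "semigroup_ring (local_monoid J) :: 'n laurent ring"
  let ?B = "Idl\<^bsub>?S\<^esub> I"
  have Ii: "ideal I (semigroup_ring nonneg_vecs)" by (rule nonneg.binomial_ideal_in_ideal[OF I])
  have Ik: "I \<subseteq> {f. keys f \<subseteq> local_monoid J}" using nonneg.ideal_keys[OF Ii] nonneg_subset_local by blast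
  have B: "binomial_ideal_in (local_monoid J) ?B" by (rule binomial_ideal_in_local[OF I])
  have Bi: "ideal ?B ?S" by (rule loc.binomial_ideal_in_ideal[OF B])
  let ?G = "?B \<union> lattice_binomial \<rho> ` L"
  have Gk: "?G \<subseteq> {f. keys f \<subseteq> local_monoid J}"
    using loc.ideal_keys[OF Bi] lattice_binomial_keys by blast
  note id = loc.Idl_ideal[OF Gk]
  have "f \<in> Idl\<^bsub>?S\<^esub> ?G"
  proof -
    have gens: "char_gens \<subseteq> {f. keys f \<subseteq> nonneg_vecs}" using char_gens_binomials nonneg.binomials_keys by blast
    have gens': "char_gens \<subseteq> {f. keys f \<subseteq> local_monoid J}" using gens nonneg_subset_local by blast
    have "char_gens \<subseteq> Idl\<^bsub>?S\<^esub> ?G"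
    proof
      fix g assume "g \<in> char_gens"
      then obtain u where u: "u \<in> L" "g = single (neg_part u) 1 * lattice_binomial \<rho> u"
        by (auto simp: char_gen_eq char_gen_factor)
      show "g \<in> Idl\<^bsub>?S\<^esub> ?G" unfolding u(2)
        using loc.Idl_superset[OF Gk] u(1) coord_local[OF neg_part_coord[OF u(1)]]
        by (intro loc.ideal_single_mult[OF id]) auto
    qed
    then have "Idl\<^bsub>?S\<^esub> char_gens \<subseteq> Idl\<^bsub>?S\<^esub> ?G" by (rule loc.Idl_least[OF id])
    moreover have "char_ideal L \<rho> \<subseteq> Idl\<^bsub>?S\<^esub> char_gens"
      unfolding char_ideal_def poly_ring_def
      by (rule Idl_mono_monoid[OF nonneg.exponent_monoid_axioms loc.exponent_monoid_axioms nonneg_subset_local gens])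
    ultimately have "char_ideal L \<rho> \<subseteq> Idl\<^bsub>?S\<^esub> ?G" by blast
    moreover have "I \<subseteq> Idl\<^bsub>?S\<^esub> ?G" using loc.Idl_superset[OF Ik] loc.Idl_superset[OF Gk] by blast
    ultimately have "I <+>\<^bsub>semigroup_ring nonneg_vecs\<^esub> char_ideal L \<rho> \<subseteq> Idl\<^bsub>?S\<^esub> ?G"
      using loc.ideal_add[OF id] unfolding subset_iff mem_set_add_semigroup_ring by metis
    then show ?thesis using f loc.Idl_least[OF id] by blast
  qed
  then obtain F where F: "F \<subseteq> ?G" "finite F" "f \<in> Idl\<^bsub>?S\<^esub> F" using loc.Idl_finite_support[OF _ Gk] by blast
  have "finite (F \<inter> lattice_binomial \<rho> ` L)" using F(2) by blast
  from finite_subset_image[OF this Int_lower2] obtain W where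
    W: "W \<subseteq> L" "finite W" "F \<inter> lattice_binomial \<rho> ` L = lattice_binomial \<rho> ` W" by blast
  have "F \<subseteq> ?B \<union> lattice_binomial \<rho> ` W" using F(1) W(3) by blast
  moreover have k: "?B \<union> lattice_binomial \<rho> ` W \<subseteq> {f. keys f \<subseteq> local_monoid J}" using Gk W(1) by blast
  ultimately have "Idl\<^bsub>?S\<^esub> F \<subseteq> Idl\<^bsub>?S\<^esub> (?B \<union> lattice_binomial \<rho> ` W)"
    using loc.Idl_superset[OF k] by (intro loc.Idl_least[OF loc.Idl_ideal[OF k]]) blast
  then show ?thesis using killed_by_lattice_binomials[OF B W(2,1), of f] kill W(1) F(3) by blast
qed

end

section \<open>High powers of the variables\<close>

definition outside_degree :: "'n set \<Rightarrow> int ^ 'n::finite \<Rightarrow> int" where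
  "outside_degree J v = (\<Sum>j\<in>- J. v $ j)"

lemma outside_degree_add: "outside_degree J (u + v) = outside_degree J u + outside_degree J v"
  by (simp add: outside_degree_def sum.distrib)

lemma outside_degree_nonneg: "v \<in> nonneg_vecs \<Longrightarrow> outside_degree J v \<ge> 0"
  by (simp add: outside_degree_def nonneg_vecs_def sum_nonneg)

lemma outside_degree_var_ideal:
  assumes f: "f \<in> var_ideal J" and m: "m \<in> keys f" shows "outside_degree J m \<ge> 1"
proof -
  have gens: "{variable j | j. j \<notin> J} \<subseteq> {f. keys f \<subseteq> nonneg_vecs}"
    by (auto simp: variable_def monomial_eq_single nonneg_vecs_def axis_def)
  have "\<forall>m\<in>keys f. outside_degree J m \<ge> 1"
    using f[unfolded var_ideal_def poly_ring_def] gens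
  proof (induction f rule: nonneg.Idl_induct)
    case (add f g)
    then show ?case using keys_add[of f g] by blast
  next
    case (single g k c)
    then obtain j where j: "j \<notin> J" "g = single (axis j 1) 1" by (auto simp: variable_def monomial_eq_single)
    have "outside_degree J (axis j 1) = 1"
      using j(1) by (simp add: outside_degree_def axis_def sum.delta)
    then show ?case using outside_degree_nonneg[OF single(2), of J]
      by (auto simp: j(2) mult_single outside_degree_add split: if_splits)
  qed simp
  then show ?thesis using m by blast
qed

lemma outside_degree_power:
  assumes "f \<in> var_ideal J [^]\<^bsub>ideals_set poly_ring\<^esub> (e::nat)"
  shows "keys f \<subseteq> nonneg_vecs \<and> (\<forall>m\<in>keys f. outside_degree J m \<ge> int e)"
  using assms
proof (induction e arbitrary: f)
  case 0
  then show ?case using outside_degree_nonneg by (auto simp: nat_pow_def ideals_set_def poly_ring_def)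
next
  case (Suc e)
  have "f \<in> ideal_prod poly_ring (var_ideal J [^]\<^bsub>ideals_set poly_ring\<^esub> e) (var_ideal J)"
    using Suc.prems by (simp add: nat_pow_def ideals_set_def)
  then show ?case
  proof (induction f rule: ideal_prod.induct)
    case (prod i j)
    have i: "keys i \<subseteq> nonneg_vecs" "\<And>m. m \<in> keys i \<Longrightarrow> outside_degree J m \<ge> int e" using Suc.IH prod(1) by blast+
    have "{variable j | j. j \<notin> J} \<subseteq> {f. keys f \<subseteq> nonneg_vecs}"
      by (auto simp: variable_def monomial_eq_single nonneg_vecs_def axis_def)
    then have j: "keys j \<subseteq> nonneg_vecs"
      using prod(2) nonneg.ideal_keys[OF nonneg.Idl_ideal] unfolding var_ideal_def poly_ring_def by blast
    have "outside_degree J m \<ge> int (Suc e)" if "m \<in> keys (i * j)" for m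
    proof -
      obtain a b where "a \<in> keys i" "b \<in> keys j" "m = a + b" using \<open>m \<in> keys (i * j)\<close> keys_mult[of i j] by blast
      then show ?thesis using i(2)[of a] outside_degree_var_ideal[OF prod(2), of b] by (simp add: outside_degree_add)
    qed
    then show ?case using nonneg.keys_mult_subset[OF i(1) j] by (simp add: poly_ring_def)
  next
    case (sum s1 s2)
    then show ?case using keys_add[of s1 s2] by (auto simp: poly_ring_def)
  qed
qed

text \<open>In a monomial of large degree in the \<open>t\<^sub>j\<close>, \<open>j \<notin> J\<close>, one of the exponents is large.\<close>

lemma high_degree_monomials:
  fixes Q :: "'n::finite laurent set"
  assumes Q: "ideal Q (semigroup_ring nonneg_vecs)" and pow: "\<And>j. j \<notin> J \<Longrightarrow> \<exists>n. variable j ^ n \<in> Q"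
  shows "\<exists>e::nat. \<forall>v\<in>nonneg_vecs. outside_degree J v \<ge> int e \<longrightarrow> monomial v \<in> Q"
proof -
  obtain n where n: "\<And>j. j \<notin> J \<Longrightarrow> variable j ^ n j \<in> Q" using pow by metis
  have "monomial v \<in> Q" if v: "v \<in> nonneg_vecs" and deg: "outside_degree J v \<ge> int (Suc (\<Sum>j\<in>- J. n j))" for v
  proof -
    have "\<exists>j\<in>- J. v $ j \<ge> int (n j)"
    proof (rule ccontr)
      assume "\<not> ?thesis"
      then have "outside_degree J v \<le> (\<Sum>j\<in>- J. int (n j))"
        unfolding outside_degree_def by (intro sum_mono) force
      then show False using deg by (simp flip: of_nat_sum)
    qed
    then obtain j where j: "j \<notin> J" "v $ j \<ge> int (n j)" by blast
    then have "v - axis j (int (n j)) \<in> nonneg_vecs" using v by (auto simp: nonneg_vecs_def axis_def)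
    from nonneg.ideal_single_mult[OF Q n[OF j(1)] this, of 1]
    show ?thesis by (simp add: variable_power mult_single monomial_eq_single)
  qed
  then show ?thesis by blast
qed

section \<open>The components of a binomial ideal\<close>

lemma associated_prime_superset:
  fixes I :: "'n::finite laurent set"
  assumes I: "ideal I (semigroup_ring nonneg_vecs)" and ass: "associated_prime (semigroup_ring nonneg_vecs) I P"
  shows "I \<subseteq> P"
proof
  fix g assume g: "g \<in> I"
  obtain f where f: "keys f \<subseteq> nonneg_vecs" "P = {g \<in> carrier (semigroup_ring nonneg_vecs). g * f \<in> I}"
    using ass by (auto simp: associated_prime_def)
  have "g * f \<in> I" using nonneg.ideal_mult[OF I g f(1)] by (simp add: mult.commute)
  then show "g \<in> P" using f(2) nonneg.ideal_keys[OF I g] by simp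
qed

context lattice_prime
begin

abbreviation "R \<equiv> semigroup_ring nonneg_vecs :: 'n laurent ring"

lemma noetherian_R: "noetherian R"
  using noetherian_poly_ring by (simp add: poly_ring_def)

lemma char_prime_least:
  assumes "ideal A R" "char_ideal L \<rho> \<subseteq> A" "\<And>j. j \<notin> J \<Longrightarrow> variable j \<in> A" shows "P \<subseteq> A"
proof -
  have "var_ideal J \<subseteq> A"
    unfolding var_ideal_def poly_ring_def using assms(3) by (intro nonneg.Idl_least[OF assms(1)]) blast
  then show ?thesis
    unfolding char_prime_def poly_ring_def
    using nonneg.ideal_sum_set(4)[OF char_ideal_ideal var_ideal_ideal assms(1,2)] by blast
qed

text \<open>The component at a minimal prime contains \<open>I\<^sub>\<rho>\<close>, so it is also the component of \<open>I + I\<^sub>\<rho>\<close>.\<close>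

lemma minimal_prime_component:
  assumes I: "binomial_ideal_in nonneg_vecs I" and min: "minimal_prime_over R I P"
  defines "I' \<equiv> I <+>\<^bsub>R\<^esub> char_ideal L \<rho>"
  shows "primary_component R I P = component_candidate J L I'"
    and "{u \<in> nonneg_vecs. monomial u \<in> component_candidate J L I'} = infinite_classes J L I'"
proof -
  have Ii: "ideal I R" by (rule nonneg.binomial_ideal_in_ideal[OF I])
  have IP: "I \<subseteq> P" using min by (simp add: minimal_prime_over_def)
  let ?C = "nonneg.SR.local_kernel I P"
  have Ci: "ideal ?C R" by (rule nonneg.SR.local_kernel_ideal[OF Ii prime])
  have nil: "\<exists>n. p ^ n \<in> ?C" if "p \<in> P" for p
    using nonneg.SR.minimal_prime_nilpotent[OF noetherian_R Ii min that] by simp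
  have charC: "char_ideal L \<rho> \<subseteq> ?C" by (rule char_ideal_subset_local_kernel[OF I prime nil])
  have I': "binomial_ideal_in nonneg_vecs I'"
    unfolding I'_def by (rule nonneg.binomial_ideal_in_sum[OF I char_ideal_binomial])
  have I'i: "ideal I' R" by (rule nonneg.binomial_ideal_in_ideal[OF I'])
  have II': "I \<subseteq> I'" "char_ideal L \<rho> \<subseteq> I'"
    unfolding I'_def by (rule nonneg.ideal_sum_set[OF Ii char_ideal_ideal])+
  have I'P: "I' \<subseteq> P"
    unfolding I'_def by (rule nonneg.ideal_sum_set(4)[OF Ii char_ideal_ideal char_prime_ideal IP char_ideal_subset])
  have I'C: "I' \<subseteq> ?C"
    unfolding I'_def
    by (rule nonneg.ideal_sum_set(4)[OF Ii char_ideal_ideal Ci nonneg.SR.subset_local_kernel[OF Ii prime] charC])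
  have eq: "nonneg.SR.local_kernel I' P = ?C"
  proof
    show "?C \<subseteq> nonneg.SR.local_kernel I' P" using II'(1) by (auto simp: nonneg.SR.local_kernel_def)
    show "nonneg.SR.local_kernel I' P \<subseteq> ?C"
    proof
      fix f assume "f \<in> nonneg.SR.local_kernel I' P"
      then obtain s where s: "keys f \<subseteq> nonneg_vecs" "keys s \<subseteq> nonneg_vecs" "s \<notin> P" "s * f \<in> I'"
        by (auto simp: nonneg.SR.local_kernel_def)
      then have "s * f \<in> ?C" using I'C by blast
      then obtain s' where s': "keys s' \<subseteq> nonneg_vecs" "s' \<notin> P" "s' * (s * f) \<in> I"
        by (auto simp: nonneg.SR.local_kernel_def)
      have "s' * s \<notin> P" using primeideal.I_prime[OF prime, of s' s] s s' by auto
      moreover have "s' * s * f \<in> I" using s'(3) by (simp add: mult.assoc)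
      ultimately show "f \<in> ?C" using s(1) nonneg.keys_mult_subset[OF s'(1) s(2)]
        by (auto simp: nonneg.SR.local_kernel_def intro!: bexI[of _ "s' * s"])
    qed
  qed
  interpret lattice_component J L \<rho> I'
  proof
    show "\<exists>N. variable j ^ N \<in> nonneg.SR.local_kernel I' P" if "j \<notin> J" for j
      unfolding eq using nil variable_mem[OF that] var_ideal_subset by blast
  qed (use prime I' II'(2) I'P in auto)
  show "primary_component R I P = component_candidate J L I'"
    unfolding nonneg.SR.primary_component_eq_local_kernel[OF Ii prime] eq[symmetric]
    by (rule local_kernel_eq_component_candidate)
  show "{u \<in> nonneg_vecs. monomial u \<in> component_candidate J L I'} = infinite_classes J L I'"
    by (rule monomials_in_component)
qed

lemma monomial_in_P:
  assumes a: "a \<in> coord_submonoid (- J)" "a \<noteq> 0" shows "monomial a \<in> P"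
proof -
  have an: "a \<in> nonneg_vecs" using a by (simp add: coord_submonoid_def)
  obtain j where j: "a $ j \<noteq> 0" using a(2) by (auto simp: vec_eq_iff)
  then have jJ: "j \<notin> J" using a(1) by (auto simp: coord_submonoid_def coord_subgroup_def)
  have "a $ j \<ge> 1" using an j by (simp add: nonneg_vecs_def) (metis order_le_less int_one_le_iff_zero_less)
  then have "a - axis j 1 \<in> nonneg_vecs" using an by (auto simp: nonneg_vecs_def axis_def)
  from nonneg.ideal_single_mult[OF var_ideal_ideal variable_mem[OF jJ] this, of 1]
  show ?thesis using var_ideal_subset by (auto simp: variable_def monomial_eq_single mult_single)
qed

text \<open>A prime that contains \<open>I + I\<^sub>\<rho> + K\<close> contains \<open>I\<^sub>\<rho>\<close> and, together with their powers, the \<open>t\<^sub>j\<close> with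
  \<open>j \<notin> J\<close>; so it contains \<open>P\<close>.  The last claim describes the generation of the sum by \<open>I\<close>, \<open>I\<^sub>\<rho>\<close>
  and the monomials of \<open>K\<close>, where \<open>K\<close> is an ideal of a subring only.\<close>

lemma truncated_component:
  assumes I: "binomial_ideal_in nonneg_vecs I" and IP: "I \<subseteq> P"
    and K: "monomial_ideal_with_powers J K" and Kn: "K \<noteq> carrier (semigroup_ring (coord_submonoid (- J)))"
  defines "I' \<equiv> Idl\<^bsub>R\<^esub> (I <+>\<^bsub>R\<^esub> char_ideal L \<rho> <+>\<^bsub>R\<^esub> K)"
  shows "minimal_prime_over R I' P"
    and "primary_component R I' P = component_candidate J L I'"
    and "{u \<in> nonneg_vecs. monomial u \<in> component_candidate J L I'} = infinite_classes J L I'"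
    and "ideal I' R" and "I \<subseteq> I'"
    and "\<And>Q. ideal Q R \<Longrightarrow> I \<subseteq> Q \<Longrightarrow> char_ideal L \<rho> \<subseteq> Q \<Longrightarrow>
      (\<And>a. a \<in> coord_submonoid (- J) \<Longrightarrow> monomial a \<in> K \<Longrightarrow> monomial a \<in> Q) \<Longrightarrow> I' \<subseteq> Q"
proof -
  let ?K = "semigroup_ring (coord_submonoid (- J)) :: 'n laurent ring"
  have Ii: "ideal I R" by (rule nonneg.binomial_ideal_in_ideal[OF I])
  obtain A where A: "A \<subseteq> coord_submonoid (- J)" "K = Idl\<^bsub>?K\<^esub> (monomial ` A)"
    using K by (auto simp: monomial_ideal_with_powers_def)
  have cn: "coord_submonoid (- J) \<subseteq> nonneg_vecs" by (auto simp: coord_submonoid_def)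
  have Ak: "monomial ` A \<subseteq> {f. keys f \<subseteq> coord_submonoid (- J)}" using A(1) by (auto simp: monomial_eq_single)
  have Ak': "monomial ` A \<subseteq> {f. keys f \<subseteq> nonneg_vecs}" using Ak cn by blast
  have AK: "monomial ` A \<subseteq> K" unfolding A(2) by (rule coord.Idl_superset[OF Ak])
  define KR where "KR = Idl\<^bsub>R\<^esub> (monomial ` A)"
  have KR: "binomial_ideal_in nonneg_vecs KR"
    unfolding KR_def using A(1) cn by (intro nonneg.monomials_binomial_ideal) blast
  have KRi: "ideal KR R" by (rule nonneg.binomial_ideal_in_ideal[OF KR])
  have KKR: "K \<subseteq> KR" unfolding A(2) KR_def
    by (rule Idl_mono_monoid[OF coord.exponent_monoid_axioms nonneg.exponent_monoid_axioms cn Ak])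
  define I1 where "I1 = I <+>\<^bsub>R\<^esub> char_ideal L \<rho>"
  have I1: "binomial_ideal_in nonneg_vecs I1"
    unfolding I1_def by (rule nonneg.binomial_ideal_in_sum[OF I char_ideal_binomial])
  have I1i: "ideal I1 R" by (rule nonneg.binomial_ideal_in_ideal[OF I1])
  have I1sub: "I \<subseteq> I1" "char_ideal L \<rho> \<subseteq> I1"
    unfolding I1_def by (rule nonneg.ideal_sum_set[OF Ii char_ideal_ideal])+
  have K0: "0 \<in> K" using coord.ideal_zero[OF coord.Idl_ideal[OF Ak]] by (simp add: A(2))
  have sum_sub: "I1 \<subseteq> I1 <+>\<^bsub>R\<^esub> K" "K \<subseteq> I1 <+>\<^bsub>R\<^esub> K"
    using K0 nonneg.ideal_zero[OF I1i] by (force simp: mem_set_add_semigroup_ring)+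
  have sum_keys: "I1 <+>\<^bsub>R\<^esub> K \<subseteq> I1 <+>\<^bsub>R\<^esub> KR" 
    using KKR unfolding subset_iff mem_set_add_semigroup_ring by blast
  have sumi: "ideal (I1 <+>\<^bsub>R\<^esub> KR) R" by (rule nonneg.ideal_sum_set(1)[OF I1i KRi])
  have ks: "I1 <+>\<^bsub>R\<^esub> K \<subseteq> {f. keys f \<subseteq> nonneg_vecs}"
    using sum_keys nonneg.ideal_keys[OF sumi] by blast
  have I'K: "I1 <+>\<^bsub>R\<^esub> K \<subseteq> I'" unfolding I'_def I1_def[symmetric] by (rule nonneg.Idl_superset[OF ks])
  show I'i: "ideal I' R" unfolding I'_def I1_def[symmetric] by (rule nonneg.Idl_ideal[OF ks])
  have I'_eq: "I' = I1 <+>\<^bsub>R\<^esub> KR"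
  proof
    show "I' \<subseteq> I1 <+>\<^bsub>R\<^esub> KR" unfolding I'_def I1_def[symmetric] by (rule nonneg.Idl_least[OF sumi sum_keys])
    have "KR \<subseteq> I'" unfolding KR_def using AK sum_sub(2) I'K by (intro nonneg.Idl_least[OF I'i]) blast
    then show "I1 <+>\<^bsub>R\<^esub> KR \<subseteq> I'"
      using sum_sub(1) I'K by (intro nonneg.ideal_sum_set(4)[OF I1i KRi I'i]) blast+
  qed
  have I'b: "binomial_ideal_in nonneg_vecs I'" unfolding I'_eq by (rule nonneg.binomial_ideal_in_sum[OF I1 KR])
  show II': "I \<subseteq> I'" using I1sub sum_sub I'K by blast
  have charI': "char_ideal L \<rho> \<subseteq> I'" using I1sub sum_sub I'K by blast
  have powI': "\<exists>k. variable j ^ k \<in> I'" if "j \<notin> J" for j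
    using K that sum_sub(2) I'K unfolding monomial_ideal_with_powers_def by blast
  show least: "I' \<subseteq> Q" if Q: "ideal Q R" "I \<subseteq> Q" "char_ideal L \<rho> \<subseteq> Q"
    "\<And>a. a \<in> coord_submonoid (- J) \<Longrightarrow> monomial a \<in> K \<Longrightarrow> monomial a \<in> Q" for Q
  proof -
    have "monomial ` A \<subseteq> Q" using Q(4) A(1) AK by blast
    then have "KR \<subseteq> Q" unfolding KR_def by (rule nonneg.Idl_least[OF Q(1)])
    moreover have "I1 \<subseteq> Q" unfolding I1_def by (rule nonneg.ideal_sum_set(4)[OF Ii char_ideal_ideal Q(1-3)])
    ultimately show ?thesis unfolding I'_eq using nonneg.ideal_sum_set(4)[OF I1i KRi Q(1)] by blast
  qed
  have one: "monomial 0 \<notin> K"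
  proof
    assume "monomial 0 \<in> K"
    then have 1: "1 \<in> K" by (simp add: monomial_eq_single)
    have Ki: "ideal K ?K" unfolding A(2) by (rule coord.Idl_ideal[OF Ak])
    have "f \<in> K" if "keys f \<subseteq> coord_submonoid (- J)" for f using coord.ideal_mult[OF Ki 1 that] by simp
    then show False using Kn coord.ideal_keys[OF Ki] by auto
  qed
  have I'P: "I' \<subseteq> P"
    using monomial_in_P one by (intro least[OF char_prime_ideal IP char_ideal_subset]) metis
  have I'C: "I' \<subseteq> nonneg.SR.local_kernel I' P" by (rule nonneg.SR.subset_local_kernel[OF I'i prime])
  interpret lattice_component J L \<rho> I'
  proof
    show "\<exists>N. variable j ^ N \<in> nonneg.SR.local_kernel I' P" if "j \<notin> J" for j
      using powI'[OF that] I'C by blast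
  qed (use prime I'b charI' I'P in auto)
  show "primary_component R I' P = component_candidate J L I'"
    unfolding nonneg.SR.primary_component_eq_local_kernel[OF I'i prime]
    by (rule local_kernel_eq_component_candidate)
  show "{u \<in> nonneg_vecs. monomial u \<in> component_candidate J L I'} = infinite_classes J L I'"
    by (rule monomials_in_component)
  show "minimal_prime_over R I' P"
    unfolding minimal_prime_over_def
  proof (intro conjI allI impI)
    fix P' assume P': "primeideal P' R \<and> I' \<subseteq> P' \<and> P' \<subseteq> P"
    have "variable j \<in> P'" if j: "j \<notin> J" for j
    proof -
      have "variable j \<in> carrier R" using var_gens_keys j by auto
      moreover obtain k where "variable j ^ k \<in> P'" using powI'[OF j] P' by blast
      ultimately show ?thesis using nonneg.SR.prime_power[of P' "variable j" k] P' by simp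
    qed
    then have "P \<subseteq> P'" using P' charI' by (intro char_prime_least) (auto dest: primeideal.axioms(1))
    then show "P' = P" using P' by blast
  qed (use prime I'P in auto)
qed

text \<open>Let \<open>Y\<close> be the intersection of the components of \<open>I\<close> other than the one at \<open>P\<close>.  Every
  element of \<open>P\<close> has a power that multiplies \<open>Y\<close> into \<open>I\<close>.  Hence the lattice binomials kill \<open>Y\<close>
  modulo \<open>I\<close>, which gives \<open>Y \<inter> (I + I\<^sub>\<rho>) \<subseteq> I\<close>, and \<open>Y\<close> lies in every component of \<open>I + I\<^sub>\<rho>\<close> at a
  prime properly contained in \<open>P\<close>.  If \<open>K\<close> is so deep that the components of \<open>I + I\<^sub>\<rho>\<close> at \<open>P\<close>
  contain it, then up to a factor outside of \<open>P\<close> an element of \<open>Y\<close> in the component of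
  \<open>I + I\<^sub>\<rho> + K\<close> lies in all components of \<open>I + I\<^sub>\<rho>\<close>.\<close>

lemma embedded_component:
  assumes I: "binomial_ideal_in nonneg_vecs I" and ass: "associated_prime R I P"
  defines "I' \<equiv> \<lambda>K. Idl\<^bsub>R\<^esub> (I <+>\<^bsub>R\<^esub> char_ideal L \<rho> <+>\<^bsub>R\<^esub> K)"
  shows "\<exists>e::nat. \<forall>K. monomial_ideal_with_powers J K \<and> K \<subseteq> var_ideal J [^]\<^bsub>ideals_set poly_ring\<^esub> e \<longrightarrow>
      K \<noteq> carrier (semigroup_ring (coord_submonoid (- J))) \<and>
      valid_primary_component R I P (component_candidate J L (I' K))"
proof -
  let ?S = "semigroup_ring (local_monoid J) :: 'n laurent ring"
  have Ii: "ideal I R" by (rule nonneg.binomial_ideal_in_ideal[OF I])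
  have IP: "I \<subseteq> P" by (rule associated_prime_superset[OF Ii ass])
  obtain \<Q> where dec: "irredundant_primary_decomposition R I \<Q>"
    using nonneg.SR.noetherian_irredundant_decomposition[OF noetherian_R Ii] by blast
  have fin: "finite \<Q>" and prim: "\<And>Q. Q \<in> \<Q> \<Longrightarrow> primary_ideal R Q" and Int: "carrier R \<inter> \<Inter>\<Q> = I"
    using dec by (auto simp: irredundant_primary_decomposition_def)
  obtain Q0 where Q0: "Q0 \<in> \<Q>" "radical R Q0 = P"
    using nonneg.SR.associated_prime_in_radicals[OF fin prim Int ass] by blast
  have Q0i: "ideal Q0 R" using prim[OF Q0(1)] by (simp add: primary_ideal_def)
  define Y where "Y = carrier R \<inter> \<Inter>(\<Q> - {Q0})"
  have Yi: "ideal Y R"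
    unfolding nonneg.ideal_semigroup_ring_iff
  proof (intro conjI ballI allI impI)
    have id: "ideal Q R" if "Q \<in> \<Q> - {Q0}" for Q using prim that by (simp add: primary_ideal_def)
    show "0 \<in> Y" using nonneg.ideal_zero[OF id] by (simp add: Y_def)
    show "a + b \<in> Y" if "a \<in> Y" "b \<in> Y" for a b
      using that nonneg.ideal_add[OF id] nonneg.keys_add_subset[of a b] by (auto simp: Y_def)
    show "x * a \<in> Y" if "a \<in> Y" "keys x \<subseteq> nonneg_vecs" for a x
      using that nonneg.ideal_mult[OF id] nonneg.keys_mult_subset[of x a] by (auto simp: Y_def)
  qed (auto simp: Y_def)
  have YQ0: "f \<in> I" if "f \<in> Y" "f \<in> Q0" for f
    using that Int Q0(1) by (auto simp: Y_def)
  have IY: "I \<subseteq> Y" using Int by (auto simp: Y_def)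
  have Pkill: "\<exists>n. p ^ n * f \<in> I" if p: "p \<in> P" and f: "f \<in> Y" for p f
  proof -
    obtain n where n: "keys p \<subseteq> nonneg_vecs" "p ^ n \<in> Q0" using p Q0(2)[symmetric] by (auto simp: radical_def)
    have "f * p ^ n \<in> Q0" using nonneg.ideal_mult[OF Q0i n(2)] nonneg.ideal_keys[OF Yi f] by blast
    moreover have "p ^ n * f \<in> Y" using nonneg.ideal_mult[OF Yi f nonneg.keys_power_subset[OF n(1)]] .
    ultimately show ?thesis using YQ0 by (metis mult.commute)
  qed
  have Q0cancel: "f \<in> Q0" if "keys f \<subseteq> nonneg_vecs" "keys s \<subseteq> nonneg_vecs" "s \<notin> P" "s * f \<in> Q0" for f s
    using nonneg.SR.primary_cancel[OF prim[OF Q0(1)], of f s] that Q0(2) by (simp add: mult.commute)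
  define I1 where "I1 = I <+>\<^bsub>R\<^esub> char_ideal L \<rho>"
  have I1b: "binomial_ideal_in nonneg_vecs I1"
    unfolding I1_def by (rule nonneg.binomial_ideal_in_sum[OF I char_ideal_binomial])
  have I1i: "ideal I1 R" by (rule nonneg.binomial_ideal_in_ideal[OF I1b])
  have I1sub: "I \<subseteq> I1" "char_ideal L \<rho> \<subseteq> I1"
    unfolding I1_def by (rule nonneg.ideal_sum_set[OF Ii char_ideal_ideal])+
  have YI1: "f \<in> I" if f: "f \<in> Y" "f \<in> I1" for f
  proof -
    have fk: "keys f \<subseteq> nonneg_vecs" by (rule nonneg.ideal_keys[OF Yi f(1)])
    have extended: "g \<in> Idl\<^bsub>?S\<^esub> A" if "ideal A R" "g \<in> A" for g A
    proof -
      have "single (shift J 0) 1 * g \<in> A" using \<open>g \<in> A\<close> by simp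
      moreover have "keys g \<subseteq> local_monoid J" using nonneg.ideal_keys[OF that] nonneg_subset_local by blast
      ultimately show ?thesis unfolding Idl_local_iff[OF that(1)] by blast
    qed
    have "lattice_binomial \<rho> u * f \<in> Idl\<^bsub>?S\<^esub> I" if u: "u \<in> L" for u
    proof -
      obtain n where "(single (pos_part u) 1 - single (neg_part u) (\<rho> u)) ^ n * f \<in> I"
        using Pkill[OF _ f(1)] char_gen_mem[OF u] char_ideal_subset by blast
      from extended[OF Ii this] show ?thesis
        by (rule char_gen_power_cancel[OF binomial_ideal_in_local[OF I] u, rotated])
          (use fk nonneg_subset_local in blast)
    qed
    from killed_by_lattice_ideal[OF I this extended[OF I1i f(2), unfolded I1_def]]
    obtain k where "single (shift J k) 1 * f \<in> I" by (auto simp: Idl_local_iff[OF Ii])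
    then have "single (shift J k) 1 * f \<in> Q0" using Int Q0(1) by blast
    then have "f \<in> Q0" using Q0cancel[OF fk] shift_nonneg shift_notin_char_prime by force
    then show ?thesis using YQ0 f(1) by blast
  qed
  obtain \<Q>1 where fin1: "finite \<Q>1" and prim1: "\<And>Q. Q \<in> \<Q>1 \<Longrightarrow> primary_ideal R Q"
    and Int1: "carrier R \<inter> \<Inter>\<Q>1 = I1"
    using nonneg.SR.noetherian_primary_decomposition[OF noetherian_R I1i] by blast
  have id1: "ideal Q R" if "Q \<in> \<Q>1" for Q using prim1[OF that] by (simp add: primary_ideal_def)
  have "\<exists>e::nat. radical R Q = P \<longrightarrow> (\<forall>v\<in>nonneg_vecs. outside_degree J v \<ge> int e \<longrightarrow> monomial v \<in> Q)"
    if Q: "Q \<in> \<Q>1" for Q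
  proof (cases "radical R Q = P")
    case True
    have "\<exists>n. variable j ^ n \<in> Q" if j: "j \<notin> J" for j
    proof -
      have "variable j \<in> radical R Q" using True variable_mem[OF j] var_ideal_subset by blast
      then show ?thesis by (auto simp: radical_def)
    qed
    then show ?thesis using high_degree_monomials[OF id1[OF Q], of J] by blast
  qed simp
  then obtain e :: "'n laurent set \<Rightarrow> nat" where e: "\<And>Q v. Q \<in> \<Q>1 \<Longrightarrow> radical R Q = P \<Longrightarrow>
      v \<in> nonneg_vecs \<Longrightarrow> outside_degree J v \<ge> int (e Q) \<Longrightarrow> monomial v \<in> Q" by metis
  \<comment> \<open>at least \<open>1\<close>, so that the unit ideal is excluded as a choice of \<open>K\<close>\<close>
  define E where "E = Suc (\<Sum>Q\<in>\<Q>1. e Q)"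
  have eE: "e Q \<le> E" if "Q \<in> \<Q>1" for Q
    using member_le_sum[of Q \<Q>1 e] fin1 that by (simp add: E_def)
  have "K \<noteq> carrier (semigroup_ring (coord_submonoid (- J))) \<and>
      valid_primary_component R I P (component_candidate J L (I' K))"
    if K: "monomial_ideal_with_powers J K" and KE: "K \<subseteq> var_ideal J [^]\<^bsub>ideals_set poly_ring\<^esub> E" for K
  proof
    have deg: "outside_degree J a \<ge> int E" if "monomial a \<in> K" for a
      using outside_degree_power[of "monomial a" J E] that KE by (auto simp: monomial_eq_single)
    show Kn: "K \<noteq> carrier (semigroup_ring (coord_submonoid (- J)))"
    proof
      assume "K = carrier (semigroup_ring (coord_submonoid (- J)))"
      then have "monomial 0 \<in> K" using coord.zero_mem[of "- J"] by (simp add: monomial_eq_single)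
      from deg[OF this] have "E = 0" by (simp add: outside_degree_def)
      then show False by (simp add: E_def)
    qed
    note trunc = truncated_component[OF I IP K Kn, folded I'_def]
    let ?C = "nonneg.SR.local_kernel (I' K) P"
    have IK: "ideal (I' K) R" "I \<subseteq> I' K" using trunc unfolding I'_def by auto
    have min: "minimal_prime_over R (I' K) P" using trunc(1) unfolding I'_def .
    have C_eq: "component_candidate J L (I' K) = ?C"
      using trunc(2) nonneg.SR.primary_component_eq_local_kernel[OF IK(1) prime] unfolding I'_def by simp
    have IKP: "I' K \<subseteq> P" using min by (simp add: minimal_prime_over_def)
    note nil = nonneg.SR.minimal_prime_nilpotent[OF noetherian_R IK(1) min]
    note primC = nonneg.SR.local_kernel_primary[OF IK(1) prime IKP nil]
    have "f \<in> I" if f: "f \<in> Y" "f \<in> ?C" for f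
    proof -
      obtain s where s: "keys s \<subseteq> nonneg_vecs" "s \<notin> P" "s * f \<in> I' K" using f(2) by (auto simp: nonneg.SR.local_kernel_def)
      have fk: "keys f \<subseteq> nonneg_vecs" by (rule nonneg.ideal_keys[OF Yi f(1)])
      have inQ: "f \<in> Q" if Q: "Q \<in> \<Q>1" "Q \<subseteq> P" for Q
      proof (cases "radical R Q = P")
        case True
        have "I' K \<subseteq> Q" unfolding I'_def
        proof (rule truncated_component(6)[OF I IP K Kn id1[OF Q(1)]])
          show "I \<subseteq> Q" "char_ideal L \<rho> \<subseteq> Q" using I1sub Int1 Q(1) by blast+
          show "monomial a \<in> Q" if "a \<in> coord_submonoid (- J)" "monomial a \<in> K" for a
            using e[OF Q(1) True, of a] deg[OF that(2)] eE[OF Q(1)] that(1) by (auto simp: coord_submonoid_def)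
        qed
        then have "s * f \<in> Q" using s(3) by blast
        then show ?thesis
          using nonneg.SR.primary_cancel[OF prim1[OF Q(1)], of f s] fk s(1,2) True by (simp add: mult.commute)
      next
        case False
        have "radical R Q \<subseteq> P" by (rule nonneg.SR.radical_subset_prime[OF prime Q(2)])
        then obtain p where p: "p \<in> P" "p \<notin> radical R Q" using False by blast
        obtain n where "p ^ n * f \<in> I" using Pkill[OF p(1) f(1)] by blast
        then have "f * p ^ n \<in> Q" using I1sub(1) Int1 Q(1) by (auto simp: mult.commute)
        moreover have pk: "keys p \<subseteq> nonneg_vecs" by (rule nonneg.ideal_keys[OF char_prime_ideal p(1)])
        moreover have "p ^ n \<notin> radical R Q"
          using nonneg.SR.prime_power[OF nonneg.SR.radical_primary_prime[OF prim1[OF Q(1)]], of p n] pk p(2) by auto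
        ultimately show ?thesis
          using nonneg.SR.primary_cancel[OF prim1[OF Q(1)], of f "p ^ n"] fk nonneg.keys_power_subset[OF pk, of n] by simp
      qed
      have "\<exists>r\<in>carrier R - P. r \<in> \<Inter>{Q \<in> \<Q>1. \<not> Q \<subseteq> P}"
        by (rule nonneg.SR.prime_contains_Inter[OF prime]) (use fin1 id1 in simp_all)
      then obtain r where r: "keys r \<subseteq> nonneg_vecs" "r \<notin> P" "r \<in> \<Inter>{Q \<in> \<Q>1. \<not> Q \<subseteq> P}" by auto
      have "r * f \<in> Q" if Q: "Q \<in> \<Q>1" for Q
      proof (cases "Q \<subseteq> P")
        case True
        then show ?thesis using nonneg.ideal_mult[OF id1[OF Q] inQ[OF Q True] r(1)] by blast
      next
        case False
        then have "r \<in> Q" using r(3) Q by blast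
        from nonneg.ideal_mult[OF id1[OF Q] this fk] show ?thesis by (simp add: mult.commute)
      qed
      moreover have "keys (r * f) \<subseteq> nonneg_vecs" by (rule nonneg.keys_mult_subset[OF r(1) fk])
      ultimately have "r * f \<in> I1" using Int1 by auto
      moreover have "r * f \<in> Y" by (rule nonneg.ideal_mult[OF Yi f(1) r(1)])
      ultimately have "r * f \<in> I" using YI1 by blast
      then have "r * f \<in> Q0" using Int Q0(1) by blast
      then have "f \<in> Q0" by (rule Q0cancel[OF fk r(1,2)])
      then show ?thesis using YQ0 f(1) by blast
    qed
    moreover have "I \<subseteq> ?C" using IK(2) nonneg.SR.subset_local_kernel[OF IK(1) prime] by blast
    ultimately have "Y \<inter> ?C = I" using IY by blast
    then have "valid_primary_component R I (radical R Q0) ?C"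
      unfolding Y_def using primC Q0(2) by (intro nonneg.SR.exchange_primary_component[OF dec Q0(1)]) auto
    then show "valid_primary_component R I P (component_candidate J L (I' K))" by (simp add: Q0(2) C_eq)
  qed
  then show ?thesis by blast
qed

end

theorem theorem3p2:
  fixes I :: "('n::finite) laurent set"
    and J :: "'n set"
    and L :: "(int ^ 'n) set"
    and \<rho> :: "int ^ 'n \<Rightarrow> complex"
  assumes "binomial_ideal I"
    and "partial_character L \<rho>"
    and "saturated L"
    and "L \<subseteq> coord_subgroup J"
    and "associated_prime poly_ring I (char_prime L \<rho> J)"
  defines "P \<equiv> char_prime L \<rho> J"
    and "I\<^sub>\<rho> \<equiv> I <+>\<^bsub>poly_ring\<^esub> char_ideal L \<rho>"
    and "I\<^sub>K \<equiv> \<lambda>K. Idl\<^bsub>poly_ring\<^esub> (I <+>\<^bsub>poly_ring\<^esub> char_ideal L \<rho> <+>\<^bsub>poly_ring\<^esub> K)"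
  shows
    "(minimal_prime_over poly_ring I P \<longrightarrow>
        primary_component poly_ring I P = component_candidate J L I\<^sub>\<rho> \<and>
        {u \<in> nonneg_vecs. monomial u \<in> component_candidate J L I\<^sub>\<rho>} = infinite_classes J L I\<^sub>\<rho>) \<and>
     (\<forall>K. monomial_ideal_with_powers J K \<and> K \<noteq> carrier (semigroup_ring (coord_submonoid (- J))) \<longrightarrow>
        minimal_prime_over poly_ring (I\<^sub>K K) P \<and>
        primary_component poly_ring (I\<^sub>K K) P = component_candidate J L (I\<^sub>K K) \<and>
        {u \<in> nonneg_vecs. monomial u \<in> component_candidate J L (I\<^sub>K K)} = infinite_classes J L (I\<^sub>K K)) \<and>
     (\<exists>e::nat. \<forall>K. monomial_ideal_with_powers J K \<and> K \<subseteq> var_ideal J [^]\<^bsub>ideals_set poly_ring\<^esub> e \<longrightarrow>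
        valid_primary_component poly_ring I P (component_candidate J L (I\<^sub>K K)) \<and>
        {u \<in> nonneg_vecs. monomial u \<in> component_candidate J L (I\<^sub>K K)} = infinite_classes J L (I\<^sub>K K))"
proof -
  have ass: "associated_prime (semigroup_ring nonneg_vecs) I (char_prime L \<rho> J)"
    using assms(5) by (simp add: poly_ring_def)
  then have prime: "primeideal (char_prime L \<rho> J) (semigroup_ring nonneg_vecs)"
    unfolding associated_prime_def by (rule conjunct1)
  interpret L: lattice_prime J L \<rho>
    by (rule lattice_prime.intro[OF lattice_character.intro[OF assms(2-4)] lattice_prime_axioms.intro[OF prime]])
  have I: "binomial_ideal_in nonneg_vecs I" using assms(1) by (simp add: binomial_ideal_iff)
  obtain e where e: "\<And>K. monomial_ideal_with_powers J K \<Longrightarrow> K \<subseteq> var_ideal J [^]\<^bsub>ideals_set poly_ring\<^esub> (e::nat) \<Longrightarrow>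
      K \<noteq> carrier (semigroup_ring (coord_submonoid (- J))) \<and>
      valid_primary_component poly_ring I P (component_candidate J L (I\<^sub>K K))"
    using L.embedded_component[OF I ass] unfolding P_def I\<^sub>K_def poly_ring_def by blast
  have IP: "I \<subseteq> char_prime L \<rho> J"
    by (rule associated_prime_superset[OF nonneg.binomial_ideal_in_ideal[OF I] ass])
  have 1: "minimal_prime_over poly_ring I P \<longrightarrow>
      primary_component poly_ring I P = component_candidate J L I\<^sub>\<rho> \<and>
      {u \<in> nonneg_vecs. monomial u \<in> component_candidate J L I\<^sub>\<rho>} = infinite_classes J L I\<^sub>\<rho>"
    using L.minimal_prime_component[OF I] unfolding P_def I\<^sub>\<rho>_def poly_ring_def by blast
  have 2: "minimal_prime_over poly_ring (I\<^sub>K K) P \<and>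
      primary_component poly_ring (I\<^sub>K K) P = component_candidate J L (I\<^sub>K K) \<and>
      {u \<in> nonneg_vecs. monomial u \<in> component_candidate J L (I\<^sub>K K)} = infinite_classes J L (I\<^sub>K K)"
    if "monomial_ideal_with_powers J K" "K \<noteq> carrier (semigroup_ring (coord_submonoid (- J)))" for K
    using L.truncated_component(1-3)[OF I IP that] unfolding P_def I\<^sub>K_def poly_ring_def by blast
  show ?thesis using 1 2 e by blast
qed

end
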